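(* Let $m,n\in\mathbb{N}$ and let $\{u(k,\cdot):\mathbb{R}^n\to\mathbb{C}\}_{k\in\mathbb{Z}^m}$ be a sequence of measurable functions for which there exist $N,C>0$ such that $$|u(k,\xi)|\leq C(1+|k|^2)^{N/2}(1+|\xi|^2)^{N/2}$$ for all $(k,\xi)\in\mathbb{Z}^m\times\mathbb{R}^n$. Then $\mathcal{F}_{\mathbb{R}^n}^{-1}(\mathcal{F}_{\mathbb{T}^m}^{-1}(u))$ is well defined and belongs to $\mathcal{S}'(\mathbb{T}^m\times\mathbb{R}^n)$. Furthermore, $$\mathcal{F}_{\mathbb{T}^m}\big(\mathcal{F}_{\mathbb{R}^n}(\mathcal{F}_{\mathbb{R}^n}^{-1}(\mathcal{F}_{\mathbb{T}^m}^{-1}(u)))\big)=u$$ in the sense of distributions (that is, for each $k\in\mathbb{Z}^m$, both sides are equal as elements of $\mathcal{S}'(\mathbb{R}^n)$).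
   Context: $\mathbb{T}^m=(\mathbb{R}/2\pi\mathbb{Z})^m$, with variables $(t,x)\in\mathbb{T}^m\times\mathbb{R}^n$; $\mathbb{N}_0$ denotes the nonnegative integers. $\mathcal{S}(\mathbb{T}^m\times\mathbb{R}^n)$ is the Fréchet space of all $f\in C^\infty(\mathbb{T}^m\times\mathbb{R}^n)$ such that $\|f\|_{\alpha,\beta,\gamma}:=\sup_{(t,x)}|x^\gamma\partial_t^\alpha\partial_x^\beta f(t,x)|<+\infty$ for all $\alpha\in\mathbb{N}_0^m$, $\beta,\gamma\in\mathbb{N}_0^n$, with seminorms $p_N(f):=\sum_{|\alpha|+|\beta|+|\gamma|\leq N}\|f\|_{\alpha,\beta,\gamma}$; $\mathcal{S}'(\mathbb{T}^m\times\mathbb{R}^n)$ is its topological dual. Each $u(k,\cdot)$ is viewed as the tempered distribution $f\mapsto\int_{\mathbb{R}^n}u(k,\xi)f(\xi)\,d\xi$ on $\mathbb{R}^n$. For $f\in\mathcal{S}(\mathbb{T}^m\times\mathbb{R}^n)$: $\mathcal{F}_{\mathbb{T}^m}(f)(k,x)=\widehat{f}(k,x):=\frac{1}{(2\pi)^m}\int_{[0,2\pi]^m}f(t,x)e^{-ik\cdot t}\,dt$, $\mathcal{F}_{\mathbb{R}^n}(f)(t,\xi):=\int_{\mathbb{R}^n}f(t,x)e^{-ix\cdot\xi}\,dx$, and $\mathcal{F}_{\mathbb{R}^n}^{-1}(f)(t,x):=\frac{1}{(2\pi)^n}\int_{\mathbb{R}^n}f(t,\xi)e^{ix\cdot\xi}\,d\xi$;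 $\mathcal{F}_{\mathbb{R}^n}^{\pm1}$ map $\mathcal{S}(\mathbb{T}^m\times\mathbb{R}^n)$ to itself. For $v\in\mathcal{S}'(\mathbb{T}^m\times\mathbb{R}^n)$: $\langle\mathcal{F}_{\mathbb{R}^n}^{\pm1}(v),f\rangle=\langle v,\mathcal{F}_{\mathbb{R}^n}^{\pm1}(f)\rangle$ for $f\in\mathcal{S}(\mathbb{T}^m\times\mathbb{R}^n)$, and $\mathcal{F}_{\mathbb{T}^m}(v)(k,\cdot)\in\mathcal{S}'(\mathbb{R}^n)$ is defined by $\langle\mathcal{F}_{\mathbb{T}^m}(v)(k,\cdot),f\rangle=\frac{1}{(2\pi)^m}\langle v(t,x),e^{-ik\cdot t}f(x)\rangle$ for $f\in\mathcal{S}(\mathbb{R}^n)$. For a sequence $\{u(k,\cdot)\in\mathcal{S}'(\mathbb{R}^n)\}_{k\in\mathbb{Z}^m}$, $\mathcal{F}_{\mathbb{T}^m}^{-1}(u)$ is the distribution defined by $\langle\mathcal{F}_{\mathbb{T}^m}^{-1}(u),f\rangle=(2\pi)^m\sum_{k\in\mathbb{Z}^m}\langle u(k,x),\widehat{f}(-k,x)\rangle$ for $f\in\mathcal{S}(\mathbb{T}^m\times\mathbb{R}^n)$, when this series converges and defines an element of $\mathcal{S}'(\mathbb{T}^m\times\mathbb{R}^n)$. *)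

theory Defs
  imports "HOL-Analysis.Analysis"
begin

section \<open>Smooth functions and partial derivatives\<close>

definition dir_deriv :: "'a::real_normed_vector \<Rightarrow> ('a \<Rightarrow> complex) \<Rightarrow> 'a \<Rightarrow> complex" where
  "dir_deriv b f z = vector_derivative (\<lambda>s. f (z + s *\<^sub>R b)) (at 0)"

primrec cont_diff :: "nat \<Rightarrow> ('a::euclidean_space \<Rightarrow> complex) \<Rightarrow> bool" where
  "cont_diff 0 f \<longleftrightarrow> continuous_on UNIV f"
| "cont_diff (Suc r) f \<longleftrightarrow>
     f differentiable_on UNIV \<and> (\<forall>b\<in>Basis. cont_diff r (dir_deriv b f))"

definition smooth :: "('a::euclidean_space \<Rightarrow> complex) \<Rightarrow> bool" where
  "smooth f \<longleftrightarrow> (\<forall>r. cont_diff r f)"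

text \<open>Multi-indices are functions from a finite index type to the naturals.  The iterated
  derivative needs some enumeration of the index type; for smooth functions, the only ones to
  which it is applied, the result does not depend on it, since partial derivatives commute.\<close>

definition index_list :: "'i::finite list" where
  "index_list = (SOME is. distinct is \<and> set is = UNIV)"

definition multi_deriv ::
    "('i::finite \<Rightarrow> 'a::real_normed_vector) \<Rightarrow> ('i \<Rightarrow> nat) \<Rightarrow> ('a \<Rightarrow> complex) \<Rightarrow> 'a \<Rightarrow> complex" where
  "multi_deriv e \<alpha> f = foldr (\<lambda>i. dir_deriv (e i) ^^ \<alpha> i) index_list f"

definition multi_order :: "('i::finite \<Rightarrow> nat) \<Rightarrow> nat" where
  "multi_order \<alpha> = (\<Sum>i\<in>UNIV. \<alpha> i)"

definition multi_power :: "real^'n \<Rightarrow> ('n \<Rightarrow> nat) \<Rightarrow> real" where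
  "multi_power x \<gamma> = (\<Prod>j\<in>UNIV. (x $ j) ^ \<gamma> j)"


section \<open>Topological duals of spaces given by seminorms\<close>

definition seminorm_topology ::
    "('a \<Rightarrow> complex) set \<Rightarrow> (nat \<Rightarrow> ('a \<Rightarrow> complex) \<Rightarrow> real) \<Rightarrow> ('a \<Rightarrow> complex) topology" where
  "seminorm_topology S p =
     topology_generated_by
       {{g \<in> S. p r (\<lambda>z. g z - f z) < \<epsilon>} | f r \<epsilon>. f \<in> S \<and> \<epsilon> > 0}"

text \<open>Functionals are extensional, i.e. take the dummy value \<open>undefined\<close> outside of \<open>S\<close>, so that
  equality of functions is equality of functionals on \<open>S\<close>.\<close>

definition topological_dual ::
    "('a \<Rightarrow> complex) set \<Rightarrow> (nat \<Rightarrow> ('a \<Rightarrow> complex) \<Rightarrow> real) \<Rightarrow> (('a \<Rightarrow> complex) \<Rightarrow> complex) set" where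
  "topological_dual S p =
     {v \<in> extensional S.
        (\<forall>f\<in>S. \<forall>g\<in>S. v (\<lambda>z. f z + g z) = v f + v g) \<and>
        (\<forall>c. \<forall>f\<in>S. v (\<lambda>z. c * f z) = c * v f) \<and>
        continuous_map (seminorm_topology S p) euclidean v}"


section \<open>Schwartz functions and tempered distributions on $\mathbb{R}^n$\<close>

definition weighted_R :: "('n \<Rightarrow> nat) \<Rightarrow> ('n \<Rightarrow> nat) \<Rightarrow> (real^'n \<Rightarrow> complex) \<Rightarrow> real^'n \<Rightarrow> real" where
  "weighted_R \<beta> \<gamma> f x =
     cmod (of_real (multi_power x \<gamma>) * multi_deriv (\<lambda>j. axis j 1) \<beta> f x)"

definition schwartz_R :: "(real^'n \<Rightarrow> complex) set" where
  "schwartz_R = {f. smooth f \<and> (\<forall>\<beta> \<gamma>. bdd_above (range (weighted_R \<beta> \<gamma> f)))}"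

definition seminorm_R :: "nat \<Rightarrow> (real^'n \<Rightarrow> complex) \<Rightarrow> real" where
  "seminorm_R r f =
     (\<Sum>(\<beta>, \<gamma>) \<in> {(\<beta>, \<gamma>). multi_order \<beta> + multi_order \<gamma> \<le> r}. (SUP x. weighted_R \<beta> \<gamma> f x))"

definition tempered_R :: "((real^'n \<Rightarrow> complex) \<Rightarrow> complex) set" where
  "tempered_R = topological_dual schwartz_R seminorm_R"

text \<open>The Lebesgue completion admits densities that are Lebesgue but not Borel measurable; the
  transforms of (continuous) Schwartz functions below use \<open>lborel\<close>, where this is immaterial.\<close>

definition distribution_of :: "(real^'n \<Rightarrow> complex) \<Rightarrow> (real^'n \<Rightarrow> complex) \<Rightarrow> complex" where
  "distribution_of w = (\<lambda>f\<in>schwartz_R. LINT \<xi>|lebesgue. w \<xi> * f \<xi>)"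


section \<open>Schwartz functions and tempered distributions on $\mathbb{T}^m\times\mathbb{R}^n$\<close>

text \<open>Functions on $\mathbb{T}^m\times\mathbb{R}^n$ are represented by their lifts to
  $\mathbb{R}^m\times\mathbb{R}^n$, which are $2\pi$-periodic in each of the first \<open>m\<close> variables.\<close>

definition periodic_T :: "((real^'m) \<times> (real^'n) \<Rightarrow> complex) \<Rightarrow> bool" where
  "periodic_T f \<longleftrightarrow> (\<forall>t x i. f (t + axis i (2 * pi), x) = f (t, x))"

definition weighted_TR ::
    "('m \<Rightarrow> nat) \<Rightarrow> ('n \<Rightarrow> nat) \<Rightarrow> ('n \<Rightarrow> nat) \<Rightarrow>
     ((real^'m) \<times> (real^'n) \<Rightarrow> complex) \<Rightarrow> (real^'m) \<times> (real^'n) \<Rightarrow> real" where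
  "weighted_TR \<alpha> \<beta> \<gamma> f z =
     cmod (of_real (multi_power (snd z) \<gamma>) *
       multi_deriv (\<lambda>i. (axis i 1, 0)) \<alpha> (multi_deriv (\<lambda>j. (0, axis j 1)) \<beta> f) z)"

definition schwartz_TR :: "((real^'m) \<times> (real^'n) \<Rightarrow> complex) set" where
  "schwartz_TR =
     {f. periodic_T f \<and> smooth f \<and> (\<forall>\<alpha> \<beta> \<gamma>. bdd_above (range (weighted_TR \<alpha> \<beta> \<gamma> f)))}"

definition seminorm_TR :: "nat \<Rightarrow> ((real^'m) \<times> (real^'n) \<Rightarrow> complex) \<Rightarrow> real" where
  "seminorm_TR r f =
     (\<Sum>(\<alpha>, \<beta>, \<gamma>) \<in> {(\<alpha>, \<beta>, \<gamma>). multi_order \<alpha> + multi_order \<beta> + multi_order \<gamma> \<le> r}.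
        (SUP z. weighted_TR \<alpha> \<beta> \<gamma> f z))"

definition tempered_TR :: "(((real^'m) \<times> (real^'n) \<Rightarrow> complex) \<Rightarrow> complex) set" where
  "tempered_TR = topological_dual schwartz_TR seminorm_TR"


section \<open>Fourier transforms of functions\<close>

definition real_vec :: "int^'m \<Rightarrow> real^'m" where
  "real_vec k = (\<chi> i. of_int (k $ i))"

definition fourier_T ::
    "((real^'m) \<times> (real^'n) \<Rightarrow> complex) \<Rightarrow> int^'m \<Rightarrow> real^'n \<Rightarrow> complex" where
  "fourier_T f k x =
     of_real (1 / (2 * pi) ^ CARD('m)) *
     (LINT t:cbox 0 (\<chi> i. 2 * pi)|lborel. f (t, x) * cis (- (real_vec k \<bullet> t)))"

definition fourier_R ::
    "((real^'m) \<times> (real^'n) \<Rightarrow> complex) \<Rightarrow> (real^'m) \<times> (real^'n) \<Rightarrow> complex" where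
  "fourier_R f = (\<lambda>(t, \<xi>). LINT x|lborel. f (t, x) * cis (- (x \<bullet> \<xi>)))"

definition inv_fourier_R ::
    "((real^'m) \<times> (real^'n) \<Rightarrow> complex) \<Rightarrow> (real^'m) \<times> (real^'n) \<Rightarrow> complex" where
  "inv_fourier_R f =
     (\<lambda>(t, x). of_real (1 / (2 * pi) ^ CARD('n)) * (LINT \<xi>|lborel. f (t, \<xi>) * cis (x \<bullet> \<xi>)))"


section \<open>Fourier transforms of distributions\<close>

definition dist_fourier_R ::
    "(((real^'m) \<times> (real^'n) \<Rightarrow> complex) \<Rightarrow> complex) \<Rightarrow>
     ((real^'m) \<times> (real^'n) \<Rightarrow> complex) \<Rightarrow> complex" where
  "dist_fourier_R v = (\<lambda>f\<in>schwartz_TR. v (fourier_R f))"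

definition dist_inv_fourier_R ::
    "(((real^'m) \<times> (real^'n) \<Rightarrow> complex) \<Rightarrow> complex) \<Rightarrow>
     ((real^'m) \<times> (real^'n) \<Rightarrow> complex) \<Rightarrow> complex" where
  "dist_inv_fourier_R v = (\<lambda>f\<in>schwartz_TR. v (inv_fourier_R f))"

definition dist_fourier_T ::
    "(((real^'m) \<times> (real^'n) \<Rightarrow> complex) \<Rightarrow> complex) \<Rightarrow>
     int^'m \<Rightarrow> (real^'n \<Rightarrow> complex) \<Rightarrow> complex" where
  "dist_fourier_T v k =
     (\<lambda>f\<in>schwartz_R. of_real (1 / (2 * pi) ^ CARD('m)) *
        v (\<lambda>(t, x). cis (- (real_vec k \<bullet> t)) * f x))"

text \<open>The series over \<open>\<int>\<^sup>m\<close> is an unordered sum.  Its convergence is not part of the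
  definition (\<open>infsum\<close> is \<open>0\<close> for a divergent series) and has to be asserted separately.\<close>

definition dist_inv_fourier_T ::
    "(int^'m \<Rightarrow> (real^'n \<Rightarrow> complex) \<Rightarrow> complex) \<Rightarrow>
     ((real^'m) \<times> (real^'n) \<Rightarrow> complex) \<Rightarrow> complex" where
  "dist_inv_fourier_T U =
     (\<lambda>f\<in>schwartz_TR. of_real ((2 * pi) ^ CARD('m)) * (\<Sum>\<^sub>\<infinity>k. U k (fourier_T f (- k))))"

end

theory Submission
  imports Defs "HOL-Probability.Characteristic_Functions" "HOL-Probability.Sinc_Integral"
begin

text \<open>Write \<open>S\<close> for the space of Schwartz functions on the product, \<open>F\<close> for the Fourier transform in the
Euclidean variable and \<open>w x = (\<Prod>j. 1 + x\<^sub>j\<^sup>2)\<close> for a product weight.  The weight dominates \<open>1 + |x|\<^sup>2\<close>, and both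
the integral of \<open>1 / w\<close> over the Euclidean space and the sum of \<open>1 / w\<close> over the integer lattice are finite,
because they factor into one-dimensional integrals and sums (\<open>integrable_inverse_weight\<close>,
\<open>summable_inverse_frequency_weight\<close>).

The Fourier coefficient of \<open>f\<close> at frequency \<open>k\<close>, taken at \<open>x\<close>, is bounded by a continuous seminorm of \<open>f\<close>
times any negative power of \<open>w k\<close> and of \<open>w x\<close> (\<open>controlled_fourier_T\<close>): powers of \<open>w x\<close> are absorbed into \<open>f\<close>,
and powers of \<open>w k\<close> come from integration by parts on the torus.  A density that grows at most like
\<open>w k ^ A * w x ^ A\<close> can therefore be paired with the coefficients: one spare power of \<open>w x\<close> makes the integral converge
and one of \<open>w k\<close> the sum.  Hence the series converges absolutely and its value is bounded by a
continuous seminorm of \<open>f\<close>, which makes it a tempered distribution (\<open>controlled_dist_inv_fourier_T\<close>,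
\<open>tempered_TR_I\<close>).

The transforms of distributions are transposes, so the other claims are about operators on \<open>S\<close>.  Continuity of
\<open>F\<close> and of its inverse follows from one criterion (\<open>cts_op_by_commutators\<close>): an operator is continuous on \<open>S\<close>
as soon as its values are controlled in the weighted sup norms without derivatives and differentiating
its value at \<open>f\<close> amounts, up to a continuous correction, to applying the operator to another function that depends
continuously on \<open>f\<close>.
The same criterion handles multiplication by coordinates and characters, and averaging over the torus.

For the inversion formula, unfolding the four transposes on a test function \<open>f\<close> of \<open>x\<close> alone leaves the series
evaluated at \<open>inv_fourier_R (fourier_R h)\<close> with \<open>h (t, x) = cis (- (k \<bullet> t)) * f x\<close>.  Fourier inversion for Schwartz functions, proved by
Gaussian regularisation, turns this into \<open>h\<close> (\<open>inv_fourier_R_fourier_R\<close>).  By orthogonality of characters all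
Fourier coefficients of \<open>h\<close> vanish except the one at frequency \<open>- k\<close>, which is \<open>f\<close> (\<open>fourier_T_modulate_lift\<close>), so one term of the
series survives and it is the pairing of \<open>u k\<close> with \<open>f\<close> (\<open>dist_fourier_inversion\<close>).\<close>

section \<open>Directional derivatives and smoothness\<close>

definition has_line_deriv :: "('a::real_normed_vector \<Rightarrow> complex) \<Rightarrow> 'a \<Rightarrow> ('a \<Rightarrow> complex) \<Rightarrow> bool" where
  "has_line_deriv f b g \<longleftrightarrow> (\<forall>z. ((\<lambda>s. f (z + s *\<^sub>R b)) has_vector_derivative g z) (at 0))"

lemma has_line_deriv_at:
  assumes "has_line_deriv f b g"
  shows "((\<lambda>s. f (z + s *\<^sub>R b)) has_vector_derivative g (z + s *\<^sub>R b)) (at s within A)"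
proof -
  have 1: "((\<lambda>r. f ((z + s *\<^sub>R b) + r *\<^sub>R b)) has_vector_derivative g (z + s *\<^sub>R b)) (at (s - s))"
    using assms unfolding has_line_deriv_def by simp
  have 2: "((\<lambda>r. r - s) has_vector_derivative 1) (at s)"
    by (auto intro!: derivative_eq_intros)
  have "((\<lambda>r. f ((z + s *\<^sub>R b) + r *\<^sub>R b)) \<circ> (\<lambda>r. r - s) has_vector_derivative 1 *\<^sub>R g (z + s *\<^sub>R b)) (at s)"
    using vector_diff_chain_at[OF 2 1] by simp
  moreover have "((\<lambda>r. f ((z + s *\<^sub>R b) + r *\<^sub>R b)) \<circ> (\<lambda>r. r - s)) = (\<lambda>s. f (z + s *\<^sub>R b))"
    by (auto simp: fun_eq_iff algebra_simps)
  ultimately show ?thesis by (auto intro: has_vector_derivative_at_within)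
qed

lemma has_line_deriv_imp_dir_deriv: "has_line_deriv f b g \<Longrightarrow> dir_deriv b f = g"
  unfolding has_line_deriv_def dir_deriv_def by (auto intro!: vector_derivative_at)

lemma differentiable_imp_has_line_deriv:
  assumes "f differentiable_on UNIV"
  shows "has_line_deriv f b (dir_deriv b f)"
proof -
  have "((\<lambda>s. f (z + s *\<^sub>R b)) has_vector_derivative dir_deriv b f z) (at 0)" for z
  proof -
    have 1: "f differentiable at (z + 0 *\<^sub>R b)" using assms by (simp add: differentiable_on_def)
    have 2: "(\<lambda>s. z + s *\<^sub>R b) differentiable at (0::real)"
      by (intro derivative_intros)
    have "(f \<circ> (\<lambda>s. z + s *\<^sub>R b)) differentiable at (0::real)"
      using 1 2 by (rule differentiable_chain_at[rotated])
    then show ?thesis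
      unfolding dir_deriv_def o_def using vector_derivative_works by blast
  qed
  then show ?thesis by (simp add: has_line_deriv_def)
qed

text \<open>The classical criterion that continuous partial derivatives imply total differentiability: move from
\<open>z\<close> to \<open>y\<close> along one coordinate direction after the other and apply the mean value inequality on each
segment.  All intermediate points stay within distance \<open>norm (y - z)\<close> of \<open>z\<close>.\<close>

lemma line_derivs_imp_has_derivative:
  fixes f :: "'a::euclidean_space \<Rightarrow> complex"
  assumes d: "\<And>b. b \<in> Basis \<Longrightarrow> has_line_deriv f b (g b)"
    and c: "\<And>b. b \<in> Basis \<Longrightarrow> continuous_on UNIV (g b)"
  shows "(f has_derivative (\<lambda>h. \<Sum>b\<in>Basis. (h \<bullet> b) *\<^sub>R g b z)) (at z)"
proof -
  have lin: "bounded_linear (\<lambda>h. \<Sum>b\<in>Basis. (h \<bullet> b) *\<^sub>R g b z)"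
    by (intro bounded_linear_sum bounded_linear_scaleR_const bounded_linear_inner_left)
  \<comment> \<open>the error is at most \<open>\<epsilon>\<close> times the step length in each of the \<open>DIM('a)\<close> directions\<close>
  have key: "\<exists>\<delta>>0. \<forall>y. norm (y - z) < \<delta> \<longrightarrow>
      norm (f y - f z - (\<Sum>b\<in>Basis. ((y - z) \<bullet> b) *\<^sub>R g b z)) \<le> e * norm (y - z)" if "e > 0" for e
  proof -
    define \<epsilon> where "\<epsilon> = e / DIM('a)"
    have "\<epsilon> > 0" using that by (simp add: \<epsilon>_def)
    have "\<exists>\<delta>>0. \<forall>y. dist y z < \<delta> \<longrightarrow> dist (g b y) (g b z) < \<epsilon>" if "b \<in> Basis" for b
      using c[OF that] \<open>\<epsilon> > 0\<close> unfolding continuous_on_iff by auto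
    then obtain D where D: "\<And>b. b \<in> Basis \<Longrightarrow> D b > 0"
      "\<And>b y. b \<in> Basis \<Longrightarrow> dist y z < D b \<Longrightarrow> dist (g b y) (g b z) < \<epsilon>" by metis
    define \<delta> where "\<delta> = Min (D ` Basis)"
    have "\<delta> > 0" using D by (auto simp: \<delta>_def)
    have \<delta>: "dist (g b y) (g b z) < \<epsilon>" if "b \<in> Basis" "dist y z < \<delta>" for b y
      using that D by (auto simp: \<delta>_def)
    have "norm (f y - f z - (\<Sum>b\<in>Basis. ((y - z) \<bullet> b) *\<^sub>R g b z)) \<le> e * norm (y - z)"
      if y: "norm (y - z) < \<delta>" for y
    proof -
      define h where "h = y - z"
      \<comment> \<open>the point reached after the coordinates in \<open>A\<close> have been changed\<close>
      define p where "p A = (\<Sum>b\<in>A. (h \<bullet> b) *\<^sub>R b)" for A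
      have pn: "norm (p A + s *\<^sub>R b) \<le> norm h"
        if "A \<subseteq> Basis" "b \<in> Basis" "b \<notin> A" "\<bar>s\<bar> \<le> \<bar>h \<bullet> b\<bar>" for A b s
      proof (rule norm_le_componentwise)
        fix i :: 'a assume i: "i \<in> Basis"
        have fA: "finite A" using finite_subset[OF that(1) finite_Basis] .
        have "p A \<bullet> i = (\<Sum>b\<in>A. if b = i then h \<bullet> i else 0)"
          unfolding p_def inner_sum_left
          using i that(1) by (intro sum.cong refl) (auto simp: inner_Basis subset_iff)
        also have "\<dots> = (if i \<in> A then h \<bullet> i else 0)"
          using fA by simp
        finally have "p A \<bullet> i = (if i \<in> A then h \<bullet> i else 0)" .
        then show "\<bar>(p A + s *\<^sub>R b) \<bullet> i\<bar> \<le> \<bar>h \<bullet> i\<bar>"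
          using that i by (auto simp: inner_add_left inner_Basis)
      qed
      have "norm (f (z + p A) - f z - (\<Sum>b\<in>A. (h \<bullet> b) *\<^sub>R g b z)) \<le> card A * \<epsilon> * norm h"
        if "A \<subseteq> Basis" for A
        using finite_subset[OF that finite_Basis] that
      proof (induction A rule: finite_induct)
        case empty then show ?case by (simp add: p_def)
      next
        case (insert b A)
        have pi: "p (insert b A) = p A + (h \<bullet> b) *\<^sub>R b" using insert by (simp add: p_def add.commute)
        have "norm (f ((z + p A) + (h \<bullet> b) *\<^sub>R b) - f ((z + p A) + 0 *\<^sub>R b)
              - ((h \<bullet> b) - 0) *\<^sub>R g b z) \<le> norm (h \<bullet> b - 0) * \<epsilon>"
        proof -
          have "norm ((\<lambda>s. f ((z + p A) + s *\<^sub>R b) - s *\<^sub>R g b z) (h \<bullet> b) - (\<lambda>s. f ((z + p A) + s *\<^sub>R b) - s *\<^sub>R g b z) 0)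
             \<le> \<epsilon> * norm (h \<bullet> b - 0)"
          proof (rule differentiable_bound[where S="closed_segment 0 (h \<bullet> b)" and f'="\<lambda>s r. r *\<^sub>R (g b ((z + p A) + s *\<^sub>R b) - g b z)"])
            fix s assume s: "s \<in> closed_segment 0 (h \<bullet> b)"
            have hl: "has_line_deriv f b (g b)" using d insert by auto
            have "((\<lambda>s. f ((z + p A) + s *\<^sub>R b) - s *\<^sub>R g b z) has_vector_derivative
                 (g b ((z + p A) + s *\<^sub>R b) - g b z)) (at s within closed_segment 0 (h \<bullet> b))"
              by (auto intro!: derivative_eq_intros has_line_deriv_at[OF hl])
            then show "((\<lambda>s. f ((z + p A) + s *\<^sub>R b) - s *\<^sub>R g b z) has_derivative
                 (\<lambda>r. r *\<^sub>R (g b ((z + p A) + s *\<^sub>R b) - g b z))) (at s within closed_segment 0 (h \<bullet> b))"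
              by (simp add: has_vector_derivative_def)
            have "\<bar>s\<bar> \<le> \<bar>h \<bullet> b\<bar>" using s by (auto simp: closed_segment_eq_real_ivl split: if_splits)
            then have "norm (p A + s *\<^sub>R b) \<le> norm h" using insert by (intro pn) auto
            then have "dist ((z + p A) + s *\<^sub>R b) z < \<delta>"
              using y by (simp add: dist_norm h_def algebra_simps)
            then have *: "norm (g b ((z + p A) + s *\<^sub>R b) - g b z) \<le> \<epsilon>"
              using \<delta>[of b] insert by (simp add: dist_norm less_imp_le)
            show "onorm (\<lambda>r. r *\<^sub>R (g b ((z + p A) + s *\<^sub>R b) - g b z)) \<le> \<epsilon>"
              by (rule onorm_le) (metis * mult.commute mult_left_mono norm_ge_zero norm_scaleR real_norm_def)
          qed auto
          then show ?thesis by (simp add: algebra_simps)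
        qed
        also have "\<dots> \<le> norm h * \<epsilon>"
          using \<open>\<epsilon> > 0\<close> insert by (intro mult_right_mono) (auto simp: Basis_le_norm)
        finally have 1: "norm (f (z + p (insert b A)) - f (z + p A) - (h \<bullet> b) *\<^sub>R g b z) \<le> norm h * \<epsilon>"
          by (simp add: pi add.assoc)
        have 2: "norm (f (z + p A) - f z - (\<Sum>b\<in>A. (h \<bullet> b) *\<^sub>R g b z)) \<le> card A * \<epsilon> * norm h"
          using insert by simp
        have "f (z + p (insert b A)) - f z - (\<Sum>b\<in>insert b A. (h \<bullet> b) *\<^sub>R g b z) =
          (f (z + p (insert b A)) - f (z + p A) - (h \<bullet> b) *\<^sub>R g b z) + (f (z + p A) - f z - (\<Sum>b\<in>A. (h \<bullet> b) *\<^sub>R g b z))"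
          using insert by simp
        then show ?case using norm_triangle_mono[OF 1 2] insert by (simp add: algebra_simps)
      qed
      from this[of Basis] show ?thesis
        by (simp add: p_def euclidean_representation h_def \<epsilon>_def)
    qed
    then show ?thesis using \<open>\<delta> > 0\<close> by blast
  qed
  show ?thesis
    unfolding has_derivative_within_alt using lin key by auto
qed

lemma cont_diff_imp_continuous: "cont_diff r f \<Longrightarrow> continuous_on UNIV f"
  by (cases r) (auto intro: differentiable_imp_continuous_on)

lemma cont_diff_Suc_D: "cont_diff (Suc r) f \<Longrightarrow> cont_diff r f"
proof (induction r arbitrary: f)
  case 0 then show ?case using cont_diff_imp_continuous by fastforce
next
  case (Suc r)
  then show ?case by (metis cont_diff.simps(2))
qed

lemma cont_diff_SucI:
  assumes "\<And>b. b \<in> Basis \<Longrightarrow> has_line_deriv f b (g b)"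
    and "\<And>b. b \<in> Basis \<Longrightarrow> cont_diff r (g b)"
  shows "cont_diff (Suc r) f"
proof -
  have "f differentiable_on UNIV"
    using line_derivs_imp_has_derivative[OF assms(1) cont_diff_imp_continuous[OF assms(2)]]
    by (auto simp: differentiable_on_def differentiable_def)
  moreover have "cont_diff r (dir_deriv b f)" if "b \<in> Basis" for b
    using has_line_deriv_imp_dir_deriv[OF assms(1)[OF that]] assms(2)[OF that] by simp
  ultimately show ?thesis by simp
qed

text \<open>Smoothness is established by exhibiting a family of continuous functions that is closed under taking
partial derivatives; no derivative of higher order has to be computed.\<close>

lemma smooth_coinduct:
  assumes "f \<in> X"
    and cont: "\<And>f. f \<in> X \<Longrightarrow> continuous_on UNIV f"
    and step: "\<And>f b. f \<in> X \<Longrightarrow> b \<in> Basis \<Longrightarrow> \<exists>g\<in>X. has_line_deriv f b g"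
  shows "smooth f"
proof -
  have "\<forall>f\<in>X. cont_diff r f" for r
  proof (induction r)
    case 0 then show ?case using cont by simp
  next
    case (Suc r)
    show ?case
    proof
      fix f assume f: "f \<in> X"
      then obtain g where "\<And>b. b \<in> Basis \<Longrightarrow> g b \<in> X \<and> has_line_deriv f b (g b)"
        using step by metis
      then show "cont_diff (Suc r) f" using Suc by (intro cont_diff_SucI[of f g]) auto
    qed
  qed
  then show ?thesis using assms(1) by (simp add: smooth_def)
qed

lemma smooth_imp_continuous: "smooth f \<Longrightarrow> continuous_on UNIV f"
  by (auto simp: smooth_def intro: cont_diff_imp_continuous)

lemma smooth_has_line_deriv: "smooth f \<Longrightarrow> has_line_deriv f b (dir_deriv b f)"
  unfolding smooth_def by (metis cont_diff.simps(2) differentiable_imp_has_line_deriv)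

lemma smooth_dir_deriv: "smooth f \<Longrightarrow> b \<in> Basis \<Longrightarrow> smooth (dir_deriv b f)"
  unfolding smooth_def by (metis cont_diff.simps(2))

lemma has_line_deriv_add:
  "has_line_deriv f b f' \<Longrightarrow> has_line_deriv g b g' \<Longrightarrow> has_line_deriv (\<lambda>z. f z + g z) b (\<lambda>z. f' z + g' z)"
  unfolding has_line_deriv_def by (auto intro!: derivative_eq_intros)

lemma has_line_deriv_mult:
  "has_line_deriv f b f' \<Longrightarrow> has_line_deriv g b g' \<Longrightarrow>
    has_line_deriv (\<lambda>z. f z * g z) b (\<lambda>z. f z * g' z + f' z * g z)"
  unfolding has_line_deriv_def
  by (auto intro!: derivative_eq_intros)

lemma has_line_deriv_const: "has_line_deriv (\<lambda>z. c) b (\<lambda>z. 0)"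
  unfolding has_line_deriv_def by (auto intro!: derivative_eq_intros)

lemma cont_diff_add: "cont_diff r f \<Longrightarrow> cont_diff r g \<Longrightarrow> cont_diff r (\<lambda>z. f z + g z)"
proof (induction r arbitrary: f g)
  case 0 then show ?case by (auto intro!: continuous_intros)
next
  case (Suc r)
  then show ?case
    by (intro cont_diff_SucI[where g="\<lambda>b z. dir_deriv b f z + dir_deriv b g z"] has_line_deriv_add
      differentiable_imp_has_line_deriv) auto
qed

lemma cont_diff_mult: "cont_diff r f \<Longrightarrow> cont_diff r g \<Longrightarrow> cont_diff r (\<lambda>z. f z * g z)"
proof (induction r arbitrary: f g)
  case 0 then show ?case by (auto intro!: continuous_intros)
next
  case (Suc r)
  have "cont_diff r f" "cont_diff r g" using Suc.prems cont_diff_Suc_D by blast+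
  with Suc show ?case
    by (intro cont_diff_SucI[where g="\<lambda>b z. f z * dir_deriv b g z + dir_deriv b f z * g z"] has_line_deriv_mult
      differentiable_imp_has_line_deriv cont_diff_add) auto
qed

lemma smooth_add: "smooth f \<Longrightarrow> smooth g \<Longrightarrow> smooth (\<lambda>z. f z + g z)"
  by (simp add: smooth_def cont_diff_add)

lemma smooth_mult: "smooth f \<Longrightarrow> smooth g \<Longrightarrow> smooth (\<lambda>z. f z * g z)"
  by (simp add: smooth_def cont_diff_mult)

lemma smooth_const: "smooth (\<lambda>z::'a::euclidean_space. c)"
proof (rule smooth_coinduct[where X="range (\<lambda>c z. c)"])
  fix f :: "'a \<Rightarrow> complex" and b assume "f \<in> range (\<lambda>c z. c)"
  then show "\<exists>g\<in>range (\<lambda>c z. c). has_line_deriv f b g" using has_line_deriv_const by blast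
qed auto

lemma has_line_deriv_cis_R:
  fixes v b :: "'a::real_inner"
  shows "has_line_deriv (\<lambda>x. cis (\<sigma> * (x \<bullet> v))) b (\<lambda>x. \<i> * of_real (\<sigma> * (b \<bullet> v)) * cis (\<sigma> * (x \<bullet> v)))"
  unfolding has_line_deriv_def cis_conv_exp
proof
  fix z :: 'a
  have "((\<lambda>w. exp (\<i> * (of_real (\<sigma> * (z \<bullet> v)) + w * of_real (\<sigma> * (b \<bullet> v))))) has_field_derivative
      \<i> * of_real (\<sigma> * (b \<bullet> v)) * exp (\<i> * of_real (\<sigma> * (z \<bullet> v)))) (at (of_real 0))"
    by (auto intro!: derivative_eq_intros)
  from has_vector_derivative_real_field[OF this]
  show "((\<lambda>s. exp (\<i> * of_real (\<sigma> * ((z + s *\<^sub>R b) \<bullet> v)))) has_vector_derivative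
      \<i> * of_real (\<sigma> * (b \<bullet> v)) * exp (\<i> * of_real (\<sigma> * (z \<bullet> v)))) (at 0)"
    by (simp add: inner_add_left algebra_simps)
qed

text \<open>Schwarz's theorem by differentiation under the integral sign: differentiating the fundamental theorem
of calculus in direction \<open>a\<close> with respect to direction \<open>b\<close> expresses an increment of the \<open>b\<close>-derivative as
an integral of the continuous function \<open>dir_deriv b (dir_deriv a f)\<close>.\<close>

lemma dir_deriv_commute:
  fixes f :: "'a::euclidean_space \<Rightarrow> complex"
  assumes f: "smooth f" and ab: "a \<in> Basis" "b \<in> Basis"
  shows "dir_deriv a (dir_deriv b f) = dir_deriv b (dir_deriv a f)"
proof
  fix z
  define fa where "fa = dir_deriv a f"
  define fb where "fb = dir_deriv b f"
  define fba where "fba = dir_deriv b fa"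
  have sm: "smooth fa" "smooth fb" "smooth fba"
    using smooth_dir_deriv f ab by (auto simp: fa_def fb_def fba_def)
  have cfa: "continuous_on A (\<lambda>x. fa (u x))" if "continuous_on A u" for A and u :: "'c::topological_space \<Rightarrow> 'a"
    using smooth_imp_continuous[OF sm(1)] that by (auto intro: continuous_on_compose2)
  have cfba: "continuous_on A (\<lambda>x. fba (u x))" if "continuous_on A u" for A and u :: "'c::topological_space \<Rightarrow> 'a"
    using smooth_imp_continuous[OF sm(3)] that by (auto intro: continuous_on_compose2)
  have la: "has_line_deriv f a fa" and lb: "has_line_deriv f b fb" and lba: "has_line_deriv fa b fba"
    and lab: "has_line_deriv fb a (dir_deriv a fb)"
    using smooth_has_line_deriv f sm by (auto simp: fa_def fb_def fba_def)
  \<comment> \<open>only \<open>s \<ge> 0\<close> is considered, which suffices for a one-sided derivative at the end\<close>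
  have ftc: "integral (cbox 0 s) (\<lambda>\<sigma>. fa (z + \<tau> *\<^sub>R b + \<sigma> *\<^sub>R a)) = f (z + \<tau> *\<^sub>R b + s *\<^sub>R a) - f (z + \<tau> *\<^sub>R b)"
    if "s \<ge> 0" for s \<tau> :: real
    using fundamental_theorem_of_calculus[of 0 s "\<lambda>\<sigma>. f (z + \<tau> *\<^sub>R b + \<sigma> *\<^sub>R a)", OF that has_line_deriv_at[OF la]]
    by (auto dest!: integral_unique)
  have diff: "fb (z + s *\<^sub>R a) - fb z = integral {0..s} (\<lambda>\<sigma>. fba (z + \<sigma> *\<^sub>R a))" if s: "s \<ge> 0" for s
  proof -
    have 1: "((\<lambda>\<tau>. integral (cbox 0 s) (\<lambda>\<sigma>. fa (z + \<tau> *\<^sub>R b + \<sigma> *\<^sub>R a)))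
        has_vector_derivative integral (cbox 0 s) (\<lambda>\<sigma>. fba (z + 0 *\<^sub>R b + \<sigma> *\<^sub>R a))) (at 0 within UNIV)"
    proof (rule leibniz_rule_vector_derivative)
      fix \<tau> \<sigma> :: real
      show "((\<lambda>\<tau>. fa (z + \<tau> *\<^sub>R b + \<sigma> *\<^sub>R a)) has_vector_derivative fba (z + \<tau> *\<^sub>R b + \<sigma> *\<^sub>R a)) (at \<tau> within UNIV)"
        using has_line_deriv_at[OF lba, of "z + \<sigma> *\<^sub>R a" \<tau>] by (simp add: algebra_simps)
    qed (auto intro!: integrable_continuous_interval continuous_intros cfa cfba simp: split_beta)
    have "((\<lambda>\<tau>. f (z + \<tau> *\<^sub>R b + s *\<^sub>R a) - f (z + \<tau> *\<^sub>R b))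
        has_vector_derivative (fb (z + s *\<^sub>R a + 0 *\<^sub>R b) - fb (z + 0 *\<^sub>R b))) (at 0)"
      using has_line_deriv_at[OF lb, of "z + s *\<^sub>R a" 0 UNIV] has_line_deriv_at[OF lb, of z 0 UNIV]
      by (auto intro!: derivative_eq_intros simp: algebra_simps)
    from vector_derivative_unique_at[OF this 1[unfolded ftc[OF s]]] show ?thesis
      by simp
  qed
  have "((\<lambda>s. integral {0..s} (\<lambda>\<sigma>. fba (z + \<sigma> *\<^sub>R a))) has_vector_derivative fba (z + 0 *\<^sub>R a)) (at 0 within {0..1})"
    by (intro integral_has_vector_derivative) (auto intro!: continuous_intros cfba)
  then have 1: "((\<lambda>s. fb (z + s *\<^sub>R a) - fb z) has_vector_derivative fba z) (at 0 within cbox 0 1)"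
    by (auto intro!: has_vector_derivative_transform[of 0 "{0..1}" "\<lambda>s. fb (z + s *\<^sub>R a) - fb z"
          "\<lambda>s. integral {0..s} (\<lambda>\<sigma>. fba (z + \<sigma> *\<^sub>R a))"] simp: diff)
  have 2: "((\<lambda>s. fb (z + s *\<^sub>R a) - fb z) has_vector_derivative dir_deriv a fb z) (at 0 within cbox 0 1)"
    using has_line_deriv_at[OF lab, of z 0 "cbox 0 1"] by (auto intro!: derivative_eq_intros)
  show "dir_deriv a (dir_deriv b f) z = dir_deriv b (dir_deriv a f) z"
    using vector_derivative_unique_within_closed_interval[OF _ _ 2 1] by (simp add: fb_def fba_def fa_def)
qed


lemma smooth_foldr_dir_deriv:
  "smooth f \<Longrightarrow> set bs \<subseteq> Basis \<Longrightarrow> smooth (foldr dir_deriv bs f)"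
  by (induction bs) (auto intro: smooth_dir_deriv)

lemma foldr_dir_deriv_move:
  assumes "smooth f" "set us \<subseteq> Basis" "b \<in> Basis"
  shows "foldr dir_deriv us (dir_deriv b f) = dir_deriv b (foldr dir_deriv us f)"
  using assms(2)
proof (induction us)
  case (Cons a us)
  then show ?case
    using dir_deriv_commute[OF smooth_foldr_dir_deriv, of f us a b] assms by auto
qed auto

text \<open>An iterated derivative depends only on the multiset of directions.  This frees the estimates below from the
particular enumeration in \<open>multi_deriv\<close>, so that one may differentiate once more in any direction.\<close>

lemma foldr_dir_deriv_perm:
  assumes "mset xs = mset ys" "set xs \<subseteq> Basis" "smooth f"
  shows "foldr dir_deriv xs f = foldr dir_deriv ys f"
  using assms(1,2)
proof (induction xs arbitrary: ys)
  case (Cons x xs)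
  have "x \<in> set ys" using Cons.prems(1) by (metis list.set_intros(1) set_mset_mset)
  then obtain us vs where ys: "ys = us @ x # vs" by (meson split_list)
  have m: "mset xs = mset (us @ vs)" using Cons.prems(1) ys by simp
  have sub: "set us \<union> set vs \<subseteq> Basis"
    using Cons.prems(2) arg_cong[OF m, of set_mset] by auto
  have "foldr dir_deriv ys f = dir_deriv x (foldr dir_deriv (us @ vs) f)"
    using foldr_dir_deriv_move[of "foldr dir_deriv vs f" us x] smooth_foldr_dir_deriv[OF assms(3), of vs]
      sub Cons.prems(2) by (simp add: ys)
  then show ?case using Cons.IH[OF m] Cons.prems(2) by simp
qed auto

lemma set_index_list [simp]: "set (index_list :: 'i::finite list) = UNIV"
  and distinct_index_list [simp]: "distinct (index_list :: 'i::finite list)"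
proof -
  have "\<exists>is::'i list. distinct is \<and> set is = UNIV" using finite_distinct_list[of "UNIV :: 'i set"] by auto
  from someI_ex[OF this] show "set (index_list :: 'i::finite list) = UNIV"
    "distinct (index_list :: 'i::finite list)" by (auto simp: index_list_def)
qed

text \<open>The directions along which \<open>multi_deriv\<close> differentiates, the outermost derivative first; as a plain list they can be
permuted.\<close>

definition multi_list :: "('i::finite \<Rightarrow> 'a) \<Rightarrow> ('i \<Rightarrow> nat) \<Rightarrow> 'a list" where
  "multi_list e \<alpha> = concat (map (\<lambda>i. replicate (\<alpha> i) (e i)) index_list)"

lemma multi_deriv_eq_foldr:
  fixes e :: "'i::finite \<Rightarrow> 'a::real_normed_vector"
  shows "multi_deriv e \<alpha> f = foldr dir_deriv (multi_list e \<alpha>) f"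
proof -
  have "foldr (\<lambda>i. dir_deriv (e i) ^^ \<alpha> i) is f =
      foldr dir_deriv (concat (map (\<lambda>i. replicate (\<alpha> i) (e i)) is)) f" for "is"
    by (induction "is") auto
  then show ?thesis by (simp add: multi_deriv_def multi_list_def)
qed

lemma mset_multi_list: "mset (multi_list e \<alpha>) = (\<Sum>i\<in>UNIV. replicate_mset (\<alpha> i) (e i))"
proof -
  have "mset (concat (map (\<lambda>i. replicate (\<alpha> i) (e i)) is)) = (\<Sum>i\<in>set is. replicate_mset (\<alpha> i) (e i))"
    if "distinct is" for "is" using that by (induction "is") auto
  from this[of index_list] show ?thesis by (simp add: multi_list_def)
qed

lemma set_multi_list: "set (multi_list e \<alpha>) \<subseteq> range e"
  by (auto simp: multi_list_def)

lemma count_multi_list: "inj e \<Longrightarrow> count (mset (multi_list e \<alpha>)) (e i) = \<alpha> i"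
  by (simp add: mset_multi_list count_sum inj_eq sum.delta)

lemma length_multi_list: "length (multi_list e \<alpha>) = multi_order \<alpha>"
proof -
  have "length (multi_list e \<alpha>) = size (mset (multi_list e \<alpha>))" by simp
  also have "\<dots> = multi_order \<alpha>" unfolding mset_multi_list multi_order_def by (simp add: size_multiset_sum)
  finally show ?thesis .
qed


section \<open>Schwartz seminorms and continuous operators\<close>

definition axis_T :: "'m \<Rightarrow> (real^'m) \<times> (real^'n)" where "axis_T i = (axis i 1, 0)"
definition axis_R :: "'n \<Rightarrow> (real^'m) \<times> (real^'n)" where "axis_R j = (0, axis j 1)"

lemma Basis_TR: "(Basis :: ((real^'m) \<times> (real^'n)) set) = range axis_T \<union> range axis_R"
  unfolding Basis_prod_def Basis_vec_def axis_T_def axis_R_def by auto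

lemma axis_T_in_Basis [simp]: "axis_T i \<in> Basis" and axis_R_in_Basis [simp]: "axis_R j \<in> Basis"
  by (auto simp: Basis_TR)

lemma inj_axis_T: "inj (axis_T :: 'm \<Rightarrow> (real^'m) \<times> (real^'n))"
  and inj_axis_R: "inj (axis_R :: 'n \<Rightarrow> (real^'m) \<times> (real^'n))"
  by (auto simp: inj_def axis_T_def axis_R_def axis_eq_axis)

lemma axis_T_neq_axis_R: "axis_T i \<noteq> axis_R j"
  by (auto simp: axis_T_def axis_R_def axis_eq_0_iff)

lemma axis_T_not_in_R [simp]: "axis_T i \<notin> range axis_R" and axis_R_not_in_T [simp]: "axis_R i \<notin> range axis_T"
  using axis_T_neq_axis_R axis_T_neq_axis_R[symmetric] by auto

text \<open>Every list of coordinate directions can be sorted into the order that the seminorms prescribe: first the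
directions of the torus, then those of the Euclidean space.\<close>

lemma Basis_list_normal_form:
  fixes bs :: "((real^'m) \<times> (real^'n)) list"
  assumes "set bs \<subseteq> Basis"
  obtains \<alpha> \<beta> where "mset bs = mset (multi_list axis_T \<alpha> @ multi_list axis_R \<beta>)"
proof -
  define \<alpha> :: "'m \<Rightarrow> nat" where "\<alpha> = (\<lambda>i. count (mset bs) (axis_T i))"
  define \<beta> :: "'n \<Rightarrow> nat" where "\<beta> = (\<lambda>j. count (mset bs) (axis_R j))"
  have "count (mset bs) b = count (mset (multi_list axis_T \<alpha> @ multi_list axis_R \<beta>)) b" for b
  proof -
    consider i where "b = axis_T i" | j where "b = axis_R j" | "b \<notin> Basis"
      unfolding Basis_TR by blast
    then show ?thesis
    proof cases
      case 1
      then have "b \<notin> set (multi_list axis_R \<beta>)" using set_multi_list[of axis_R \<beta>] axis_T_not_in_R by blast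
      then have c0: "count (mset (multi_list axis_R \<beta>)) b = 0" by (simp only: count_mset_0_iff not_False_eq_True)
      show ?thesis unfolding mset_append count_union c0 add_0_right
        unfolding 1 count_multi_list[OF inj_axis_T, of \<alpha> i] by (simp only: \<alpha>_def)
    next
      case 2
      then have "b \<notin> set (multi_list axis_T \<alpha>)" using set_multi_list[of axis_T \<alpha>] axis_R_not_in_T by blast
      then have c0: "count (mset (multi_list axis_T \<alpha>)) b = 0" by (simp only: count_mset_0_iff not_False_eq_True)
      show ?thesis unfolding mset_append count_union c0 add_0
        unfolding 2 count_multi_list[OF inj_axis_R, of \<beta> j] by (simp only: \<beta>_def)
    next
      case 3
      then have "b \<notin> set bs" "b \<notin> set (multi_list axis_T \<alpha>)" "b \<notin> set (multi_list axis_R \<beta>)"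
        using assms set_multi_list[of axis_T \<alpha>] set_multi_list[of axis_R \<beta>] by (auto simp: Basis_TR)
      then have "count (mset bs) b = 0" "count (mset (multi_list axis_T \<alpha>)) b = 0"
        "count (mset (multi_list axis_R \<beta>)) b = 0"
        by (simp_all only: count_mset_0_iff not_False_eq_True)
      then show ?thesis by (simp only: mset_append count_union add_0)
    qed
  qed
  then show ?thesis using that by (metis multiset_eqI)
qed

text \<open>The quantities bounded by the Schwartz seminorms, but for derivatives along an arbitrary list of directions.\<close>

definition wderiv :: "((real^'m) \<times> (real^'n)) list \<Rightarrow> ('n \<Rightarrow> nat) \<Rightarrow>
    ((real^'m) \<times> (real^'n) \<Rightarrow> complex) \<Rightarrow> (real^'m) \<times> (real^'n) \<Rightarrow> real" where
  "wderiv bs \<gamma> f z = cmod (of_real (multi_power (snd z) \<gamma>) * foldr dir_deriv bs f z)"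

lemma weighted_TR_eq_wderiv: "weighted_TR \<alpha> \<beta> \<gamma> f = wderiv (multi_list axis_T \<alpha> @ multi_list axis_R \<beta>) \<gamma> f"
  by (rule ext) (simp add: weighted_TR_def wderiv_def multi_deriv_eq_foldr axis_T_def[abs_def] axis_R_def[abs_def])

lemma set_multi_list_Basis: "set (multi_list axis_T \<alpha> @ multi_list axis_R \<beta>) \<subseteq> Basis"
  using set_multi_list[of axis_T \<alpha>] set_multi_list[of axis_R \<beta>] by (auto simp: Basis_TR)

lemma schwartz_TR_D:
  assumes "f \<in> schwartz_TR"
  shows "periodic_T f" "smooth f"
  using assms by (auto simp: schwartz_TR_def)

lemma wderiv_eq_weighted_TR:
  assumes "set bs \<subseteq> Basis"
  obtains \<alpha> \<beta> where "multi_order \<alpha> + multi_order \<beta> = length bs"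
    "\<And>f. smooth f \<Longrightarrow> wderiv bs \<gamma> f = weighted_TR \<alpha> \<beta> \<gamma> f"
proof -
  obtain \<alpha> \<beta> where m: "mset bs = mset (multi_list axis_T \<alpha> @ multi_list axis_R \<beta>)"
    using Basis_list_normal_form[OF assms] .
  have "length bs = multi_order \<alpha> + multi_order \<beta>"
    using arg_cong[OF m, of size] by (simp add: length_multi_list)
  moreover have "wderiv bs \<gamma> f = weighted_TR \<alpha> \<beta> \<gamma> f" if "smooth f" for f
    unfolding weighted_TR_eq_wderiv using foldr_dir_deriv_perm[OF m assms that]
    by (auto simp: wderiv_def fun_eq_iff)
  ultimately show ?thesis using that by metis
qed

lemma bdd_weighted_TR: "f \<in> schwartz_TR \<Longrightarrow> bdd_above (range (weighted_TR \<alpha> \<beta> \<gamma> f))"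
  by (auto simp: schwartz_TR_def)

lemma schwartz_TR_I:
  assumes "periodic_T f" "smooth f"
    and "\<And>bs \<gamma>. set bs \<subseteq> Basis \<Longrightarrow> \<exists>C. \<forall>z. wderiv bs \<gamma> f z \<le> C"
  shows "f \<in> schwartz_TR"
  unfolding schwartz_TR_def
proof (intro CollectI conjI allI assms(1,2))
  fix \<alpha> \<beta> \<gamma>
  show "bdd_above (range (weighted_TR \<alpha> \<beta> \<gamma> f))"
    unfolding weighted_TR_eq_wderiv using assms(3)[OF set_multi_list_Basis, of \<alpha> \<beta> \<gamma>]
    by (auto simp: bdd_above_def)
qed

lemma finite_multi_order_le: "finite {\<alpha> :: 'i::finite \<Rightarrow> nat. multi_order \<alpha> \<le> r}"
proof (rule finite_subset)
  have "\<alpha> i \<le> multi_order \<alpha>" for i and \<alpha> :: "'i \<Rightarrow> nat"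
    unfolding multi_order_def by (rule member_le_sum) auto
  then show "{\<alpha> :: 'i \<Rightarrow> nat. multi_order \<alpha> \<le> r} \<subseteq> PiE UNIV (\<lambda>_. {..r})"
    by (auto simp: PiE_UNIV_domain intro: order_trans)
qed (auto intro: finite_PiE)

lemma finite_multi_order_TR:
  "finite {(\<alpha> :: 'm::finite \<Rightarrow> nat, \<beta> :: 'n::finite \<Rightarrow> nat, \<gamma> :: 'n \<Rightarrow> nat).
     multi_order \<alpha> + multi_order \<beta> + multi_order \<gamma> \<le> r}"
  by (rule finite_subset[of _ "{\<alpha>. multi_order \<alpha> \<le> r} \<times> {\<alpha>. multi_order \<alpha> \<le> r} \<times> {\<alpha>. multi_order \<alpha> \<le> r}"])
    (auto intro!: finite_cartesian_product finite_multi_order_le)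

lemma weighted_TR_nonneg: "0 \<le> weighted_TR \<alpha> \<beta> \<gamma> f z"
  by (simp add: weighted_TR_def)

lemma SUP_weighted_TR_nonneg: "f \<in> schwartz_TR \<Longrightarrow> 0 \<le> (SUP z. weighted_TR \<alpha> \<beta> \<gamma> f z)"
  using bdd_weighted_TR[of f \<alpha> \<beta> \<gamma>] weighted_TR_nonneg cSUP_upper2[of "weighted_TR \<alpha> \<beta> \<gamma> f" UNIV] by blast

lemma seminorm_TR_mono: "f \<in> schwartz_TR \<Longrightarrow> r \<le> r' \<Longrightarrow> seminorm_TR r f \<le> seminorm_TR r' f"
  unfolding seminorm_TR_def
  by (intro sum_mono2 finite_multi_order_TR) (auto simp: SUP_weighted_TR_nonneg)

lemma weighted_TR_le_seminorm:
  assumes "f \<in> schwartz_TR" "multi_order \<alpha> + multi_order \<beta> + multi_order \<gamma> \<le> r"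
  shows "weighted_TR \<alpha> \<beta> \<gamma> f z \<le> seminorm_TR r f"
proof -
  have "weighted_TR \<alpha> \<beta> \<gamma> f z \<le> (SUP z. weighted_TR \<alpha> \<beta> \<gamma> f z)"
    using bdd_weighted_TR[OF assms(1)] by (intro cSUP_upper) auto
  also have "\<dots> = (\<lambda>(\<alpha>,\<beta>,\<gamma>). SUP z. weighted_TR \<alpha> \<beta> \<gamma> f z) (\<alpha>,\<beta>,\<gamma>)" by simp
  also have "\<dots> \<le> seminorm_TR r f"
    unfolding seminorm_TR_def
    by (rule member_le_sum) (use assms in \<open>auto simp: SUP_weighted_TR_nonneg intro!: finite_multi_order_TR\<close>)
  finally show ?thesis .
qed

text \<open>A family of real quantities attached to Schwartz functions is controlled if it is bounded, uniformly in
the index, by a multiple of one of the defining seminorms.\<close>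

definition controlled :: "(((real^'m) \<times> (real^'n) \<Rightarrow> complex) \<Rightarrow> 'i \<Rightarrow> real) \<Rightarrow> bool" where
  "controlled Q \<longleftrightarrow> (\<exists>C\<ge>0. \<exists>r. \<forall>f\<in>schwartz_TR. \<forall>i. Q f i \<le> C * seminorm_TR r f)"

lemma controlledI:
  assumes "C \<ge> 0" "\<And>f i. f \<in> schwartz_TR \<Longrightarrow> Q f i \<le> C * seminorm_TR r f"
  shows "controlled Q"
  using assms by (auto simp: controlled_def)

lemma controlledE:
  assumes "controlled Q"
  obtains C r where "C \<ge> 0" "\<And>f i. f \<in> schwartz_TR \<Longrightarrow> Q f i \<le> C * seminorm_TR r f"
  using assms unfolding controlled_def by blast

lemma controlled_wderiv:
  fixes bs :: "((real^'m) \<times> (real^'n)) list"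
  assumes "set bs \<subseteq> Basis"
  shows "controlled (wderiv bs \<gamma>)"
proof -
  obtain \<alpha> \<beta> where o: "multi_order \<alpha> + multi_order \<beta> = length bs"
    and w: "\<And>f. smooth f \<Longrightarrow> wderiv bs \<gamma> f = weighted_TR \<alpha> \<beta> \<gamma> f"
    using wderiv_eq_weighted_TR[OF assms] by metis
  show ?thesis
    by (rule controlledI[of 1 _ "length bs + multi_order \<gamma>"])
      (auto simp: w schwartz_TR_D o intro!: weighted_TR_le_seminorm)
qed

lemma controlled_add:
  assumes "controlled P" "controlled Q"
  shows "controlled (\<lambda>f i. P f i + Q f i)"
proof -
  obtain C r where C: "C \<ge> 0" "\<And>f i. f \<in> schwartz_TR \<Longrightarrow> P f i \<le> C * seminorm_TR r f"
    using controlledE[OF assms(1)] by metis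
  obtain D s where D: "D \<ge> 0" "\<And>f i. f \<in> schwartz_TR \<Longrightarrow> Q f i \<le> D * seminorm_TR s f"
    using controlledE[OF assms(2)] by metis
  show ?thesis
  proof (rule controlledI[of "C + D" _ "max r s"])
    fix f :: "(real^'a) \<times> (real^'b) \<Rightarrow> complex" and i assume f: "f \<in> schwartz_TR"
    have "C * seminorm_TR r f \<le> C * seminorm_TR (max r s) f" "D * seminorm_TR s f \<le> D * seminorm_TR (max r s) f"
      using C(1) D(1) f by (auto intro!: mult_left_mono seminorm_TR_mono)
    then show "P f i + Q f i \<le> (C + D) * seminorm_TR (max r s) f"
      using C(2)[OF f, of i] D(2)[OF f, of i] by (simp add: algebra_simps)
  qed (use C D in auto)
qed

lemma controlled_mono:
  assumes "controlled Q" "c \<ge> 0" "\<And>f i. f \<in> schwartz_TR \<Longrightarrow> \<exists>j. P f i \<le> c * Q f j"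
  shows "controlled P"
proof -
  obtain C r where C: "C \<ge> 0" "\<And>f i. f \<in> schwartz_TR \<Longrightarrow> Q f i \<le> C * seminorm_TR r f"
    using controlledE[OF assms(1)] by metis
  show ?thesis
  proof (rule controlledI[of "c * C" _ r])
    fix f :: "(real^'a) \<times> (real^'b) \<Rightarrow> complex" and i assume f: "f \<in> schwartz_TR"
    obtain j where "P f i \<le> c * Q f j" using assms(3)[OF f] by blast
    also have "\<dots> \<le> c * (C * seminorm_TR r f)" using C(2)[OF f] assms(2) by (intro mult_left_mono)
    finally show "P f i \<le> c * C * seminorm_TR r f" by (simp add: mult.assoc)
  qed (use C assms in auto)
qed

lemma controlled_bound: "controlled Q \<Longrightarrow> f \<in> schwartz_TR \<Longrightarrow> \<exists>C. \<forall>i. Q f i \<le> C"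
  by (auto simp: controlled_def)

lemma controlled_sum:
  assumes "finite I" "\<And>\<iota>. \<iota> \<in> I \<Longrightarrow> controlled (Q \<iota>)"
  shows "controlled (\<lambda>f i. \<Sum>\<iota>\<in>I. Q \<iota> f i)"
  using assms
proof (induction I rule: finite_induct)
  case empty
  then show ?case by (auto intro!: controlledI[of 0])
next
  case (insert x I)
  then show ?case using controlled_add[of "Q x" "\<lambda>f i. \<Sum>\<iota>\<in>I. Q \<iota> f i"] by simp
qed

definition cts_op :: "(((real^'m) \<times> (real^'n) \<Rightarrow> complex) \<Rightarrow> ((real^'m) \<times> (real^'n) \<Rightarrow> complex)) \<Rightarrow> bool" where
  "cts_op T \<longleftrightarrow> (\<forall>f\<in>schwartz_TR. T f \<in> schwartz_TR) \<and>
     (\<forall>r. \<exists>C\<ge>0. \<exists>s. \<forall>f\<in>schwartz_TR. seminorm_TR r (T f) \<le> C * seminorm_TR s f)"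

lemma cts_op_in: "cts_op T \<Longrightarrow> f \<in> schwartz_TR \<Longrightarrow> T f \<in> schwartz_TR"
  by (simp add: cts_op_def)

lemma cts_opI:
  fixes T :: "((real^'m) \<times> (real^'n) \<Rightarrow> complex) \<Rightarrow> ((real^'m) \<times> (real^'n) \<Rightarrow> complex)"
  assumes per: "\<And>f. f \<in> schwartz_TR \<Longrightarrow> periodic_T (T f)"
    and sm: "\<And>f. f \<in> schwartz_TR \<Longrightarrow> smooth (T f)"
    and co: "\<And>bs \<gamma>. set bs \<subseteq> Basis \<Longrightarrow> controlled (\<lambda>f. wderiv bs \<gamma> (T f))"
  shows "cts_op T"
proof -
  have "T f \<in> schwartz_TR" if f: "f \<in> schwartz_TR" for f
    using controlled_bound[OF co f] by (intro schwartz_TR_I per sm f) auto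
  moreover have "\<exists>C\<ge>0. \<exists>s. \<forall>f\<in>schwartz_TR. seminorm_TR r (T f) \<le> C * seminorm_TR s f" for r
  proof -
    have "controlled (\<lambda>f (i::unit). \<Sum>(\<alpha>, \<beta>, \<gamma>) \<in> {(\<alpha>, \<beta>, \<gamma>). multi_order \<alpha> + multi_order \<beta> + multi_order \<gamma> \<le> r}.
        (SUP z. weighted_TR \<alpha> \<beta> \<gamma> (T f) z))"
    proof (rule controlled_sum[OF finite_multi_order_TR], clarsimp)
      fix \<alpha> :: "'m \<Rightarrow> nat" and \<beta> \<gamma> :: "'n \<Rightarrow> nat"
      obtain C s where C: "C \<ge> 0" "\<And>f i. f \<in> schwartz_TR \<Longrightarrow> weighted_TR \<alpha> \<beta> \<gamma> (T f) i \<le> C * seminorm_TR s f"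
        using co[OF set_multi_list_Basis[of \<alpha> \<beta>], of \<gamma>] unfolding controlled_def weighted_TR_eq_wderiv by blast
      show "controlled (\<lambda>f (i::unit). SUP z. weighted_TR \<alpha> \<beta> \<gamma> (T f) z)"
        by (rule controlledI[of C _ s]) (auto intro!: cSUP_least C)
    qed
    then show ?thesis by (auto simp: controlled_def seminorm_TR_def)
  qed
  ultimately show ?thesis by (simp add: cts_op_def)
qed

lemma controlled_comp:
  assumes "controlled Q" "cts_op T"
  shows "controlled (\<lambda>f. Q (T f))"
proof -
  obtain C r where C: "C \<ge> 0" "\<And>f i. f \<in> schwartz_TR \<Longrightarrow> Q f i \<le> C * seminorm_TR r f"
    using controlledE[OF assms(1)] by metis
  obtain D s where D: "D \<ge> 0" "\<And>f. f \<in> schwartz_TR \<Longrightarrow> seminorm_TR r (T f) \<le> D * seminorm_TR s f"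
    using assms(2) unfolding cts_op_def by meson
  show ?thesis
  proof (rule controlledI[of "C * D" _ s])
    fix f :: "(real^'a) \<times> (real^'b) \<Rightarrow> complex" and i assume f: "f \<in> schwartz_TR"
    have "Q (T f) i \<le> C * seminorm_TR r (T f)" using C cts_op_in[OF assms(2) f] by blast
    also have "\<dots> \<le> C * (D * seminorm_TR s f)" using D f C by (intro mult_left_mono) auto
    finally show "Q (T f) i \<le> C * D * seminorm_TR s f" by (simp add: mult.assoc)
  qed (use C D in auto)
qed

lemma cts_op_comp: "cts_op T \<Longrightarrow> cts_op U \<Longrightarrow> cts_op (\<lambda>f. T (U f))"
  unfolding cts_op_def[of "\<lambda>f. T (U f)"]
proof (intro conjI ballI allI)
  fix r assume T: "cts_op T" and U: "cts_op U"
  have "controlled (\<lambda>f (i::unit). seminorm_TR r (T f))"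
    using T by (auto simp: cts_op_def controlled_def)
  from controlled_comp[OF this U]
  show "\<exists>C\<ge>0. \<exists>s. \<forall>f\<in>schwartz_TR. seminorm_TR r (T (U f)) \<le> C * seminorm_TR s f"
    by (auto simp: controlled_def)
qed (auto intro: cts_op_in)

lemma cts_op_id: "cts_op (\<lambda>f. f)"
  unfolding cts_op_def by (auto intro!: exI[of _ "1::real"])

lemma foldr_dir_deriv_add:
  assumes "smooth f" "smooth g" "set bs \<subseteq> Basis"
  shows "foldr dir_deriv bs (\<lambda>z. f z + g z) = (\<lambda>z. foldr dir_deriv bs f z + foldr dir_deriv bs g z)"
  using assms(3)
proof (induction bs)
  case (Cons b bs)
  then have "dir_deriv b (\<lambda>z. foldr dir_deriv bs f z + foldr dir_deriv bs g z) =
      (\<lambda>z. dir_deriv b (foldr dir_deriv bs f) z + dir_deriv b (foldr dir_deriv bs g) z)"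
    by (intro has_line_deriv_imp_dir_deriv has_line_deriv_add smooth_has_line_deriv smooth_foldr_dir_deriv assms) auto
  then show ?case using Cons by simp
qed auto

lemma foldr_dir_deriv_scale:
  assumes "smooth f" "set bs \<subseteq> Basis"
  shows "foldr dir_deriv bs (\<lambda>z. c * f z) = (\<lambda>z. c * foldr dir_deriv bs f z)"
  using assms(2)
proof (induction bs)
  case (Cons b bs)
  then have "dir_deriv b (\<lambda>z. c * foldr dir_deriv bs f z) =
      (\<lambda>z. c * dir_deriv b (foldr dir_deriv bs f) z + 0 * foldr dir_deriv bs f z)"
    by (intro has_line_deriv_imp_dir_deriv has_line_deriv_mult has_line_deriv_const smooth_has_line_deriv smooth_foldr_dir_deriv assms) auto
  then show ?case using Cons by simp
qed auto

lemma wderiv_add_le: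
  assumes "smooth f" "smooth g" "set bs \<subseteq> Basis"
  shows "wderiv bs \<gamma> (\<lambda>z. f z + g z) z \<le> wderiv bs \<gamma> f z + wderiv bs \<gamma> g z"
  unfolding wderiv_def foldr_dir_deriv_add[OF assms]
  by (metis distrib_left norm_triangle_ineq)

lemma wderiv_scale:
  assumes "smooth f" "set bs \<subseteq> Basis"
  shows "wderiv bs \<gamma> (\<lambda>z. c * f z) z = cmod c * wderiv bs \<gamma> f z"
  unfolding wderiv_def foldr_dir_deriv_scale[OF assms] by (simp add: norm_mult)

lemma cts_op_add:
  assumes T: "cts_op T" and U: "cts_op U"
  shows "cts_op (\<lambda>f z. T f z + U f z)"
proof (rule cts_opI)
  fix f :: "(real^'a) \<times> (real^'b) \<Rightarrow> complex" assume f: "f \<in> schwartz_TR"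
  note * = schwartz_TR_D[OF cts_op_in[OF T f]] schwartz_TR_D[OF cts_op_in[OF U f]]
  show "periodic_T (\<lambda>z. T f z + U f z)" using * by (auto simp: periodic_T_def)
  show "smooth (\<lambda>z. T f z + U f z)" using * by (auto intro: smooth_add)
next
  fix bs :: "((real^'a) \<times> (real^'b)) list" and \<gamma> assume bs: "set bs \<subseteq> Basis"
  show "controlled (\<lambda>f. wderiv bs \<gamma> (\<lambda>z. T f z + U f z))"
  proof (rule controlled_mono[of _ 1])
    show "controlled (\<lambda>f z. wderiv bs \<gamma> (T f) z + wderiv bs \<gamma> (U f) z)"
      by (intro controlled_add controlled_comp[OF _ T] controlled_comp[OF _ U] controlled_wderiv bs)
  qed (use bs in \<open>auto intro!: wderiv_add_le schwartz_TR_D cts_op_in T U exI\<close>)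
qed

lemma cts_op_scale: "cts_op (\<lambda>f z. c * f z)"
proof (rule cts_opI)
  fix f :: "(real^'a) \<times> (real^'b) \<Rightarrow> complex" assume f: "f \<in> schwartz_TR"
  note * = schwartz_TR_D[OF f]
  show "periodic_T (\<lambda>z. c * f z)" using * by (auto simp: periodic_T_def)
  show "smooth (\<lambda>z. c * f z)" using * by (auto intro: smooth_mult smooth_const)
next
  fix bs :: "((real^'a) \<times> (real^'b)) list" and \<gamma> assume bs: "set bs \<subseteq> Basis"
  show "controlled (\<lambda>f. wderiv bs \<gamma> (\<lambda>z. c * f z))"
    by (rule controlled_mono[OF controlled_wderiv[OF bs], of "cmod c"])
      (use bs in \<open>auto intro!: exI simp: wderiv_scale schwartz_TR_D\<close>)
qed

lemma cts_op_dir_deriv: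
  fixes b :: "(real^'m) \<times> (real^'n)"
  assumes b: "b \<in> Basis"
  shows "cts_op (dir_deriv b)"
proof (rule cts_opI)
  fix f :: "(real^'m) \<times> (real^'n) \<Rightarrow> complex" assume f: "f \<in> schwartz_TR"
  note * = schwartz_TR_D[OF f]
  have "(\<lambda>s. f ((t + axis i (2 * pi), x) + s *\<^sub>R b)) = (\<lambda>s. f ((t, x) + s *\<^sub>R b))" for t x i
  proof
    fix s
    have "f (t + s *\<^sub>R fst b + axis i (2 * pi), x + s *\<^sub>R snd b) = f (t + s *\<^sub>R fst b, x + s *\<^sub>R snd b)"
      using *(1) by (simp add: periodic_T_def)
    then show "f ((t + axis i (2 * pi), x) + s *\<^sub>R b) = f ((t, x) + s *\<^sub>R b)"
      by (cases b) (simp add: add.assoc add.commute[of "axis i (2 * pi)"])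
  qed
  then show "periodic_T (dir_deriv b f)"
    unfolding periodic_T_def dir_deriv_def by simp
  show "smooth (dir_deriv b f)" using * b by (auto intro: smooth_dir_deriv)
next
  fix bs :: "((real^'m) \<times> (real^'n)) list" and \<gamma> assume bs: "set bs \<subseteq> Basis"
  have "wderiv bs \<gamma> (dir_deriv b f) = wderiv (bs @ [b]) \<gamma> f" for f
    by (auto simp: wderiv_def)
  then show "controlled (\<lambda>f. wderiv bs \<gamma> (dir_deriv b f))"
    using controlled_wderiv[of "bs @ [b]" \<gamma>] bs b by simp
qed

lemma schwartz_TR_add:
  fixes f :: "(real^'m) \<times> (real^'n) \<Rightarrow> complex"
  assumes "f \<in> schwartz_TR" "g \<in> schwartz_TR" shows "(\<lambda>z. f z + g z) \<in> schwartz_TR"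
proof (rule schwartz_TR_I)
  note * = schwartz_TR_D[OF assms(1)] schwartz_TR_D[OF assms(2)]
  show "periodic_T (\<lambda>z. f z + g z)" using * by (auto simp: periodic_T_def)
  show "smooth (\<lambda>z. f z + g z)" using * by (auto intro: smooth_add)
  fix bs \<gamma> assume bs: "set bs \<subseteq> (Basis :: ((real^'m) \<times> (real^'n)) set)"
  obtain C D where "\<forall>z. wderiv bs \<gamma> f z \<le> C" "\<forall>z. wderiv bs \<gamma> g z \<le> D"
    using controlled_bound[OF controlled_wderiv[OF bs]] assms by meson
  then show "\<exists>C. \<forall>z. wderiv bs \<gamma> (\<lambda>z. f z + g z) z \<le> C"
    using wderiv_add_le[OF *(2,4) bs] by (meson add_mono order_trans)
qed

lemma schwartz_TR_zero: "(\<lambda>z::(real^'m) \<times> (real^'n). 0) \<in> schwartz_TR"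
  by (rule schwartz_TR_I) (auto simp: periodic_T_def smooth_const wderiv_def foldr_dir_deriv_scale[of "\<lambda>_. 0" _ 0, simplified] smooth_const)

text \<open>If differentiating \<open>T f\<close> in direction \<open>b\<close> gives \<open>T (A b f) + B b f\<close> with continuous \<open>A b\<close> and \<open>B b\<close>, then bounds on
derivatives of \<open>T f\<close> reduce inductively to bounds on values of \<open>T\<close>, applied to other Schwartz functions.
Smoothness of \<open>T f\<close> comes from the same identity, because the functions \<open>T f + h\<close> with Schwartz \<open>f\<close> and \<open>h\<close> are closed
under partial derivatives.\<close>

lemma cts_op_by_commutators:
  fixes T :: "((real^'m) \<times> (real^'n) \<Rightarrow> complex) \<Rightarrow> ((real^'m) \<times> (real^'n) \<Rightarrow> complex)"
  assumes per: "\<And>f. f \<in> schwartz_TR \<Longrightarrow> periodic_T (T f)"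
    and cont: "\<And>f. f \<in> schwartz_TR \<Longrightarrow> continuous_on UNIV (T f)"
    and base: "\<And>\<gamma>. controlled (\<lambda>f. wderiv [] \<gamma> (T f))"
    and A: "\<And>b. b \<in> Basis \<Longrightarrow> cts_op (A b)" and B: "\<And>b. b \<in> Basis \<Longrightarrow> cts_op (B b)"
    and D: "\<And>b f. b \<in> Basis \<Longrightarrow> f \<in> schwartz_TR \<Longrightarrow> has_line_deriv (T f) b (\<lambda>z. T (A b f) z + B b f z)"
  shows "cts_op T"
proof (rule cts_opI)
  have smooth: "smooth (\<lambda>z. T f z + h z)" if "f \<in> schwartz_TR" "h \<in> schwartz_TR" for f h
  proof (rule smooth_coinduct[where X="{\<lambda>z. T f z + h z | f h. f \<in> schwartz_TR \<and> h \<in> schwartz_TR}"])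
    fix g assume "g \<in> {\<lambda>z. T f z + h z | f h. f \<in> schwartz_TR \<and> h \<in> schwartz_TR}"
    then obtain f h where g: "g = (\<lambda>z. T f z + h z)" "f \<in> schwartz_TR" "h \<in> schwartz_TR" by blast
    then show "continuous_on UNIV g"
      using cont schwartz_TR_D smooth_imp_continuous by (auto intro!: continuous_intros)
    fix b :: "(real^'m) \<times> (real^'n)" assume b: "b \<in> Basis"
    have "has_line_deriv g b (\<lambda>z. T (A b f) z + B b f z + dir_deriv b h z)"
      unfolding g using D[OF b g(2)] smooth_has_line_deriv[OF schwartz_TR_D(2)[OF g(3)]]
      by (rule has_line_deriv_add)
    moreover have "(\<lambda>z. B b f z + dir_deriv b h z) \<in> schwartz_TR"
      using cts_op_in[OF B[OF b] g(2)] cts_op_in[OF cts_op_dir_deriv[OF b] g(3)] by (rule schwartz_TR_add)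
    ultimately show "\<exists>g'\<in>{\<lambda>z. T f z + h z | f h. f \<in> schwartz_TR \<and> h \<in> schwartz_TR}. has_line_deriv g b g'"
      using cts_op_in[OF A[OF b] g(2)] by (auto simp: add.assoc)
  qed (use that in blast)
  show sm: "smooth (T f)" if "f \<in> schwartz_TR" for f
    using smooth[OF that schwartz_TR_zero] by simp
  show "controlled (\<lambda>f. wderiv bs \<gamma> (T f))" if "set bs \<subseteq> Basis" for bs \<gamma>
    using that
  proof (induction bs rule: rev_induct)
    case Nil show ?case by (rule base)
  next
    case (snoc b bs)
    then have b: "b \<in> Basis" and bs: "set bs \<subseteq> Basis" by auto
    show ?case
    proof (rule controlled_mono[of _ 1])
      show "controlled (\<lambda>f z. wderiv bs \<gamma> (T (A b f)) z + wderiv bs \<gamma> (B b f) z)"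
        using snoc(1)[OF bs] by (intro controlled_add controlled_comp[OF _ A[OF b]] controlled_comp[OF _ B[OF b]] controlled_wderiv bs)
    next
      fix f z assume f: "f \<in> (schwartz_TR :: ((real^'m) \<times> (real^'n) \<Rightarrow> complex) set)"
      have "wderiv (bs @ [b]) \<gamma> (T f) z = wderiv bs \<gamma> (\<lambda>z. T (A b f) z + B b f z) z"
        using has_line_deriv_imp_dir_deriv[OF D[OF b f]] by (simp add: wderiv_def)
      also have "\<dots> \<le> wderiv bs \<gamma> (T (A b f)) z + wderiv bs \<gamma> (B b f) z"
        by (intro wderiv_add_le sm schwartz_TR_D cts_op_in[OF A[OF b]] cts_op_in[OF B[OF b]] f bs)
      finally show "\<exists>j. wderiv (bs @ [b]) \<gamma> (T f) z \<le> 1 * (wderiv bs \<gamma> (T (A b f)) j + wderiv bs \<gamma> (B b f) j)" by (intro exI[of _ z]) simp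
    qed simp
  qed
qed (rule per)

lemma has_line_deriv_coord:
  "has_line_deriv (\<lambda>z::(real^'m) \<times> (real^'n). complex_of_real (snd z $ j)) b (\<lambda>z. of_real (snd b $ j))"
  unfolding has_line_deriv_def
  by (auto intro!: derivative_eq_intros has_vector_derivative_of_real)

lemma has_line_deriv_cis:
  "has_line_deriv (\<lambda>z::(real^'m) \<times> (real^'n). cis (k \<bullet> fst z)) b (\<lambda>z. \<i> * of_real (k \<bullet> fst b) * cis (k \<bullet> fst z))"
  using has_line_deriv_cis_R[of 1 "(k, 0) :: (real^'m) \<times> (real^'n)" b] by (simp add: inner_prod_def inner_commute)

text \<open>The commutator of a derivative with multiplication by a coordinate is a constant multiple of the identity.\<close>

lemma cts_op_coord:
  "cts_op (\<lambda>f (z::(real^'m) \<times> (real^'n)). of_real (snd z $ j) * f z)"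
proof (rule cts_op_by_commutators[where A=dir_deriv and B="\<lambda>b f z. of_real (snd b $ j) * f z"])
  fix \<gamma> :: "'n \<Rightarrow> nat"
  have "multi_power x (\<gamma>(j := Suc (\<gamma> j))) = x $ j * multi_power x \<gamma>" for x
    unfolding multi_power_def by (subst (1 2) prod.remove[of _ j]) auto
  then have "wderiv [] \<gamma> (\<lambda>z. of_real (snd z $ j) * f z) = wderiv [] (\<gamma>(j := Suc (\<gamma> j))) f"
    for f :: "(real^'m) \<times> (real^'n) \<Rightarrow> complex"
    by (auto simp: wderiv_def fun_eq_iff norm_mult)
  then show "controlled (\<lambda>f (z::(real^'m) \<times> (real^'n)). wderiv [] \<gamma> (\<lambda>z. of_real (snd z $ j) * f z) z)"
    using controlled_wderiv[of "[]" "\<gamma>(j := Suc (\<gamma> j))"] by simp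
next
  fix b :: "(real^'m) \<times> (real^'n)" and f assume b: "b \<in> Basis" and f: "f \<in> (schwartz_TR :: ((real^'m) \<times> (real^'n) \<Rightarrow> complex) set)"
  show "has_line_deriv (\<lambda>z. of_real (snd z $ j) * f z) b
           (\<lambda>z. of_real (snd z $ j) * dir_deriv b f z + of_real (snd b $ j) * f z)"
    by (intro has_line_deriv_mult has_line_deriv_coord smooth_has_line_deriv schwartz_TR_D f)
next
  fix f :: "(real^'m) \<times> (real^'n) \<Rightarrow> complex" assume f: "f \<in> schwartz_TR"
  show "periodic_T (\<lambda>z. of_real (snd z $ j) * f z)"
    using schwartz_TR_D(1)[OF f] by (simp add: periodic_T_def)
  show "continuous_on UNIV (\<lambda>z. of_real (snd z $ j) * f z)"
    using smooth_imp_continuous[OF schwartz_TR_D(2)[OF f]] by (auto intro!: continuous_intros)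
qed (auto intro!: cts_op_dir_deriv cts_op_scale)

definition modulate :: "int^'m \<Rightarrow> ((real^'m) \<times> (real^'n) \<Rightarrow> complex) \<Rightarrow> (real^'m) \<times> (real^'n) \<Rightarrow> complex" where
  "modulate k f z = cis (real_vec k \<bullet> fst z) * f z"

text \<open>The integrality of \<open>k\<close> is what makes the character periodic.\<close>

lemma cts_op_modulate:
  fixes k :: "int^'m"
  shows "cts_op (modulate k :: ((real^'m) \<times> (real^'n) \<Rightarrow> complex) \<Rightarrow> _)"
  unfolding modulate_def[abs_def]
proof (rule cts_op_by_commutators[where A="\<lambda>b f z. dir_deriv b f z + \<i> * of_real (real_vec k \<bullet> fst b) * f z" and B="\<lambda>b f z. 0 * f z"])
  fix f :: "(real^'m) \<times> (real^'n) \<Rightarrow> complex" assume f: "f \<in> schwartz_TR"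
  have "cis (2 * pi * of_int (k $ i)) = 1" for i
    by (rule cis_multiple_2pi) simp
  then have "cis (real_vec k \<bullet> axis i (2 * pi)) = 1" for i
    by (simp add: inner_axis real_vec_def mult_ac)
  then show "periodic_T (\<lambda>z. cis (real_vec k \<bullet> fst z) * f z)"
    using schwartz_TR_D(1)[OF f] by (simp add: periodic_T_def inner_add_right flip: cis_mult)
  show "continuous_on UNIV (\<lambda>z. cis (real_vec k \<bullet> fst z) * f z)"
    using smooth_imp_continuous[OF schwartz_TR_D(2)[OF f]] by (auto intro!: continuous_intros)
next
  fix \<gamma> :: "'n \<Rightarrow> nat"
  have "wderiv [] \<gamma> (\<lambda>z. cis (real_vec k \<bullet> fst z) * f z) = wderiv [] \<gamma> f"
    for f :: "(real^'m) \<times> (real^'n) \<Rightarrow> complex"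
    by (auto simp: wderiv_def fun_eq_iff norm_mult)
  then show "controlled (\<lambda>f (z::(real^'m) \<times> (real^'n)). wderiv [] \<gamma> (\<lambda>z. cis (real_vec k \<bullet> fst z) * f z) z)"
    using controlled_wderiv[of "[]" \<gamma>] by simp
next
  fix b :: "(real^'m) \<times> (real^'n)" and f assume b: "b \<in> Basis" and f: "f \<in> (schwartz_TR :: ((real^'m) \<times> (real^'n) \<Rightarrow> complex) set)"
  have "has_line_deriv (\<lambda>z. cis (real_vec k \<bullet> fst z) * f z) b
     (\<lambda>z. cis (real_vec k \<bullet> fst z) * dir_deriv b f z + (\<i> * of_real (real_vec k \<bullet> fst b) * cis (real_vec k \<bullet> fst z)) * f z)"
    by (intro has_line_deriv_mult has_line_deriv_cis smooth_has_line_deriv schwartz_TR_D f)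
  then show "has_line_deriv (\<lambda>z. cis (real_vec k \<bullet> fst z) * f z) b
     (\<lambda>z. cis (real_vec k \<bullet> fst z) * (dir_deriv b f z + \<i> * of_real (real_vec k \<bullet> fst b) * f z) + 0 * f z)"
    by (simp add: algebra_simps)
qed (rule cts_op_add cts_op_scale cts_op_dir_deriv | assumption)+

text \<open>The product form, rather than a power of \<open>1 + (norm x)\<^sup>2\<close>, makes integrals and lattice sums of \<open>1 / weight\<close> factor
into one-dimensional ones.\<close>

definition weight :: "real^'n \<Rightarrow> real" where
  "weight x = (\<Prod>j\<in>UNIV. 1 + (x $ j)\<^sup>2)"

lemma weight_ge_1: "1 \<le> weight x"
  unfolding weight_def by (rule prod_ge_1) auto

lemma cts_op_weight: "cts_op (\<lambda>f z. of_real (weight (snd z) ^ A) * f z)"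
proof -
  have 1: "cts_op (\<lambda>f (z::(real^'m) \<times> (real^'n)). of_real (\<Prod>j\<in>J. 1 + (snd z $ j)\<^sup>2) * f z)" if "finite J" for J
    using that
  proof induction
    case empty show ?case using cts_op_id by simp
  next
    case (insert j J)
    have "cts_op (\<lambda>f (z::(real^'m) \<times> (real^'n)).
        of_real (\<Prod>j\<in>J. 1 + (snd z $ j)\<^sup>2) * f z + of_real (snd z $ j) * (of_real (snd z $ j) * (of_real (\<Prod>j\<in>J. 1 + (snd z $ j)\<^sup>2) * f z)))"
      by (intro cts_op_add insert.IH cts_op_comp[OF cts_op_coord, of "\<lambda>f z. of_real (snd z $ j) * (of_real (\<Prod>j\<in>J. 1 + (snd z $ j)\<^sup>2) * f z)"]
         cts_op_comp[OF cts_op_coord insert.IH])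
    then show ?case using insert.hyps
      by (simp add: algebra_simps power2_eq_square)
  qed
  show ?thesis
  proof (induction A)
    case 0 show ?case using cts_op_id by simp
  next
    case (Suc A)
    show ?case using cts_op_comp[OF 1[OF finite] Suc] by (simp add: weight_def mult.assoc)
  qed
qed

lemma controlled_weight: "controlled (\<lambda>f (z::(real^'m) \<times> (real^'n)). weight (snd z) ^ A * cmod (f z))"
proof -
  have "weight (snd z) ^ A * cmod (f z) = wderiv [] (\<lambda>_. 0) (\<lambda>z. of_real (weight (snd z) ^ A) * f z) z"
    for f and z :: "(real^'m) \<times> (real^'n)"
    using weight_ge_1[of "snd z"] by (auto simp: wderiv_def multi_power_def norm_mult norm_power)
  then show ?thesis by (simp only:) (rule controlled_comp[OF controlled_wderiv cts_op_weight], simp)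
qed


section \<open>Integrals of functions dominated by an inverse weight\<close>

text \<open>Lebesgue measure is the image of a product of one-dimensional Lebesgue measures, so products of functions of
the single coordinates can be integrated factor by factor.\<close>

lemma lborel_Basis_prod:
  fixes h :: "'a::euclidean_space \<Rightarrow> real \<Rightarrow> complex"
  assumes "\<And>b. b \<in> Basis \<Longrightarrow> integrable lborel (h b)"
  shows "integrable lborel (\<lambda>x::'a. \<Prod>b\<in>Basis. h b (x \<bullet> b))"
    and "(LINT x|lborel. (\<Prod>b\<in>Basis. h b ((x::'a) \<bullet> b))) = (\<Prod>b\<in>Basis. LINT y|lborel. h b y)"
proof -
  interpret product_sigma_finite "\<lambda>b::'a. lborel :: real measure" by standard
  let ?g = "\<lambda>f. \<Sum>b\<in>Basis. f b *\<^sub>R (b::'a)"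
  have [measurable]: "\<And>b. b \<in> Basis \<Longrightarrow> h b \<in> borel_measurable borel"
    using assms by (auto dest: borel_measurable_integrable)
  have g: "?g \<in> (\<Pi>\<^sub>M b\<in>Basis. lborel) \<rightarrow>\<^sub>M borel" by measurable
  have m: "(\<lambda>x::'a. \<Prod>b\<in>Basis. h b (x \<bullet> b)) \<in> borel_measurable borel" by measurable
  have eq: "(\<Prod>b\<in>Basis. h b (?g f \<bullet> b)) = (\<Prod>b\<in>Basis. h b (f b))" for f
    by (intro prod.cong refl) (simp add: inner_sum_left_Basis)
  show "integrable lborel (\<lambda>x::'a. \<Prod>b\<in>Basis. h b (x \<bullet> b))"
    by (subst lborel_eq, subst integrable_distr_eq[OF g m])
      (auto simp only: eq intro!: product_integrable_prod assms finite_Basis)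
  show "(LINT x|lborel. (\<Prod>b\<in>Basis. h b ((x::'a) \<bullet> b))) = (\<Prod>b\<in>Basis. LINT y|lborel. h b y)"
    by (subst lborel_eq, subst integral_distr[OF g m])
      (auto simp only: eq intro!: product_integral_prod assms finite_Basis)
qed

lemma prod_Basis_vec: "(\<Prod>b\<in>Basis. h b (x \<bullet> b)) = (\<Prod>j\<in>UNIV. h (axis j 1) (x $ j))" for x :: "real^'n"
proof -
  have B: "(Basis :: (real^'n) set) = range (\<lambda>j. axis j 1)" by (auto simp: Basis_vec_def)
  have "inj (\<lambda>j::'n. axis j (1::real))" by (auto simp: inj_def axis_eq_axis)
  then show ?thesis unfolding B by (subst prod.reindex) (auto simp: inner_axis)
qed

lemma lborel_vec_prod:
  fixes g :: "'n::finite \<Rightarrow> real \<Rightarrow> complex"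
  assumes "\<And>j. integrable lborel (g j)"
  shows "integrable lborel (\<lambda>x::real^'n. \<Prod>j\<in>UNIV. g j (x $ j))"
    and "(LINT x|lborel. (\<Prod>j\<in>UNIV. g j ((x::real^'n) $ j))) = (\<Prod>j\<in>UNIV. LINT y|lborel. g j y)"
proof -
  define h where "h b = g (THE j. b = axis j 1)" for b :: "real^'n"
  have h: "h (axis j 1) = g j" for j by (auto simp: h_def axis_eq_axis)
  have B: "(Basis :: (real^'n) set) = range (\<lambda>j. axis j 1)" by (auto simp: Basis_vec_def)
  have inj: "inj (\<lambda>j::'n. axis j (1::real))" by (auto simp: inj_def axis_eq_axis)
  have i: "integrable lborel (h b)" if "b \<in> Basis" for b
    using that assms h by (auto simp: B)
  show "integrable lborel (\<lambda>x::real^'n. \<Prod>j\<in>UNIV. g j (x $ j))"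
    using lborel_Basis_prod(1)[of h, OF i] unfolding prod_Basis_vec h by simp
  show "(LINT x|lborel. (\<Prod>j\<in>UNIV. g j ((x::real^'n) $ j))) = (\<Prod>j\<in>UNIV. LINT y|lborel. g j y)"
  proof -
    have "(LINT x|lborel. (\<Prod>j\<in>UNIV. g j ((x::real^'n) $ j))) = (LINT x|lborel. (\<Prod>b\<in>Basis. h b ((x::real^'n) \<bullet> b)))"
      unfolding prod_Basis_vec h ..
    also have "\<dots> = (\<Prod>b\<in>Basis. LINT y|lborel. h b y)"
      by (rule lborel_Basis_prod(2)[of h, OF i])
    also have "\<dots> = (\<Prod>j\<in>UNIV. LINT y|lborel. g j y)"
      unfolding B by (subst prod.reindex[OF inj]) (simp add: h)
    finally show ?thesis .
  qed
qed

lemma weight_measurable [measurable]: "weight \<in> borel_measurable borel"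
  unfolding weight_def by measurable

lemma weight_pos [simp]: "0 < weight x"
  using weight_ge_1[of x] by linarith

lemma integrable_inverse_weight: "integrable lborel (\<lambda>x::real^'n. 1 / weight x)"
proof -
  have "integrable lborel (\<lambda>x::real. inverse (1 + x\<^sup>2))"
    using integrable_inverse_1_plus_square by (simp add: set_integrable_def einterval_def)
  then have "integrable lborel (\<lambda>x::real. complex_of_real (inverse (1 + x\<^sup>2)))"
    by (simp only: complex_of_real_integrable_eq)
  from lborel_vec_prod(1)[of "\<lambda>j. \<lambda>x. complex_of_real (inverse (1 + x\<^sup>2))", OF this]
  have "integrable lborel (\<lambda>x::real^'n. complex_of_real (1 / weight x))"
    by (simp add: weight_def prod_inversef[symmetric] inverse_eq_divide prod_dividef)
  then show ?thesis using integrable_Re by fastforce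
qed

lemma has_vector_derivative_at_0_iff:
  fixes f :: "real \<Rightarrow> 'b::real_normed_vector"
  shows "(f has_vector_derivative D) (at 0) \<longleftrightarrow> ((\<lambda>s. (f s - f 0) /\<^sub>R s) \<longlongrightarrow> D) (at 0)"
proof -
  have *: "norm (f h - f 0 - h *\<^sub>R D) / norm h = norm ((f h - f 0) /\<^sub>R h - D)" if "h \<noteq> 0" for h :: real
  proof -
    have "(f h - f 0) /\<^sub>R h - D = (f h - f 0 - h *\<^sub>R D) /\<^sub>R h"
      using that by (simp add: scaleR_diff_right)
    then show ?thesis by (simp add: divide_inverse mult.commute)
  qed
  have "(f has_vector_derivative D) (at 0) \<longleftrightarrow> ((\<lambda>h. norm (f h - f 0 - h *\<^sub>R D) / norm h) \<longlongrightarrow> 0) (at 0)"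
    unfolding has_vector_derivative_def has_derivative_at by (simp add: bounded_linear_scaleR_left)
  also have "\<dots> \<longleftrightarrow> ((\<lambda>h. norm ((f h - f 0) /\<^sub>R h - D)) \<longlongrightarrow> 0) (at 0)"
    by (rule filterlim_cong) (auto simp: eventually_at_filter *[unfolded real_norm_def] intro!: always_eventually)
  also have "\<dots> \<longleftrightarrow> ((\<lambda>s. (f s - f 0) /\<^sub>R s) \<longlongrightarrow> D) (at 0)"
    by (simp add: tendsto_norm_zero_iff LIM_zero_iff)
  finally show ?thesis .
qed

text \<open>Differentiation under the integral sign: the difference quotients are bounded by \<open>B\<close> by the mean value
inequality and converge pointwise, so dominated convergence applies.\<close>

lemma has_vector_derivative_integral_dominated:
  fixes \<phi> \<phi>' :: "real \<Rightarrow> 'y \<Rightarrow> complex"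
  assumes int: "\<And>s. \<bar>s\<bar> \<le> 1 \<Longrightarrow> integrable M (\<phi> s)"
    and der: "\<And>s y. y \<in> space M \<Longrightarrow> \<bar>s\<bar> \<le> 1 \<Longrightarrow> ((\<lambda>s. \<phi> s y) has_vector_derivative \<phi>' s y) (at s)"
    and meas: "\<phi>' 0 \<in> borel_measurable M"
    and bnd: "\<And>s y. y \<in> space M \<Longrightarrow> \<bar>s\<bar> \<le> 1 \<Longrightarrow> cmod (\<phi>' s y) \<le> B y" and B: "integrable M B"
  shows "((\<lambda>s. integral\<^sup>L M (\<phi> s)) has_vector_derivative integral\<^sup>L M (\<phi>' 0)) (at 0)"
  unfolding has_vector_derivative_at_0_iff tendsto_at_iff_sequentially
proof (intro allI impI)
  fix X :: "nat \<Rightarrow> real" assume X0: "\<forall>i. X i \<in> UNIV - {0}" and X: "X \<longlonglongrightarrow> 0"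
  obtain N where N: "\<And>n. n \<ge> N \<Longrightarrow> \<bar>X n\<bar> \<le> 1"
    using tendstoD[OF X, of 1] by (auto simp: eventually_sequentially dist_real_def intro: less_imp_le)
  define Y where "Y n = X (n + N)" for n
  have Y: "Y \<longlonglongrightarrow> 0" "\<And>n. Y n \<noteq> 0" "\<And>n. \<bar>Y n\<bar> \<le> 1"
    using LIMSEQ_ignore_initial_segment[OF X, of N] X0 N by (auto simp: Y_def[abs_def])
  have "(\<lambda>n. LINT y|M. (\<phi> (Y n) y - \<phi> 0 y) /\<^sub>R Y n) \<longlonglongrightarrow> integral\<^sup>L M (\<phi>' 0)"
  proof (rule integral_dominated_convergence[OF meas _ B])
    show "(\<lambda>y. (\<phi> (Y n) y - \<phi> 0 y) /\<^sub>R Y n) \<in> borel_measurable M" for n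
      using borel_measurable_integrable[OF int[OF Y(3)]] borel_measurable_integrable[OF int[of 0]] by auto
    show "AE y in M. (\<lambda>n. (\<phi> (Y n) y - \<phi> 0 y) /\<^sub>R Y n) \<longlonglongrightarrow> \<phi>' 0 y"
    proof (rule AE_I2)
      fix y assume "y \<in> space M"
      from der[OF this, of 0] have "((\<lambda>s. (\<phi> s y - \<phi> 0 y) /\<^sub>R s) \<longlongrightarrow> \<phi>' 0 y) (at 0)"
        by (simp add: has_vector_derivative_at_0_iff)
      then show "(\<lambda>n. (\<phi> (Y n) y - \<phi> 0 y) /\<^sub>R Y n) \<longlonglongrightarrow> \<phi>' 0 y"
        using Y unfolding tendsto_at_iff_sequentially by (auto simp: o_def)
    qed
    show "AE y in M. cmod ((\<phi> (Y n) y - \<phi> 0 y) /\<^sub>R Y n) \<le> B y" for n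
    proof (rule AE_I2)
      fix y assume y: "y \<in> space M"
      have "cmod (\<phi> (Y n) y - \<phi> 0 y) \<le> B y * norm (Y n - 0)"
      proof (rule differentiable_bound[where S="{-1..1}" and f'="\<lambda>s r. r *\<^sub>R \<phi>' s y"])
        fix s :: real assume s: "s \<in> {-1..1}"
        show "((\<lambda>s. \<phi> s y) has_derivative (\<lambda>r. r *\<^sub>R \<phi>' s y)) (at s within {-1..1})"
          using der[OF y, of s] s by (auto simp: has_vector_derivative_def intro: has_derivative_at_withinI)
        show "onorm (\<lambda>r. r *\<^sub>R \<phi>' s y) \<le> B y"
        proof (rule onorm_le)
          have *: "cmod (\<phi>' s y) \<le> B y" using bnd[OF y, of s] s by (auto simp: abs_le_iff)
          show "norm (r *\<^sub>R \<phi>' s y) \<le> B y * norm r" for r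
            by (metis * mult.commute mult_left_mono norm_ge_zero norm_scaleR real_norm_def)
        qed
      qed (use Y(3)[of n] in \<open>auto simp: abs_le_iff\<close>)
      then show "cmod ((\<phi> (Y n) y - \<phi> 0 y) /\<^sub>R Y n) \<le> B y"
        unfolding norm_scaleR using Y(2)[of n] by (simp add: field_simps)
    qed
  qed
  moreover have "(LINT y|M. (\<phi> (Y n) y - \<phi> 0 y) /\<^sub>R Y n) = (integral\<^sup>L M (\<phi> (Y n)) - integral\<^sup>L M (\<phi> 0)) /\<^sub>R Y n" for n
    using int[of 0] int[OF Y(3)] by simp
  ultimately have "(\<lambda>n. (integral\<^sup>L M (\<phi> (X (n + N))) - integral\<^sup>L M (\<phi> 0)) /\<^sub>R X (n + N)) \<longlonglongrightarrow> integral\<^sup>L M (\<phi>' 0)"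
    by (simp only: Y_def)
  then show "((\<lambda>s. (integral\<^sup>L M (\<phi> s) - integral\<^sup>L M (\<phi> 0)) /\<^sub>R s) \<circ> X) \<longlonglongrightarrow> integral\<^sup>L M (\<phi>' 0)"
    unfolding o_def by (rule LIMSEQ_offset)
qed

lemma continuous_on_integral_dominated:
  fixes \<phi> :: "'a::metric_space \<Rightarrow> 'y \<Rightarrow> complex"
  assumes "\<And>z. \<phi> z \<in> borel_measurable M"
    and cont: "\<And>y. continuous_on UNIV (\<lambda>z. \<phi> z y)"
    and "\<And>z y. cmod (\<phi> z y) \<le> B y" and "integrable M B"
  shows "continuous_on UNIV (\<lambda>z. integral\<^sup>L M (\<phi> z))"
  unfolding continuous_on_sequentially
proof (intro allI ballI impI, elim conjE)
  fix X :: "nat \<Rightarrow> 'a" and a assume X: "X \<longlonglongrightarrow> a"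
  have "(\<lambda>n. integral\<^sup>L M (\<phi> (X n))) \<longlonglongrightarrow> integral\<^sup>L M (\<phi> a)"
  proof (rule integral_dominated_convergence[where w=B])
    show "AE y in M. (\<lambda>n. \<phi> (X n) y) \<longlonglongrightarrow> \<phi> a y"
      by (intro AE_I2 continuous_on_tendsto_compose[OF cont X]) auto
  qed (use assms in auto)
  then show "((\<lambda>z. integral\<^sup>L M (\<phi> z)) \<circ> X) \<longlonglongrightarrow> integral\<^sup>L M (\<phi> a)" by (simp add: o_def)
qed

text \<open>Translations by at most one along an axis change the weight by at most a constant factor, so a translate of a function dominated
by \<open>1 / weight\<close> is still dominated by a fixed integrable function.\<close>

lemma weight_shift:
  assumes "\<bar>s\<bar> \<le> 1" shows "weight x \<le> 3 * weight (x + s *\<^sub>R axis j 1)"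
proof -
  have sq: "1 + (x $ j)\<^sup>2 \<le> 3 * (1 + (x $ j + s)\<^sup>2)"
  proof -
    have "s\<^sup>2 \<le> 1" using assms by (simp add: abs_square_le_1)
    moreover have "(x $ j)\<^sup>2 \<le> 2 * (x $ j + s)\<^sup>2 + 2 * s\<^sup>2"
      using sum_squares_ge_zero[of "x $ j + 2 * s" 0] by (simp add: power2_eq_square algebra_simps)
    moreover have "0 \<le> (x $ j + s)\<^sup>2" by simp
    ultimately have "1 + (x $ j)\<^sup>2 \<le> 3 + 3 * (x $ j + s)\<^sup>2" by linarith
    then show ?thesis by (simp add: distrib_left)
  qed
  have w: "weight y = (1 + (y $ j)\<^sup>2) * (\<Prod>i\<in>UNIV - {j}. 1 + (y $ i)\<^sup>2)" for y :: "real^'a"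
    unfolding weight_def by (subst prod.remove[of _ j]) auto
  have e: "(\<Prod>i\<in>UNIV - {j}. 1 + ((x + s *\<^sub>R axis j 1) $ i)\<^sup>2) = (\<Prod>i\<in>UNIV - {j}. 1 + (x $ i)\<^sup>2)"
    by (intro prod.cong) (auto simp: axis_def)
  have "0 \<le> (\<Prod>i\<in>UNIV - {j}. 1 + (x $ i)\<^sup>2)" by (intro prod_nonneg) auto
  from mult_right_mono[OF sq this] show ?thesis
    unfolding w e by (simp add: axis_def algebra_simps)
qed

lemma integrable_weight_bounded:
  fixes h :: "real^'n \<Rightarrow> complex"
  assumes "continuous_on UNIV h" "\<And>x. cmod (h x) \<le> C / weight x"
  shows "integrable lborel h"
proof (rule Bochner_Integration.integrable_bound)
  show "integrable lborel (\<lambda>x::real^'n. C / weight x)" using integrable_mult_right[OF integrable_inverse_weight, of C] by simp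
  show "AE x in lborel. norm (h x) \<le> norm (C / weight x)"
    unfolding real_norm_def by (intro AE_I2 order_trans[OF assms(2) abs_ge_self])
qed (use assms(1) in \<open>auto intro: borel_measurable_continuous_onI\<close>)

text \<open>Integration by parts in the form "the integral of a derivative vanishes": by translation
invariance the integral of \<open>h (x + s *\<^sub>R axis j 1)\<close> does not depend on \<open>s\<close>, and its derivative at \<open>s = 0\<close> is the
integral of \<open>h'\<close>.\<close>

lemma integral_line_deriv_eq_0:
  fixes h :: "real^'n \<Rightarrow> complex"
  assumes hd: "has_line_deriv h (axis j 1) h'"
    and c: "continuous_on UNIV h" "continuous_on UNIV h'"
    and b: "\<And>x. cmod (h x) \<le> C / weight x" "\<And>x. cmod (h' x) \<le> C / weight x"
  shows "(LINT x|lborel. h' x) = 0"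
proof -
  have C: "C \<ge> 0"
    using order_trans[OF norm_ge_zero b(1)[of 0]] weight_pos[of "0::real^'n"] by (auto simp: zero_le_divide_iff)
  have shift: "integrable lborel (\<lambda>x. h (x + v))" "(LINT x|lborel. h (x + v)) = (LINT x|lborel. h x)" for v
  proof -
    have m: "h \<in> borel_measurable borel" using c by (auto intro: borel_measurable_continuous_onI)
    have "integrable (distr lborel borel ((+) v)) h"
      using integrable_weight_bounded[OF c(1) b(1)] lborel_distr_plus[of v] by simp
    then show "integrable lborel (\<lambda>x. h (x + v))"
      using m by (subst (asm) integrable_distr_eq) (auto simp: add.commute)
    have "(LINT x|lborel. h x) = (LINT x|distr lborel borel ((+) v). h x)"
      using lborel_distr_plus[of v] by simp
    also have "\<dots> = (LINT x|lborel. h (v + x))" using m by (subst integral_distr) auto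
    finally show "(LINT x|lborel. h (x + v)) = (LINT x|lborel. h x)" by (simp add: add.commute)
  qed
  have "((\<lambda>s. LINT x|lborel. h (x + s *\<^sub>R axis j 1)) has_vector_derivative (LINT x|lborel. h' (x + 0 *\<^sub>R axis j 1))) (at 0)"
  proof (rule has_vector_derivative_integral_dominated[where B="\<lambda>x. 3 * C * (1 / weight x)"])
    show "cmod (h' (x + s *\<^sub>R axis j 1)) \<le> 3 * C * (1 / weight x)" if "\<bar>s\<bar> \<le> 1" for s x
    proof -
      have "C / weight (x + s *\<^sub>R axis j 1) \<le> 3 * C / weight x"
        using mult_left_mono[OF weight_shift[OF that, of x j] C] by (simp add: field_simps)
      then show ?thesis using b(2)[of "x + s *\<^sub>R axis j 1"] by simp
    qed
    show "integrable lborel (\<lambda>x::real^'n. 3 * C * (1 / weight x))"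
      by (intro integrable_mult_right integrable_inverse_weight)
    show "(\<lambda>x. h' (x + 0 *\<^sub>R axis j 1)) \<in> borel_measurable lborel"
      using c by (auto intro: borel_measurable_continuous_onI)
  qed (auto intro: shift has_line_deriv_at[OF hd])
  then have "((\<lambda>s::real. LINT x|lborel. h x) has_vector_derivative (LINT x|lborel. h' x)) (at 0)"
    by (simp add: shift)
  moreover have "((\<lambda>s::real. LINT x|lborel. h x) has_vector_derivative 0) (at 0)" by simp
  ultimately show ?thesis by (rule vector_derivative_unique_at)
qed


section \<open>The Fourier transform in the Euclidean variable\<close>

text \<open>The forward transform is the case \<open>\<sigma> = - 1\<close>; the inverse one is, up to a constant factor, the case \<open>\<sigma> = 1\<close>.\<close>

definition osc_integral :: "real \<Rightarrow> ((real^'m) \<times> (real^'n) \<Rightarrow> complex) \<Rightarrow> (real^'m) \<times> (real^'n) \<Rightarrow> complex" where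
  "osc_integral \<sigma> f z = (LINT x|lborel. f (fst z, x) * cis (\<sigma> * (x \<bullet> snd z)))"

lemma continuous_cis_comp [continuous_intros]:
  "continuous_on A g \<Longrightarrow> continuous_on A (\<lambda>x. cis (g x))"
  unfolding cis_conv_exp by (intro continuous_intros)

lemma schwartz_weight_bound:
  fixes f :: "(real^'m) \<times> (real^'n) \<Rightarrow> complex"
  assumes "f \<in> schwartz_TR"
  obtains C where "\<And>t x. cmod (f (t, x)) \<le> C / weight x"
proof -
  obtain C where "\<And>z. weight (snd z) ^ 1 * cmod (f z) \<le> C"
    using controlled_bound[OF controlled_weight assms] by metis
  then have "cmod (f (t, x)) \<le> C / weight x" for t x
    by (metis power_one_right snd_conv mult.commute pos_le_divide_eq weight_pos)
  then show ?thesis using that by blast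
qed

lemma schwartz_continuous: "f \<in> schwartz_TR \<Longrightarrow> continuous_on A g \<Longrightarrow> continuous_on A (\<lambda>x. f (g x))"
  using smooth_imp_continuous[OF schwartz_TR_D(2)] by (auto intro: continuous_on_compose2)

lemma osc_integrable:
  assumes "f \<in> schwartz_TR"
  shows "integrable lborel (\<lambda>x. f (t, x) * cis (\<sigma> * (x \<bullet> \<xi>)))"
proof -
  obtain C where "\<And>t x. cmod (f (t, x)) \<le> C / weight x" using schwartz_weight_bound[OF assms] by metis
  then show ?thesis
    by (intro integrable_weight_bounded[where C=C] continuous_intros schwartz_continuous[OF assms]) (auto simp: norm_mult)
qed

lemma continuous_osc_integral:
  fixes f :: "(real^'m) \<times> (real^'n) \<Rightarrow> complex"
  assumes f: "f \<in> schwartz_TR"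
  shows "continuous_on UNIV (osc_integral \<sigma> f)"
proof -
  obtain C where C: "\<And>t x. cmod (f (t, x)) \<le> C / weight x" using schwartz_weight_bound[OF assms] by metis
  show ?thesis unfolding osc_integral_def
  proof (rule continuous_on_integral_dominated)
    show "integrable lborel (\<lambda>x::real^'n. C * (1 / weight x))"
      by (intro integrable_mult_right integrable_inverse_weight)
    show "(\<lambda>x. f (fst z, x) * cis (\<sigma> * (x \<bullet> snd z))) \<in> borel_measurable lborel" for z
      using borel_measurable_integrable[OF osc_integrable[OF f]] .
  qed (use C in \<open>auto simp: norm_mult intro!: continuous_intros schwartz_continuous[OF f]\<close>)
qed

text \<open>The operator that a derivative in direction \<open>b\<close> becomes when it is moved inside \<open>osc_integral\<close>: the derivative itself
for a direction of the torus, multiplication by \<open>\<i> \<sigma> x\<^sub>j\<close> for the direction \<open>axis_R j\<close>.\<close>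

definition osc_symbol :: "real \<Rightarrow> (real^'m) \<times> (real^'n) \<Rightarrow> ((real^'m) \<times> (real^'n) \<Rightarrow> complex) \<Rightarrow> (real^'m) \<times> (real^'n) \<Rightarrow> complex" where
  "osc_symbol \<sigma> b f = (if b \<in> range axis_T then dir_deriv b f
     else (\<lambda>z. \<i> * of_real \<sigma> * (of_real (snd z $ (THE j. b = axis_R j)) * f z)))"

lemma osc_symbol_T: "osc_symbol \<sigma> (axis_T i) f = dir_deriv (axis_T i) f"
  by (simp add: osc_symbol_def)

lemma osc_symbol_R: "osc_symbol \<sigma> (axis_R j) f = (\<lambda>z. \<i> * of_real \<sigma> * (of_real (snd z $ j) * f z))"
  by (simp add: osc_symbol_def inj_eq[OF inj_axis_R])

lemma cts_op_osc_symbol: "b \<in> Basis \<Longrightarrow> cts_op (osc_symbol \<sigma> b)"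
proof -
  assume "b \<in> Basis"
  then consider i where "b = axis_T i" | j where "b = axis_R j" unfolding Basis_TR by blast
  then show ?thesis
  proof cases
    case 1 then show ?thesis
      using cts_op_dir_deriv[of "axis_T i"] by (simp add: osc_symbol_T[abs_def])
  next
    case 2 then show ?thesis
      using cts_op_comp[OF cts_op_scale cts_op_coord] by (simp add: osc_symbol_R[abs_def])
  qed
qed

lemma has_line_deriv_osc_integral:
  fixes f :: "(real^'m) \<times> (real^'n) \<Rightarrow> complex"
  assumes f: "f \<in> schwartz_TR" and b: "b \<in> Basis"
  shows "has_line_deriv (osc_integral \<sigma> f) b (osc_integral \<sigma> (osc_symbol \<sigma> b f))"
  unfolding has_line_deriv_def
proof
  fix z :: "(real^'m) \<times> (real^'n)"
  let ?g = "osc_symbol \<sigma> b f"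
  have g: "?g \<in> schwartz_TR" using cts_op_in[OF cts_op_osc_symbol[OF b] f] .
  obtain C where C: "\<And>t x. cmod (?g (t, x)) \<le> C / weight x" using schwartz_weight_bound[OF g] by metis
  have der: "((\<lambda>s. f (fst (z + s *\<^sub>R b), x) * cis (\<sigma> * (x \<bullet> snd (z + s *\<^sub>R b)))) has_vector_derivative
      ?g (fst (z + s *\<^sub>R b), x) * cis (\<sigma> * (x \<bullet> snd (z + s *\<^sub>R b)))) (at s)" for s x
  proof -
    consider i where "b = axis_T i" | j where "b = axis_R j" using b unfolding Basis_TR by blast
    then show ?thesis
    proof cases
      case 1
      have "((\<lambda>s. f ((fst z, x) + s *\<^sub>R b)) has_vector_derivative dir_deriv b f ((fst z, x) + s *\<^sub>R b)) (at s)"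
        by (intro has_line_deriv_at smooth_has_line_deriv schwartz_TR_D f)
      then have "((\<lambda>s. f ((fst z, x) + s *\<^sub>R b) * cis (\<sigma> * (x \<bullet> snd z))) has_vector_derivative
           dir_deriv b f ((fst z, x) + s *\<^sub>R b) * cis (\<sigma> * (x \<bullet> snd z))) (at s)"
        by (auto intro!: derivative_eq_intros)
      then show ?thesis unfolding 1 osc_symbol_T by (simp add: axis_T_def)
    next
      case 2
      have "((\<lambda>s. cis (\<sigma> * ((snd z + s *\<^sub>R axis j 1) \<bullet> x))) has_vector_derivative
        \<i> * of_real (\<sigma> * (axis j 1 \<bullet> x)) * cis (\<sigma> * ((snd z + s *\<^sub>R axis j 1) \<bullet> x))) (at s)"
        by (intro has_line_deriv_at[OF has_line_deriv_cis_R])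
      then have "((\<lambda>s. f (fst z, x) * cis (\<sigma> * ((snd z + s *\<^sub>R axis j 1) \<bullet> x))) has_vector_derivative
        f (fst z, x) * (\<i> * of_real (\<sigma> * (axis j 1 \<bullet> x)) * cis (\<sigma> * ((snd z + s *\<^sub>R axis j 1) \<bullet> x)))) (at s)"
        by (auto intro!: derivative_eq_intros)
      then show ?thesis unfolding 2 osc_symbol_R
        by (simp add: axis_R_def inner_axis' inner_commute[of x] mult_ac)
    qed
  qed
  show "((\<lambda>s. osc_integral \<sigma> f (z + s *\<^sub>R b)) has_vector_derivative osc_integral \<sigma> ?g z) (at 0)"
    unfolding osc_integral_def
    using has_vector_derivative_integral_dominated[of lborel
        "\<lambda>s x. f (fst (z + s *\<^sub>R b), x) * cis (\<sigma> * (x \<bullet> snd (z + s *\<^sub>R b)))"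
        "\<lambda>s x. ?g (fst (z + s *\<^sub>R b), x) * cis (\<sigma> * (x \<bullet> snd (z + s *\<^sub>R b)))" "\<lambda>x. C * (1 / weight x)"]
    using der C integrable_mult_right[OF integrable_inverse_weight, of C] osc_integrable[OF f]
      borel_measurable_integrable[OF osc_integrable[OF g]]
    by (simp add: norm_mult)
qed

text \<open>The dual rule, which trades multiplication by a coordinate outside for a derivative inside: the integrand
\<open>f (t, x) * cis (\<sigma> * (x \<bullet> \<xi>))\<close> has a derivative with vanishing integral.\<close>

lemma coord_osc_integral:
  fixes f :: "(real^'m) \<times> (real^'n) \<Rightarrow> complex"
  assumes f: "f \<in> schwartz_TR" and \<sigma>: "\<sigma>\<^sup>2 = 1"
  shows "of_real (snd z $ j) * osc_integral \<sigma> f z = osc_integral \<sigma> (\<lambda>z. \<i> * of_real \<sigma> * dir_deriv (axis_R j) f z) z"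
proof -
  let ?d = "dir_deriv (axis_R j) f"
  have d: "?d \<in> schwartz_TR" using cts_op_in[OF cts_op_dir_deriv f] by simp
  obtain C where C: "\<And>t x. cmod (f (t, x)) \<le> C / weight x" using schwartz_weight_bound[OF f] by metis
  obtain D where D: "\<And>t x. cmod (?d (t, x)) \<le> D / weight x" using schwartz_weight_bound[OF d] by metis
  define h where "h x = f (fst z, x) * cis (\<sigma> * (x \<bullet> snd z))" for x
  define h' where "h' x = f (fst z, x) * (\<i> * of_real (\<sigma> * (snd z $ j)) * cis (\<sigma> * (x \<bullet> snd z))) + ?d (fst z, x) * cis (\<sigma> * (x \<bullet> snd z))" for x
  have ld: "has_line_deriv (\<lambda>x. f (fst z, x)) (axis j 1) (\<lambda>x. ?d (fst z, x))"
    using smooth_has_line_deriv[OF schwartz_TR_D(2)[OF f], of "axis_R j"]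
    by (auto simp: has_line_deriv_def axis_R_def)
  have "has_line_deriv h (axis j 1) h'"
    using has_line_deriv_mult[OF ld has_line_deriv_cis_R[of \<sigma> "snd z" "axis j 1"]]
    by (simp add: h_def[abs_def] h'_def[abs_def] inner_axis')
  moreover have "continuous_on UNIV h" "continuous_on UNIV h'"
    unfolding h_def[abs_def] h'_def[abs_def]
    by (auto intro!: continuous_intros schwartz_continuous[OF f] schwartz_continuous[OF d])
  moreover define K where "K = \<bar>C\<bar> + \<bar>D\<bar> + \<bar>\<sigma> * snd z $ j\<bar> * \<bar>C\<bar>"
  have "cmod (h x) \<le> K / weight x" for x
  proof -
    have "cmod (h x) \<le> C / weight x" using C by (simp add: h_def norm_mult)
    also have "C \<le> K"
      unfolding K_def using abs_ge_self[of C] mult_nonneg_nonneg[of "\<bar>\<sigma> * snd z $ j\<bar>" "\<bar>C\<bar>"]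
        abs_ge_zero[of D] abs_ge_zero[of "\<sigma> * snd z $ j"] abs_ge_zero[of C] by linarith
    then have "C / weight x \<le> K / weight x" by (intro divide_right_mono) (auto simp: less_imp_le)
    finally show ?thesis .
  qed
  moreover have "cmod (h' x) \<le> K / weight x" for x
  proof -
    have "cmod (h' x) \<le> cmod (f (fst z, x)) * \<bar>\<sigma> * snd z $ j\<bar> + cmod (?d (fst z, x))"
      unfolding h'_def by (rule order_trans[OF norm_triangle_ineq]) (simp add: norm_mult abs_mult)
    also have "\<dots> \<le> C / weight x * \<bar>\<sigma> * snd z $ j\<bar> + D / weight x"
      using C D by (intro add_mono mult_right_mono) auto
    also have "\<dots> = (C * \<bar>\<sigma> * snd z $ j\<bar> + D) / weight x" by (simp add: add_divide_distrib)
    also have "\<dots> \<le> K / weight x"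
    proof (rule divide_right_mono)
      have "C * \<bar>\<sigma> * snd z $ j\<bar> \<le> \<bar>\<sigma> * snd z $ j\<bar> * \<bar>C\<bar>"
        by (subst mult.commute) (rule mult_left_mono, auto)
      then show "C * \<bar>\<sigma> * snd z $ j\<bar> + D \<le> K"
        unfolding K_def using abs_ge_self[of D] abs_ge_zero[of C] by linarith
    qed (simp add: less_imp_le)
    finally show ?thesis .
  qed
  ultimately have "(LINT x|lborel. h' x) = 0" by (rule integral_line_deriv_eq_0)
  also have "(LINT x|lborel. h' x) = \<i> * of_real (\<sigma> * (snd z $ j)) * osc_integral \<sigma> f z + osc_integral \<sigma> ?d z"
    using osc_integrable[OF f, of "fst z" \<sigma> "snd z"] osc_integrable[OF d, of "fst z" \<sigma> "snd z"]
    by (simp add: h'_def osc_integral_def mult.left_commute[of "f _"])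
  finally have 0: "osc_integral \<sigma> ?d z = - (\<i> * of_real (\<sigma> * (snd z $ j)) * osc_integral \<sigma> f z)"
    by (simp add: add_eq_0_iff2)
  \<comment> \<open>this is where \<open>\<sigma> = \<plusminus> 1\<close> enters: the factor \<open>\<i> \<sigma>\<close> has inverse \<open>- \<i> \<sigma>\<close>\<close>
  have s: "complex_of_real \<sigma> * of_real \<sigma> = 1" using \<sigma> by (simp add: power2_eq_square flip: of_real_mult)
  have "osc_integral \<sigma> (\<lambda>z. \<i> * of_real \<sigma> * ?d z) z = \<i> * of_real \<sigma> * osc_integral \<sigma> ?d z"
    by (simp add: osc_integral_def mult.assoc)
  also have "\<dots> = (of_real \<sigma> * of_real \<sigma>) * of_real (snd z $ j) * osc_integral \<sigma> f z"
    unfolding 0 by (simp add: algebra_simps)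
  finally show ?thesis unfolding s by simp
qed

text \<open>The multipliers \<open>q\<close> for which \<open>q * osc_integral \<sigma> f\<close> is again an \<open>osc_integral\<close>, of a function depending continuously on
\<open>f\<close>, contain the coordinates and are closed under products.\<close>

lemma multi_power_osc_integral:
  fixes \<gamma> :: "'n::finite \<Rightarrow> nat"
  assumes \<sigma>: "\<sigma>\<^sup>2 = 1"
  obtains A where "cts_op (A :: ((real^'m) \<times> (real^'n) \<Rightarrow> complex) \<Rightarrow> _)"
    "\<And>f z. f \<in> schwartz_TR \<Longrightarrow> of_real (multi_power (snd z) \<gamma>) * osc_integral \<sigma> f z = osc_integral \<sigma> (A f) z"
proof -
  let ?P = "\<lambda>q. \<exists>A. cts_op (A :: ((real^'m) \<times> (real^'n) \<Rightarrow> complex) \<Rightarrow> _) \<and>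
      (\<forall>f\<in>schwartz_TR. \<forall>z. of_real (q (snd z)) * osc_integral \<sigma> f z = osc_integral \<sigma> (A f) z)"
  have one: "?P (\<lambda>x. 1)" using cts_op_id by (auto intro!: exI[of _ "\<lambda>f. f"])
  have mult: "?P (\<lambda>x. p x * q x)" if p: "?P p" and q: "?P q" for p q :: "real^'n \<Rightarrow> real"
  proof -
    obtain A :: "((real^'m) \<times> (real^'n) \<Rightarrow> complex) \<Rightarrow> _" where A: "cts_op A"
       "\<forall>f\<in>schwartz_TR. \<forall>z. of_real (p (snd z)) * osc_integral \<sigma> f z = osc_integral \<sigma> (A f) z"
      using p by blast
    obtain B :: "((real^'m) \<times> (real^'n) \<Rightarrow> complex) \<Rightarrow> _" where B: "cts_op B"
       "\<forall>f\<in>schwartz_TR. \<forall>z. of_real (q (snd z)) * osc_integral \<sigma> f z = osc_integral \<sigma> (B f) z"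
      using q by blast
    have "of_real (p (snd z) * q (snd z)) * osc_integral \<sigma> f z = osc_integral \<sigma> (A (B f)) z" if "f \<in> schwartz_TR" for f z
      using A(2) B(2) cts_op_in[OF B(1) that] that by (simp add: mult.assoc del: split_paired_All)
    then show ?thesis using cts_op_comp[OF A(1) B(1)] by blast
  qed
  have coord: "?P (\<lambda>x. x $ j)" for j
    using cts_op_comp[OF cts_op_scale cts_op_dir_deriv[of "axis_R j"], of "\<i> * of_real \<sigma>"] coord_osc_integral[OF _ \<sigma>]
    by (intro exI[of _ "\<lambda>f z. \<i> * of_real \<sigma> * dir_deriv (axis_R j) f z"]) auto
  have pow: "?P (\<lambda>x. (x $ j) ^ n)" for j n
  proof (induction n)
    case 0 show ?case using one by simp
  next
    case (Suc n) show ?case using mult[OF coord Suc, of j] by simp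
  qed
  have "?P (\<lambda>x. \<Prod>j\<in>J. (x $ j) ^ \<gamma> j)" if "finite J" for J
    using that
  proof induction
    case empty show ?case using one by simp
  next
    case (insert j J) show ?case using mult[OF pow insert.IH, of j "\<gamma> j"] insert.hyps by simp
  qed
  from this[of UNIV] show ?thesis using that unfolding multi_power_def by auto
qed

lemma controlled_osc_integral:
  "controlled (\<lambda>(f :: (real^'a) \<times> (real^'b) \<Rightarrow> complex) z. cmod (osc_integral \<sigma> f z))"
proof -
  obtain C r where C: "C \<ge> 0" "\<And>(f :: (real^'a) \<times> (real^'b) \<Rightarrow> complex) z. f \<in> schwartz_TR \<Longrightarrow> weight (snd z) ^ 1 * cmod (f z) \<le> C * seminorm_TR r f"
    using controlledE[OF controlled_weight] by metis
  let ?I = "LINT x|lborel. 1 / weight (x :: real^'b)"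
  show ?thesis
  proof (rule controlledI[of "C * ?I" _ r])
    fix f :: "(real^'a) \<times> (real^'b) \<Rightarrow> complex" and z assume f: "f \<in> schwartz_TR"
    have "cmod (osc_integral \<sigma> f z) \<le> (LINT x|lborel. cmod (f (fst z, x) * cis (\<sigma> * (x \<bullet> snd z))))"
      unfolding osc_integral_def by (rule integral_norm_bound)
    also have "\<dots> \<le> (LINT x|lborel. C * seminorm_TR r f * (1 / weight (x :: real^'b)))"
    proof (rule integral_mono)
      show "integrable lborel (\<lambda>x :: real^'b. C * seminorm_TR r f * (1 / weight x))"
        by (intro integrable_mult_right integrable_inverse_weight)
      show "cmod (f (fst z, x) * cis (\<sigma> * (x \<bullet> snd z))) \<le> C * seminorm_TR r f * (1 / weight x)" for x
        using C(2)[OF f, of "(fst z, x)"] by (simp add: norm_mult pos_le_divide_eq mult.commute)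
    qed (intro integrable_norm osc_integrable f)
    also have "\<dots> = C * seminorm_TR r f * ?I" by (subst integral_mult_right_zero) simp
    finally show "cmod (osc_integral \<sigma> f z) \<le> C * ?I * seminorm_TR r f" by (simp add: mult_ac)
  qed (auto intro!: mult_nonneg_nonneg C integral_nonneg simp: less_imp_le)
qed

lemma cts_op_osc_integral:
  assumes \<sigma>: "\<sigma>\<^sup>2 = 1"
  shows "cts_op (osc_integral \<sigma> :: ((real^'m) \<times> (real^'n) \<Rightarrow> complex) \<Rightarrow> _)"
proof (rule cts_op_by_commutators[where A="osc_symbol \<sigma>" and B="\<lambda>b f z. 0 * f z"])
  fix \<gamma> :: "'n \<Rightarrow> nat"
  obtain A where A: "cts_op (A :: ((real^'m) \<times> (real^'n) \<Rightarrow> complex) \<Rightarrow> _)"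
    "\<And>f z. f \<in> schwartz_TR \<Longrightarrow> of_real (multi_power (snd z) \<gamma>) * osc_integral \<sigma> f z = osc_integral \<sigma> (A f) z"
    using multi_power_osc_integral[OF \<sigma>, of \<gamma>] by metis
  show "controlled (\<lambda>f. wderiv [] \<gamma> (osc_integral \<sigma> (f :: (real^'m) \<times> (real^'n) \<Rightarrow> complex)))"
    by (rule controlled_mono[OF controlled_comp[OF controlled_osc_integral[of \<sigma>] A(1)], of 1])
      (auto simp: wderiv_def A(2) intro!: exI)
next
  fix f :: "(real^'m) \<times> (real^'n) \<Rightarrow> complex" assume f: "f \<in> schwartz_TR"
  show "periodic_T (osc_integral \<sigma> f)"
    using schwartz_TR_D(1)[OF f] by (simp add: periodic_T_def osc_integral_def)
  show "continuous_on UNIV (osc_integral \<sigma> f)" by (rule continuous_osc_integral[OF f])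
next
  fix b :: "(real^'m) \<times> (real^'n)" and f :: "(real^'m) \<times> (real^'n) \<Rightarrow> complex"
  assume "b \<in> Basis" "f \<in> schwartz_TR"
  from has_line_deriv_osc_integral[OF this(2,1), of \<sigma>]
  show "has_line_deriv (osc_integral \<sigma> f) b (\<lambda>z. osc_integral \<sigma> (osc_symbol \<sigma> b f) z + 0 * f z)" by simp
qed (rule cts_op_scale cts_op_osc_symbol | assumption)+


section \<open>Fourier inversion in the Euclidean variable\<close>

text \<open>The value is the characteristic function of the standard normal distribution, rescaled.\<close>

lemma gaussian_fourier_1D:
  fixes t \<epsilon> :: real
  assumes "\<epsilon> > 0"
  shows "integrable lborel (\<lambda>y. cis (t * y) * of_real (exp (- (\<epsilon> * y)\<^sup>2 / 2)))"
    and "(LINT y|lborel. cis (t * y) * of_real (exp (- (\<epsilon> * y)\<^sup>2 / 2))) = of_real (sqrt (2 * pi) / \<epsilon> * exp (- (t / \<epsilon>)\<^sup>2 / 2))"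
proof -
  let ?g = "\<lambda>t y. cis (t * y) * of_real (exp (- y\<^sup>2 / 2))"
  have d: "?g t y = of_real (sqrt (2 * pi)) * (std_normal_density y *\<^sub>R cis (t * y))" for t y
    by (simp add: std_normal_density_def scaleR_conv_of_real flip: of_real_mult)
  have int: "integrable lborel (\<lambda>y. std_normal_density y *\<^sub>R cis (t * y))" for t
    by (rule Bochner_Integration.integrable_bound[of _ std_normal_density])
      (auto simp: integrable_normal_density cis_conv_exp)
  have int': "integrable lborel (?g t)" for t
    unfolding d by (intro integrable_mult_right int)
  have val: "(LINT y|lborel. ?g t y) = of_real (sqrt (2 * pi) * exp (- t\<^sup>2 / 2))" for t
  proof -
    have "(LINT y|lborel. ?g t y) = of_real (sqrt (2 * pi)) * (LINT y|lborel. std_normal_density y *\<^sub>R cis (t * y))"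
      unfolding d by (rule integral_mult_right_zero)
    also have "(LINT y|lborel. std_normal_density y *\<^sub>R cis (t * y)) = char std_normal_distribution t"
      unfolding char_def by (subst integral_density) (auto simp: cis_conv_exp)
    finally show ?thesis by (simp add: char_std_normal_distribution)
  qed
  let ?h = "\<lambda>y. cis (t * y) * of_real (exp (- (\<epsilon> * y)\<^sup>2 / 2))"
  have sub: "?h (0 + (1 / \<epsilon>) * y) = ?g (t / \<epsilon>) y" for y using assms by simp
  show "integrable lborel ?h"
    using lborel_integrable_real_affine_iff[of "1 / \<epsilon>" ?h 0] int'[of "t / \<epsilon>"] assms unfolding sub by simp
  show "(LINT y|lborel. ?h y) = of_real (sqrt (2 * pi) / \<epsilon> * exp (- (t / \<epsilon>)\<^sup>2 / 2))"
    using lborel_integral_real_affine[of "1 / \<epsilon>" ?h 0] assms unfolding sub val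
    by (simp add: scaleR_conv_of_real)
qed

lemma cis_inner_eq_prod: "cis (v \<bullet> x) = (\<Prod>j\<in>UNIV. cis (v $ j * x $ j))" for v x :: "real^'n"
  by (simp add: inner_vec_def cis_conv_exp sum_distrib_left exp_sum)

lemma exp_norm_eq_prod: "exp (- (c * norm x)\<^sup>2 / 2) = (\<Prod>j\<in>UNIV. exp (- (c * x $ j)\<^sup>2 / 2))" for x :: "real^'n"
proof -
  have "(norm x)\<^sup>2 = (\<Sum>j\<in>UNIV. (x $ j)\<^sup>2)"
    unfolding power2_norm_eq_inner by (simp add: inner_vec_def power2_eq_square)
  then have "- (c * norm x)\<^sup>2 / 2 = (\<Sum>j\<in>UNIV. - (c * x $ j)\<^sup>2 / 2)"
    by (simp add: power_mult_distrib sum_distrib_left sum_negf sum_divide_distrib)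
  then show ?thesis by (simp add: exp_sum)
qed

lemma gaussian_fourier:
  fixes v :: "real^'n" and \<epsilon> :: real
  assumes "\<epsilon> > 0"
  shows "integrable lborel (\<lambda>x::real^'n. cis (v \<bullet> x) * of_real (exp (- (\<epsilon> * norm x)\<^sup>2 / 2)))"
    and "(LINT x|lborel. cis (v \<bullet> x) * of_real (exp (- (\<epsilon> * norm x)\<^sup>2 / 2))) =
      of_real ((sqrt (2 * pi) / \<epsilon>) ^ CARD('n) * exp (- (norm v / \<epsilon>)\<^sup>2 / 2))"
proof -
  let ?g = "\<lambda>j y. cis (v $ j * y) * of_real (exp (- (\<epsilon> * y)\<^sup>2 / 2))"
  have e: "cis (v \<bullet> x) * of_real (exp (- (\<epsilon> * norm x)\<^sup>2 / 2)) = (\<Prod>j\<in>UNIV. ?g j (x $ j))" for x :: "real^'n"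
    unfolding cis_inner_eq_prod exp_norm_eq_prod of_real_prod prod.distrib ..
  show "integrable lborel (\<lambda>x::real^'n. cis (v \<bullet> x) * of_real (exp (- (\<epsilon> * norm x)\<^sup>2 / 2)))"
    unfolding e by (intro lborel_vec_prod gaussian_fourier_1D assms)
  have "(LINT x|lborel. cis (v \<bullet> x) * of_real (exp (- (\<epsilon> * norm x)\<^sup>2 / 2))) = (\<Prod>j\<in>UNIV. LINT y|lborel. ?g j y)"
    unfolding e by (intro lborel_vec_prod gaussian_fourier_1D assms)
  also have "\<dots> = (\<Prod>j\<in>UNIV. of_real (sqrt (2 * pi) / \<epsilon> * exp (- ((1 / \<epsilon>) * v $ j)\<^sup>2 / 2)))"
    by (simp only: gaussian_fourier_1D(2)[OF assms]) simp
  also have "\<dots> = of_real ((sqrt (2 * pi) / \<epsilon>) ^ CARD('n) * exp (- ((1 / \<epsilon>) * norm v)\<^sup>2 / 2))"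
    unfolding exp_norm_eq_prod of_real_prod[symmetric] prod.distrib by simp
  finally show "(LINT x|lborel. cis (v \<bullet> x) * of_real (exp (- (\<epsilon> * norm x)\<^sup>2 / 2))) =
      of_real ((sqrt (2 * pi) / \<epsilon>) ^ CARD('n) * exp (- (norm v / \<epsilon>)\<^sup>2 / 2))" by simp
qed

lemma integrable_gaussian:
  assumes "\<epsilon> > 0" shows "integrable lborel (\<lambda>x::real^'n. exp (- (\<epsilon> * norm x)\<^sup>2 / 2))"
  using gaussian_fourier(1)[OF assms, of "0 :: real^'n"] by (simp add: complex_of_real_integrable_eq)

lemma integral_affine_euclidean:
  fixes h :: "'a::euclidean_space \<Rightarrow> complex"
  assumes "c \<noteq> 0" and [measurable]: "h \<in> borel_measurable borel"
  shows "(LINT y|lborel. h y) = of_real (\<bar>c\<bar> ^ DIM('a)) * (LINT w|lborel. h (t + c *\<^sub>R w))"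
proof -
  have "(LINT y|lborel. h y) = (LINT y|density (distr lborel borel (\<lambda>x. t + c *\<^sub>R x)) (\<lambda>_. ennreal (\<bar>c\<bar> ^ DIM('a))). h y)"
    using lborel_affine[OF assms(1), of t] by (simp add: ennreal_power)
  also have "\<dots> = (LINT y|distr lborel borel (\<lambda>x. t + c *\<^sub>R x). \<bar>c\<bar> ^ DIM('a) *\<^sub>R h y)"
    by (subst integral_density) auto
  also have "\<dots> = (LINT w|lborel. \<bar>c\<bar> ^ DIM('a) *\<^sub>R h (t + c *\<^sub>R w))"
    by (subst integral_distr) auto
  finally show ?thesis by (simp add: scaleR_conv_of_real)
qed

text \<open>Fubini's theorem moves the damped inverse transform onto the Gaussian, whose transform is known; the substitution
\<open>y = x + \<epsilon> *\<^sub>R w\<close> then shows an average of \<open>f\<close> around \<open>x\<close> at scale \<open>\<epsilon>\<close>.\<close>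

lemma gaussian_regularisation:
  fixes f :: "real^'n \<Rightarrow> complex" and x :: "real^'n"
  assumes c: "continuous_on UNIV f" and b: "\<And>y. cmod (f y) \<le> C / weight y" and \<epsilon>: "\<epsilon> > 0"
  shows "(LINT \<xi>|lborel. (LINT y|lborel. f y * cis (- (y \<bullet> \<xi>))) * cis (x \<bullet> \<xi>) * of_real (exp (- (\<epsilon> * norm \<xi>)\<^sup>2 / 2)))
    = of_real (sqrt (2 * pi) ^ CARD('n)) * (LINT w|lborel. f (x + \<epsilon> *\<^sub>R w) * of_real (exp (- (norm w)\<^sup>2 / 2)))"
proof -
  let ?e = "\<lambda>\<xi>::real^'n. exp (- (\<epsilon> * norm \<xi>)\<^sup>2 / 2)"
  let ?K = "\<lambda>y \<xi>. f y * (cis ((x - y) \<bullet> \<xi>) * of_real (?e \<xi>))"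
  have fm [measurable]: "f \<in> borel_measurable borel" using c by (rule borel_measurable_continuous_onI)
  have cm [measurable]: "cis \<in> borel_measurable borel"
    unfolding cis_conv_exp[abs_def] by measurable
  have fi: "integrable lborel f" by (rule integrable_weight_bounded[OF c b])
  have ei: "integrable lborel ?e" by (rule integrable_gaussian[OF \<epsilon>])
  have m: "(\<lambda>(y, \<xi>). ?K y \<xi>) \<in> borel_measurable (lborel \<Otimes>\<^sub>M lborel)"
    by measurable
  have int: "integrable (lborel \<Otimes>\<^sub>M lborel) (\<lambda>(y, \<xi>). ?K y \<xi>)"
  proof (rule lborel_pair.Fubini_integrable[OF m])
    have "(\<lambda>y. LINT \<xi>|lborel. cmod (case (y, \<xi>) of (y, \<xi>) \<Rightarrow> ?K y \<xi>)) = (\<lambda>y. cmod (f y) * (LINT \<xi>|lborel. ?e \<xi>))"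
      by (simp add: norm_mult)
    then show "integrable lborel (\<lambda>y. LINT \<xi>|lborel. cmod (case (y, \<xi>) of (y, \<xi>) \<Rightarrow> ?K y \<xi>))"
      using fi by simp
    show "AE y in lborel. integrable lborel (\<lambda>\<xi>. case (y, \<xi>) of (y, \<xi>) \<Rightarrow> ?K y \<xi>)"
      unfolding prod.case by (intro AE_I2 integrable_mult_right gaussian_fourier(1)[OF \<epsilon>])
  qed
  have "(LINT \<xi>|lborel. (LINT y|lborel. f y * cis (- (y \<bullet> \<xi>))) * cis (x \<bullet> \<xi>) * of_real (?e \<xi>))
      = (LINT \<xi>|lborel. LINT y|lborel. ?K y \<xi>)"
  proof (rule Bochner_Integration.integral_cong[OF refl])
    fix \<xi> :: "real^'n"
    have "?K y \<xi> = f y * cis (- (y \<bullet> \<xi>)) * (cis (x \<bullet> \<xi>) * of_real (?e \<xi>))" for y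
      by (simp add: inner_diff_left cis_mult mult_ac flip: mult.assoc)
    then have "(LINT y|lborel. ?K y \<xi>) = (LINT y|lborel. f y * cis (- (y \<bullet> \<xi>)) * (cis (x \<bullet> \<xi>) * of_real (?e \<xi>)))"
      by (simp only:)
    also have "\<dots> = (LINT y|lborel. f y * cis (- (y \<bullet> \<xi>))) * (cis (x \<bullet> \<xi>) * of_real (?e \<xi>))"
      by (rule integral_mult_left_zero)
    finally show "(LINT y|lborel. f y * cis (- (y \<bullet> \<xi>))) * cis (x \<bullet> \<xi>) * of_real (?e \<xi>) = (LINT y|lborel. ?K y \<xi>)"
      by (simp only: mult.assoc)
  qed
  also have "\<dots> = (LINT y|lborel. LINT \<xi>|lborel. ?K y \<xi>)"
    using lborel_pair.Fubini_integral[OF int] by simp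
  also have "\<dots> = (LINT y|lborel. f y * of_real ((sqrt (2 * pi) / \<epsilon>) ^ CARD('n) * exp (- (norm (x - y) / \<epsilon>)\<^sup>2 / 2)))"
    by (simp only: integral_mult_right_zero gaussian_fourier(2)[OF \<epsilon>])
  also have "\<dots> = of_real (\<epsilon> ^ CARD('n)) * (LINT w|lborel. f (x + \<epsilon> *\<^sub>R w) * of_real ((sqrt (2 * pi) / \<epsilon>) ^ CARD('n) * exp (- (norm (x - (x + \<epsilon> *\<^sub>R w)) / \<epsilon>)\<^sup>2 / 2)))"
    using \<epsilon> by (subst integral_affine_euclidean[of \<epsilon> _ x]) auto
  also have "\<dots> = of_real (\<epsilon> ^ CARD('n)) * (LINT w|lborel. of_real ((sqrt (2 * pi) / \<epsilon>) ^ CARD('n)) * (f (x + \<epsilon> *\<^sub>R w) * of_real (exp (- (norm w)\<^sup>2 / 2))))"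
    using \<epsilon> by (simp add: mult_ac)
  also have "\<dots> = of_real (sqrt (2 * pi) ^ CARD('n)) * (LINT w|lborel. f (x + \<epsilon> *\<^sub>R w) * of_real (exp (- (norm w)\<^sup>2 / 2)))"
  proof (subst integral_mult_right_zero)
    have "\<epsilon> ^ CARD('n) * (sqrt (2 * pi) / \<epsilon>) ^ CARD('n) = sqrt (2 * pi) ^ CARD('n)"
      using \<epsilon> by (simp add: power_divide)
    then show "of_real (\<epsilon> ^ CARD('n)) * (of_real ((sqrt (2 * pi) / \<epsilon>) ^ CARD('n)) * I) = of_real (sqrt (2 * pi) ^ CARD('n)) * I" for I :: complex
      by (simp only: mult.assoc[symmetric] of_real_mult[symmetric])
  qed
  finally show ?thesis .
qed

text \<open>Let \<open>\<epsilon>\<close> tend to zero in \<open>gaussian_regularisation\<close>, with dominated convergence on both sides.  Each of the two Gaussian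
integrals contributes a factor \<open>sqrt (2 * pi) ^ CARD('n)\<close>.\<close>

lemma fourier_inversion_weight_bounded:
  fixes f F :: "real^'n \<Rightarrow> complex"
  assumes c: "continuous_on UNIV f" and b: "\<And>y. cmod (f y) \<le> C / weight y"
    and F: "\<And>\<xi>. F \<xi> = (LINT y|lborel. f y * cis (- (y \<bullet> \<xi>)))"
    and cF: "continuous_on UNIV F" and bF: "\<And>y. cmod (F y) \<le> D / weight y"
  shows "(LINT \<xi>|lborel. F \<xi> * cis (x \<bullet> \<xi>)) = of_real ((2 * pi) ^ CARD('n)) * f x"
proof (rule LIMSEQ_unique)
  let ?\<epsilon> = "\<lambda>k. inverse (real (Suc k))"
  have \<epsilon>0: "?\<epsilon> \<longlonglongrightarrow> 0" by (rule LIMSEQ_inverse_real_of_nat)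
  have [measurable]: "f \<in> borel_measurable borel" "F \<in> borel_measurable borel"
    using c cF by (auto intro: borel_measurable_continuous_onI)
  have cm [measurable]: "cis \<in> borel_measurable borel"
    unfolding cis_conv_exp[abs_def] by measurable
  have Fi: "integrable lborel F" by (rule integrable_weight_bounded[OF cF bF])
  let ?L = "\<lambda>k. LINT \<xi>|lborel. F \<xi> * cis (x \<bullet> \<xi>) * of_real (exp (- (?\<epsilon> k * norm \<xi>)\<^sup>2 / 2))"
  show "?L \<longlonglongrightarrow> (LINT \<xi>|lborel. F \<xi> * cis (x \<bullet> \<xi>))"
  proof (rule integral_dominated_convergence[where w="\<lambda>\<xi>. cmod (F \<xi>)"])
    show "AE \<xi> in lborel. (\<lambda>k. F \<xi> * cis (x \<bullet> \<xi>) * of_real (exp (- (?\<epsilon> k * norm \<xi>)\<^sup>2 / 2))) \<longlonglongrightarrow> F \<xi> * cis (x \<bullet> \<xi>)"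
    proof (rule AE_I2)
      fix \<xi> :: "real^'n"
      have "(\<lambda>k. F \<xi> * cis (x \<bullet> \<xi>) * of_real (exp (- (?\<epsilon> k * norm \<xi>)\<^sup>2 / 2))) \<longlonglongrightarrow> F \<xi> * cis (x \<bullet> \<xi>) * of_real (exp (- (0 * norm \<xi>)\<^sup>2 / 2))"
        by (intro tendsto_intros \<epsilon>0) auto
      then show "(\<lambda>k. F \<xi> * cis (x \<bullet> \<xi>) * of_real (exp (- (?\<epsilon> k * norm \<xi>)\<^sup>2 / 2))) \<longlonglongrightarrow> F \<xi> * cis (x \<bullet> \<xi>)" by simp
    qed
    show "AE \<xi> in lborel. cmod (F \<xi> * cis (x \<bullet> \<xi>) * of_real (exp (- (?\<epsilon> k * norm \<xi>)\<^sup>2 / 2))) \<le> cmod (F \<xi>)" for k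
      by (intro AE_I2) (simp add: norm_mult mult_left_le)
  qed (use Fi in auto)
  have C0: "0 \<le> C"
    using order_trans[OF norm_ge_zero b[of 0]] weight_pos[of "0::real^'n"] by (auto simp: zero_le_divide_iff)
  have bC: "cmod (f y) \<le> C" for y
    using order_trans[OF b[of y] divide_left_mono[OF weight_ge_1[of y] C0]] by simp
  let ?R = "\<lambda>k. LINT w|lborel. f (x + ?\<epsilon> k *\<^sub>R w) * of_real (exp (- (norm w)\<^sup>2 / 2))"
  have gi: "integrable lborel (\<lambda>w::real^'n. exp (- (norm w)\<^sup>2 / 2))" using integrable_gaussian[of 1] by simp
  have "?R \<longlonglongrightarrow> (LINT w|lborel. f x * of_real (exp (- (norm (w::real^'n))\<^sup>2 / 2)))"
  proof (rule integral_dominated_convergence[where w="\<lambda>w. C * exp (- (norm w)\<^sup>2 / 2)"])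
    show "AE w in lborel. (\<lambda>k. f (x + ?\<epsilon> k *\<^sub>R w) * of_real (exp (- (norm w)\<^sup>2 / 2))) \<longlonglongrightarrow> f x * of_real (exp (- (norm w)\<^sup>2 / 2))"
    proof (rule AE_I2)
      fix w :: "real^'n"
      have "(\<lambda>k. x + ?\<epsilon> k *\<^sub>R w) \<longlonglongrightarrow> x + 0 *\<^sub>R w" by (intro tendsto_intros \<epsilon>0)
      then have "(\<lambda>k. f (x + ?\<epsilon> k *\<^sub>R w)) \<longlonglongrightarrow> f x"
        by (intro continuous_on_tendsto_compose[OF c]) auto
      then show "(\<lambda>k. f (x + ?\<epsilon> k *\<^sub>R w) * of_real (exp (- (norm w)\<^sup>2 / 2))) \<longlonglongrightarrow> f x * of_real (exp (- (norm w)\<^sup>2 / 2))"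
        by (intro tendsto_intros)
    qed
    show "AE w in lborel. cmod (f (x + ?\<epsilon> k *\<^sub>R w) * of_real (exp (- (norm w)\<^sup>2 / 2))) \<le> C * exp (- (norm w)\<^sup>2 / 2)" for k
      by (intro AE_I2) (simp add: norm_mult bC)
  qed (use gi in auto)
  also have "(LINT w|lborel. f x * of_real (exp (- (norm (w::real^'n))\<^sup>2 / 2))) = f x * of_real (sqrt (2 * pi) ^ CARD('n))"
    using gaussian_fourier(2)[of 1 "0 :: real^'n"] by simp
  finally have "(\<lambda>k. of_real (sqrt (2 * pi) ^ CARD('n)) * ?R k) \<longlonglongrightarrow> of_real (sqrt (2 * pi) ^ CARD('n)) * (f x * of_real (sqrt (2 * pi) ^ CARD('n)))"
    by (intro tendsto_intros)
  moreover have "?L k = of_real (sqrt (2 * pi) ^ CARD('n)) * ?R k" for k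
    unfolding F by (rule gaussian_regularisation[OF c b]) simp
  moreover have "of_real (sqrt (2 * pi) ^ CARD('n)) * (f x * of_real (sqrt (2 * pi) ^ CARD('n))) = complex_of_real ((2 * pi) ^ CARD('n)) * f x"
  proof -
    have "sqrt (2 * pi) ^ CARD('n) * sqrt (2 * pi) ^ CARD('n) = (2 * pi) ^ CARD('n)"
      by (simp only: power_mult_distrib[symmetric] real_sqrt_mult_self) simp
    from arg_cong[OF this, of complex_of_real] show ?thesis by (simp add: mult_ac)
  qed
  ultimately show "?L \<longlonglongrightarrow> of_real ((2 * pi) ^ CARD('n)) * f x" by (simp only:)
qed

lemma fourier_R_eq_osc_integral: "fourier_R f = osc_integral (- 1) f"
  by (auto simp: fourier_R_def osc_integral_def)

lemma inv_fourier_R_eq_osc_integral: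
  fixes f :: "(real^'m) \<times> (real^'n) \<Rightarrow> complex"
  shows "inv_fourier_R f = (\<lambda>z. of_real (1 / (2 * pi) ^ CARD('n)) * osc_integral 1 f z)"
  by (auto simp: inv_fourier_R_def osc_integral_def inner_commute)

lemma cts_op_fourier_R: "cts_op fourier_R"
  using cts_op_osc_integral[of "- 1"] by (simp add: fourier_R_eq_osc_integral[abs_def])

lemma cts_op_inv_fourier_R: "cts_op (inv_fourier_R :: ((real^'m) \<times> (real^'n) \<Rightarrow> complex) \<Rightarrow> _)"
  unfolding inv_fourier_R_eq_osc_integral[abs_def]
  by (rule cts_op_comp[OF cts_op_scale cts_op_osc_integral]) simp

lemma inv_fourier_R_fourier_R:
  fixes f :: "(real^'m) \<times> (real^'n) \<Rightarrow> complex"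
  assumes f: "f \<in> schwartz_TR"
  shows "inv_fourier_R (fourier_R f) = f"
proof
  fix z :: "(real^'m) \<times> (real^'n)"
  obtain t x where z: "z = (t, x)" by (cases z)
  have g: "fourier_R f \<in> schwartz_TR" by (rule cts_op_in[OF cts_op_fourier_R f])
  obtain C where C: "\<And>t x. cmod (f (t, x)) \<le> C / weight x" using schwartz_weight_bound[OF f] by metis
  obtain D where D: "\<And>t x. cmod (fourier_R f (t, x)) \<le> D / weight x" using schwartz_weight_bound[OF g] by metis
  have "(LINT \<xi>|lborel. fourier_R f (t, \<xi>) * cis (x \<bullet> \<xi>)) = of_real ((2 * pi) ^ CARD('n)) * f (t, x)"
    by (rule fourier_inversion_weight_bounded[where f="\<lambda>x. f (t, x)", OF _ C _ _ D])
      (auto intro!: schwartz_continuous[OF f] schwartz_continuous[OF g] continuous_intros, simp add: fourier_R_def)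
  then show "inv_fourier_R (fourier_R f) z = f z"
    by (simp add: inv_fourier_R_def z)
qed


section \<open>Fourier coefficients in the periodic variable\<close>

definition torus_cell :: "(real^'m) set" where
  "torus_cell = cbox 0 (\<chi> i. 2 * pi)"

definition torus_integral :: "((real^'m) \<times> (real^'n) \<Rightarrow> complex) \<Rightarrow> (real^'m) \<times> (real^'n) \<Rightarrow> complex" where
  "torus_integral f z = integral torus_cell (\<lambda>s. f (s, snd z))"

text \<open>The shifted cell sticks out of the original one by a slab that a translation by one period carries back
to the part left uncovered.\<close>

lemma integral_periodic_shift:
  fixes g :: "real^'m \<Rightarrow> complex"
  assumes c: "continuous_on UNIV g" and per: "\<And>t. g (t + axis i (2 * pi)) = g t"
    and s: "0 \<le> s" "s \<le> 2 * pi"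
  shows "integral torus_cell (\<lambda>t. g (t + axis i s)) = integral torus_cell g"
proof -
  \<comment> \<open>the cell with its side in direction \<open>i\<close> replaced by \<open>[a, b]\<close>\<close>
  define R :: "real \<Rightarrow> real \<Rightarrow> (real^'m) set"
    where "R a b = cbox (\<chi> j. if j = i then a else 0) (\<chi> j. if j = i then b else 2 * pi)" for a b
  have mem: "t \<in> R a b \<longleftrightarrow> a \<le> t $ i \<and> t $ i \<le> b \<and> (\<forall>j. j \<noteq> i \<longrightarrow> 0 \<le> t $ j \<and> t $ j \<le> 2 * pi)" for t a b
    unfolding R_def mem_box_cart by (auto split: if_splits)
  have cell: "torus_cell = R 0 (2 * pi)"
    unfolding torus_cell_def R_def by (intro arg_cong2[of _ _ _ _ cbox]) (auto simp: vec_eq_iff)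
  have split: "integral (R a b) g = integral (R a c) g + integral (R c b) g" if "a \<le> c" "c \<le> b" for a b c
  proof -
    have "R a b \<inter> {x. x \<bullet> axis i 1 \<le> c} = R a c" "R a b \<inter> {x. c \<le> x \<bullet> axis i 1} = R c b"
      using that by (auto simp: mem inner_axis)
    moreover have "g integrable_on R a b"
      unfolding R_def by (intro integrable_continuous continuous_on_subset[OF c]) auto
    ultimately show ?thesis
      using integral_split[of g "\<chi> j. if j = i then a else 0" "\<chi> j. if j = i then b else 2 * pi" "axis i 1" c]
      unfolding R_def[symmetric] by (simp add: R_def[symmetric])
  qed
  have shift: "integral (R a b) (\<lambda>t. g (t + axis i d)) = integral (R (a + d) (b + d)) g" for a b d
  proof -
    have *: "(\<chi> j. if j = i then a else 0) + axis i d = (\<chi> j. if j = i then a + d else 0)"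
       "(\<chi> j. if j = i then b else 2 * pi) + axis i d = (\<chi> j. if j = i then b + d else 2 * pi)" for a b
      by (auto simp: vec_eq_iff axis_def)
    show ?thesis
      using integral_shift_cbox_plus[of "\<chi> j. if j = i then a else 0" "\<chi> j. if j = i then b else 2 * pi" g "axis i d"]
      unfolding * R_def by (simp add: o_def add.commute)
  qed
  have "integral torus_cell (\<lambda>t. g (t + axis i s)) = integral (R s (2 * pi + s)) g"
    unfolding cell shift by simp
  also have "\<dots> = integral (R s (2 * pi)) g + integral (R (0 + 2 * pi) (s + 2 * pi)) g"
    using s by (subst split[of s "2 * pi"]) (auto simp: add.commute)
  also have "integral (R (0 + 2 * pi) (s + 2 * pi)) g = integral (R 0 s) g"
    by (subst shift[symmetric]) (simp add: per)
  also have "integral (R s (2 * pi)) g + integral (R 0 s) g = integral torus_cell g"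
    unfolding cell using s by (subst split[of 0 s "2 * pi"]) auto
  finally show ?thesis .
qed

lemma continuous_torus_integral:
  fixes f :: "(real^'m) \<times> (real^'n) \<Rightarrow> complex"
  assumes "f \<in> schwartz_TR"
  shows "continuous_on UNIV (torus_integral f)"
proof -
  have "continuous_on UNIV (\<lambda>z::(real^'m) \<times> (real^'n). integral (cbox 0 (\<chi> i. 2 * pi)) (\<lambda>s. f (s, snd z)))"
    by (rule integral_continuous_on_param)
      (auto intro!: continuous_on_compose2[OF smooth_imp_continuous[OF schwartz_TR_D(2)[OF assms]]] continuous_intros simp: split_beta)
  then show ?thesis by (simp add: torus_integral_def[abs_def] torus_cell_def)
qed

lemma torus_integral_line_deriv:
  fixes f :: "(real^'m) \<times> (real^'n) \<Rightarrow> complex"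
  assumes f: "f \<in> schwartz_TR" and b: "b \<in> Basis"
  shows "((\<lambda>\<sigma>. integral torus_cell (\<lambda>s. f ((s, x) + \<sigma> *\<^sub>R b))) has_vector_derivative
      torus_integral (dir_deriv b f) (t, x)) (at 0)"
proof -
  have d: "smooth (dir_deriv b f)" using schwartz_TR_D(2)[OF f] b by (rule smooth_dir_deriv)
  have "((\<lambda>\<sigma>. integral (cbox 0 (\<chi> i. 2 * pi)) (\<lambda>s. f ((s, x) + \<sigma> *\<^sub>R b))) has_vector_derivative
      integral (cbox 0 (\<chi> i. 2 * pi)) (\<lambda>s. dir_deriv b f ((s, x) + 0 *\<^sub>R b))) (at 0 within UNIV)"
  proof (rule leibniz_rule_vector_derivative)
    show "((\<lambda>\<sigma>. f ((s, x) + \<sigma> *\<^sub>R b)) has_vector_derivative dir_deriv b f ((s, x) + \<sigma> *\<^sub>R b)) (at \<sigma> within UNIV)" for \<sigma> s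
      by (intro has_line_deriv_at smooth_has_line_deriv schwartz_TR_D f)
    show "(\<lambda>s. f ((s, x) + \<sigma> *\<^sub>R b)) integrable_on cbox 0 (\<chi> i. 2 * pi)" for \<sigma>
      by (auto intro!: integrable_continuous continuous_on_compose2[OF smooth_imp_continuous[OF schwartz_TR_D(2)[OF f]]] continuous_intros)
    show "continuous_on (UNIV \<times> cbox 0 (\<chi> i. 2 * pi)) (\<lambda>(\<sigma>, s). dir_deriv b f ((s, x) + \<sigma> *\<^sub>R b))"
      by (auto intro!: continuous_on_compose2[OF smooth_imp_continuous[OF d]] continuous_intros simp: split_beta)
  qed auto
  then show ?thesis by (simp add: torus_integral_def torus_cell_def)
qed

text \<open>The integral of a shifted function over the cell does not depend on the shift, so the derivative of this integral,
which is the integral of the derivative, vanishes.\<close>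

lemma torus_integral_dir_deriv_T:
  fixes f :: "(real^'m) \<times> (real^'n) \<Rightarrow> complex"
  assumes f: "f \<in> schwartz_TR"
  shows "torus_integral (dir_deriv (axis_T i) f) z = 0"
proof -
  obtain t x where z: "z = (t, x)" by (cases z)
  have c: "continuous_on UNIV (\<lambda>s. f (s, x))"
    by (auto intro!: continuous_on_compose2[OF smooth_imp_continuous[OF schwartz_TR_D(2)[OF f]]] continuous_intros)
  have "integral torus_cell (\<lambda>s. f ((s, x) + \<sigma> *\<^sub>R axis_T i)) = integral torus_cell (\<lambda>s. f (s, x))"
    if "\<sigma> \<in> {0..2 * pi}" for \<sigma>
  proof -
    have "\<sigma> *\<^sub>R axis i 1 = axis i \<sigma>" by (auto simp: vec_eq_iff axis_def)
    then show ?thesis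
      using integral_periodic_shift[OF c, of i \<sigma>] schwartz_TR_D(1)[OF f] that
      by (simp add: axis_T_def periodic_T_def)
  qed
  then have "((\<lambda>\<sigma>. integral torus_cell (\<lambda>s. f ((s, x) + \<sigma> *\<^sub>R axis_T i))) has_vector_derivative 0) (at 0 within cbox 0 (2 * pi))"
    using has_vector_derivative_transform[of 0 "{0..2*pi}" "\<lambda>\<sigma>. integral torus_cell (\<lambda>s. f ((s, x) + \<sigma> *\<^sub>R axis_T i))"
       "\<lambda>_. integral torus_cell (\<lambda>s. f (s, x))" 0] by auto
  moreover have "((\<lambda>\<sigma>. integral torus_cell (\<lambda>s. f ((s, x) + \<sigma> *\<^sub>R axis_T i))) has_vector_derivative
      torus_integral (dir_deriv (axis_T i) f) z) (at 0 within cbox 0 (2 * pi))"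
    using torus_integral_line_deriv[OF f, of "axis_T i" x t] unfolding z
    by (auto intro: has_vector_derivative_at_within)
  ultimately show ?thesis
    using vector_derivative_unique_within_closed_interval[of 0 "2 * pi" 0] by fastforce
qed

lemma has_line_deriv_torus_integral:
  fixes f :: "(real^'m) \<times> (real^'n) \<Rightarrow> complex"
  assumes f: "f \<in> schwartz_TR" and b: "b \<in> Basis"
  shows "has_line_deriv (torus_integral f) b (torus_integral (dir_deriv b f))"
proof -
  consider i where "b = axis_T i" | j where "b = axis_R j" using b unfolding Basis_TR by blast
  then show ?thesis
  proof cases
    case 1
    then show ?thesis
      by (simp add: has_line_deriv_def torus_integral_dir_deriv_T[OF f]) (simp add: torus_integral_def axis_T_def)
  next
    case 2
    show ?thesis unfolding has_line_deriv_def
    proof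
      fix z :: "(real^'m) \<times> (real^'n)"
      show "((\<lambda>s. torus_integral f (z + s *\<^sub>R b)) has_vector_derivative torus_integral (dir_deriv b f) z) (at 0)"
        using torus_integral_line_deriv[OF f b, of "snd z" "fst z"] 2 by (simp add: torus_integral_def axis_R_def)
    qed
  qed
qed

lemma norm_torus_integral_le:
  fixes f :: "(real^'m) \<times> (real^'n) \<Rightarrow> complex"
  assumes f: "f \<in> schwartz_TR" and K: "\<And>s. cmod (f (s, x)) \<le> K"
  shows "cmod (torus_integral f (t, x)) \<le> (2 * pi) ^ CARD('m) * K"
proof -
  have K0: "0 \<le> K" using order_trans[OF norm_ge_zero K] .
  have i: "(\<lambda>s. f (s, x)) integrable_on cbox 0 (\<chi> i. 2 * pi)"
    by (auto intro!: integrable_continuous continuous_on_compose2[OF smooth_imp_continuous[OF schwartz_TR_D(2)[OF f]]] continuous_intros)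
  have "measure lborel (cbox 0 (\<chi> i. 2 * pi) :: (real^'m) set) = (2 * pi) ^ CARD('m)"
    by (subst content_cbox_cart) (auto simp: interval_ne_empty_cart)
  then show ?thesis
    using has_integral_bound[OF K0 integrable_integral[OF i]] K by (simp add: torus_integral_def torus_cell_def mult.commute)
qed

lemma torus_integral_scale: "torus_integral (\<lambda>z. c * f z) z = c * torus_integral f z"
  unfolding torus_integral_def by simp

text \<open>Averaging commutes with every partial derivative: with those of the torus because both sides vanish.\<close>

lemma cts_op_torus_integral:
  "cts_op (torus_integral :: ((real^'m) \<times> (real^'n) \<Rightarrow> complex) \<Rightarrow> _)"
proof (rule cts_op_by_commutators[where A=dir_deriv and B="\<lambda>b f z. 0 * f z"])
  fix f :: "(real^'m) \<times> (real^'n) \<Rightarrow> complex" assume f: "f \<in> schwartz_TR"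
  show "periodic_T (torus_integral f)" by (simp add: periodic_T_def torus_integral_def)
  show "continuous_on UNIV (torus_integral f)" by (rule continuous_torus_integral[OF f])
next
  fix b :: "(real^'m) \<times> (real^'n)" and f :: "(real^'m) \<times> (real^'n) \<Rightarrow> complex"
  assume "b \<in> Basis" "f \<in> schwartz_TR"
  from has_line_deriv_torus_integral[OF this(2,1)]
  show "has_line_deriv (torus_integral f) b (\<lambda>z. torus_integral (dir_deriv b f) z + 0 * f z)" by simp
next
  fix \<gamma> :: "'n \<Rightarrow> nat"
  obtain C r where C: "C \<ge> 0" "\<And>(f :: (real^'m) \<times> (real^'n) \<Rightarrow> complex) z. f \<in> schwartz_TR \<Longrightarrow> wderiv [] \<gamma> f z \<le> C * seminorm_TR r f"
    using controlledE[OF controlled_wderiv[of "[]" \<gamma>]] by (metis empty_subsetI list.set(1))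
  show "controlled (\<lambda>f. wderiv [] \<gamma> (torus_integral (f :: (real^'m) \<times> (real^'n) \<Rightarrow> complex)))"
  proof (rule controlledI[of "(2 * pi) ^ CARD('m) * C" _ r])
    fix f :: "(real^'m) \<times> (real^'n) \<Rightarrow> complex" and z :: "(real^'m) \<times> (real^'n)" assume f: "f \<in> schwartz_TR"
    obtain t x where z: "z = (t, x)" by (cases z)
    have g: "(\<lambda>z. of_real (multi_power x \<gamma>) * f z) \<in> schwartz_TR" by (rule cts_op_in[OF cts_op_scale f])
    have "cmod (torus_integral (\<lambda>z. of_real (multi_power x \<gamma>) * f z) (t, x)) \<le> (2 * pi) ^ CARD('m) * (C * seminorm_TR r f)"
      by (rule norm_torus_integral_le[OF g]) (use C(2)[OF f, of "(_, x)"] in \<open>simp add: wderiv_def\<close>)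
    then show "wderiv [] \<gamma> (torus_integral f) z \<le> (2 * pi) ^ CARD('m) * C * seminorm_TR r f"
      by (simp add: torus_integral_scale wderiv_def z mult.assoc)
  qed (use C in simp)
qed (rule cts_op_scale cts_op_dir_deriv | assumption)+

lemma fourier_T_eq_torus_integral:
  fixes f :: "(real^'m) \<times> (real^'n) \<Rightarrow> complex"
  assumes f: "f \<in> schwartz_TR"
  shows "fourier_T f k x = of_real (1 / (2 * pi) ^ CARD('m)) * torus_integral (modulate (- k) f) (t, x)"
proof -
  let ?g = "\<lambda>s. f (s, x) * cis (- (real_vec k \<bullet> s))"
  have m: "real_vec (- k) = - real_vec k" by (simp add: real_vec_def vec_eq_iff)
  have "continuous_on UNIV ?g"
    by (auto intro!: continuous_on_compose2[OF smooth_imp_continuous[OF schwartz_TR_D(2)[OF f]]] continuous_intros simp: cis_conv_exp)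
  then have "set_integrable lborel (cbox 0 (\<chi> i. 2 * pi)) ?g"
    unfolding set_integrable_def by (intro borel_integrable_compact) (auto intro: continuous_on_subset)
  from set_borel_integral_eq_integral(2)[OF this]
  show ?thesis by (simp add: fourier_T_def torus_integral_def torus_cell_def modulate_def m mult.commute)
qed

lemma torus_integral_modulate_dir_deriv:
  fixes f :: "(real^'m) \<times> (real^'n) \<Rightarrow> complex"
  assumes f: "f \<in> schwartz_TR"
  shows "torus_integral (modulate k (dir_deriv (axis_T i) f)) z =
     - (\<i> * of_int (k $ i)) * torus_integral (modulate k f) z"
proof -
  have "has_line_deriv (modulate k f) (axis_T i)
     (\<lambda>z. cis (real_vec k \<bullet> fst z) * dir_deriv (axis_T i) f z + (\<i> * of_real (real_vec k \<bullet> fst (axis_T i :: (real^'m) \<times> (real^'n))) * cis (real_vec k \<bullet> fst z)) * f z)"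
    unfolding modulate_def[abs_def] by (intro has_line_deriv_mult has_line_deriv_cis smooth_has_line_deriv schwartz_TR_D f)
  from has_line_deriv_imp_dir_deriv[OF this]
  have d: "dir_deriv (axis_T i) (modulate k f) = (\<lambda>z. modulate k (dir_deriv (axis_T i) f) z + (\<i> * of_int (k $ i)) * modulate k f z)"
    by (simp add: modulate_def axis_T_def inner_axis real_vec_def fun_eq_iff mult_ac)
  have m: "modulate k f \<in> schwartz_TR" "modulate k (dir_deriv (axis_T i) f) \<in> schwartz_TR"
    using f by (auto intro!: cts_op_in[OF cts_op_modulate] cts_op_in[OF cts_op_dir_deriv])
  have int: "(\<lambda>s. g (s, x)) integrable_on torus_cell" if "g \<in> schwartz_TR" for g :: "(real^'m) \<times> (real^'n) \<Rightarrow> complex" and x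
    unfolding torus_cell_def
    by (auto intro!: integrable_continuous continuous_on_compose2[OF smooth_imp_continuous[OF schwartz_TR_D(2)[OF that]]] continuous_intros)
  have "0 = torus_integral (\<lambda>z. modulate k (dir_deriv (axis_T i) f) z + (\<i> * of_int (k $ i)) * modulate k f z) z"
    using torus_integral_dir_deriv_T[OF m(1), of i z] unfolding d by simp
  also have "\<dots> = torus_integral (modulate k (dir_deriv (axis_T i) f)) z + \<i> * of_int (k $ i) * torus_integral (modulate k f) z"
    unfolding torus_integral_def using int[OF m(1)] int[OF m(2)]
    by (subst integral_add) (auto intro: integrable_on_mult_right)
  finally show ?thesis by (simp add: eq_neg_iff_add_eq_0)
qed

lemma torus_integral_add:
  fixes f g :: "(real^'m) \<times> (real^'n) \<Rightarrow> complex"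
  assumes "f \<in> schwartz_TR" "g \<in> schwartz_TR"
  shows "torus_integral (\<lambda>z. f z + g z) z = torus_integral f z + torus_integral g z"
  unfolding torus_integral_def torus_cell_def
  by (intro integral_add integrable_continuous schwartz_continuous assms continuous_intros)

lemma modulate_add: "modulate k (\<lambda>z. f z + g z) = (\<lambda>z. modulate k f z + modulate k g z)"
  by (simp add: modulate_def fun_eq_iff distrib_left)

lemma modulate_scale: "modulate k (\<lambda>z. c * f z) = (\<lambda>z. c * modulate k f z)"
  by (simp add: modulate_def fun_eq_iff)

text \<open>Two integrations by parts in direction \<open>i\<close> turn the factor \<open>1 + k\<^sub>i\<^sup>2\<close> into the operator that subtracts the second
derivative in that direction from the identity.\<close>

lemma frequency_weight_torus_integral:
  obtains L where "cts_op (L :: ((real^'m) \<times> (real^'n) \<Rightarrow> complex) \<Rightarrow> _)"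
    "\<And>f k z. f \<in> schwartz_TR \<Longrightarrow>
      of_real (weight (real_vec k) ^ A) * torus_integral (modulate k f) z = torus_integral (modulate k (L f)) z"
proof -
  let ?P = "\<lambda>q. \<exists>L. cts_op (L :: ((real^'m) \<times> (real^'n) \<Rightarrow> complex) \<Rightarrow> _) \<and>
      (\<forall>f\<in>schwartz_TR. \<forall>k z. of_real (q k) * torus_integral (modulate k f) z = torus_integral (modulate k (L f)) z)"
  have one: "?P (\<lambda>k. 1)" using cts_op_id by (auto intro!: exI[of _ "\<lambda>f. f"])
  have mult: "?P (\<lambda>k. p k * q k)" if p: "?P p" and q: "?P q" for p q :: "int^'m \<Rightarrow> real"
  proof -
    obtain K :: "((real^'m) \<times> (real^'n) \<Rightarrow> complex) \<Rightarrow> _" where K: "cts_op K"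
      "\<forall>f\<in>schwartz_TR. \<forall>k z. of_real (p k) * torus_integral (modulate k f) z = torus_integral (modulate k (K f)) z"
      using p by blast
    obtain L :: "((real^'m) \<times> (real^'n) \<Rightarrow> complex) \<Rightarrow> _" where L: "cts_op L"
      "\<forall>f\<in>schwartz_TR. \<forall>k z. of_real (q k) * torus_integral (modulate k f) z = torus_integral (modulate k (L f)) z"
      using q by blast
    have "of_real (p k * q k) * torus_integral (modulate k f) z = torus_integral (modulate k (K (L f))) z"
      if "f \<in> schwartz_TR" for f k z
      using K(2) L(2) cts_op_in[OF L(1) that] that by (simp add: mult.assoc del: split_paired_All)
    then show ?thesis using cts_op_comp[OF K(1) L(1)] by blast
  qed
  have sq: "?P (\<lambda>k. 1 + (real_vec k $ i)\<^sup>2)" for i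
  proof (intro exI[of _ "\<lambda>f z. f z + (- 1) * dir_deriv (axis_T i) (dir_deriv (axis_T i) f) z"] conjI ballI allI)
    have d: "cts_op (\<lambda>f. dir_deriv (axis_T i) (dir_deriv (axis_T i :: (real^'m) \<times> (real^'n)) f))"
      by (intro cts_op_comp[OF cts_op_dir_deriv cts_op_dir_deriv]) auto
    have s: "cts_op (\<lambda>f z. (- 1) * dir_deriv (axis_T i :: (real^'m) \<times> (real^'n)) (dir_deriv (axis_T i) f) z)"
      by (rule cts_op_comp[OF cts_op_scale d])
    show "cts_op (\<lambda>f z. f z + (- 1) * dir_deriv (axis_T i :: (real^'m) \<times> (real^'n)) (dir_deriv (axis_T i) f) z)"
      by (rule cts_op_add[OF cts_op_id s])
    fix f :: "(real^'m) \<times> (real^'n) \<Rightarrow> complex" and k z assume f: "f \<in> schwartz_TR"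
    let ?D = "dir_deriv (axis_T i)"
    have d1: "?D f \<in> schwartz_TR" using cts_op_in[OF cts_op_dir_deriv f] by simp
    have "torus_integral (modulate k (\<lambda>z. f z + (- 1) * ?D (?D f) z)) z =
       torus_integral (modulate k f) z + (- 1) * torus_integral (modulate k (?D (?D f))) z"
      unfolding modulate_add modulate_scale
      by (subst torus_integral_add[OF cts_op_in[OF cts_op_modulate f]
            cts_op_in[OF cts_op_scale cts_op_in[OF cts_op_modulate cts_op_in[OF d f]]]])
        (simp only: torus_integral_scale)
    also have "\<dots> = of_real (1 + (real_vec k $ i)\<^sup>2) * torus_integral (modulate k f) z"
      unfolding torus_integral_modulate_dir_deriv[OF d1] torus_integral_modulate_dir_deriv[OF f]
      by (simp add: real_vec_def power2_eq_square algebra_simps)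
    finally show "of_real (1 + (real_vec k $ i)\<^sup>2) * torus_integral (modulate k f) z =
      torus_integral (modulate k (\<lambda>z. f z + (- 1) * ?D (?D f) z)) z" ..
  qed
  have w: "?P (\<lambda>k. \<Prod>i\<in>J. 1 + (real_vec k $ i)\<^sup>2)" if "finite J" for J
    using that
  proof induction
    case empty show ?case using one by simp
  next
    case (insert i J) show ?case using mult[OF sq[of i] insert.IH] insert.hyps by simp
  qed
  have "?P (\<lambda>k. weight (real_vec k) ^ A)"
  proof (induction A)
    case 0 show ?case using one by simp
  next
    case (Suc A) show ?case using mult[OF w[OF finite[of UNIV]] Suc] by (simp add: weight_def)
  qed
  then show ?thesis using that by blast
qed

lemma real_vec_uminus: "real_vec (- k) = - real_vec k"
  by (simp add: real_vec_def vec_eq_iff)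

lemma weight_uminus [simp]: "weight (- x) = weight x"
  by (simp add: weight_def)

text \<open>Arbitrarily fast decay of the Fourier coefficients, jointly in the frequency and in the point, at the cost of
one continuous seminorm.\<close>

lemma controlled_fourier_T:
  "controlled (\<lambda>(f :: (real^'m) \<times> (real^'n) \<Rightarrow> complex) (k, x).
     weight (real_vec k) ^ A * (weight x ^ B * cmod (fourier_T f k x)))"
proof -
  obtain L where L: "cts_op (L :: ((real^'m) \<times> (real^'n) \<Rightarrow> complex) \<Rightarrow> _)"
    "\<And>f k z. f \<in> schwartz_TR \<Longrightarrow>
      of_real (weight (real_vec k) ^ A) * torus_integral (modulate k f) z = torus_integral (modulate k (L f)) z"
    using frequency_weight_torus_integral[of A] by metis
  have "controlled (\<lambda>(f :: (real^'m) \<times> (real^'n) \<Rightarrow> complex) z. weight (snd z) ^ B * cmod (L f z))"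
    using controlled_comp[OF controlled_weight L(1)] .
  then obtain C r where C: "C \<ge> 0" "\<And>(f :: (real^'m) \<times> (real^'n) \<Rightarrow> complex) z. f \<in> schwartz_TR \<Longrightarrow>
       weight (snd z) ^ B * cmod (L f z) \<le> C * seminorm_TR r f"
    by (rule controlledE) blast
  show ?thesis
  proof (rule controlledI[of C _ r], safe)
    fix f :: "(real^'m) \<times> (real^'n) \<Rightarrow> complex" and k :: "int^'m" and x :: "real^'n"
    assume f: "f \<in> schwartz_TR"
    let ?g = "\<lambda>z. of_real (weight x ^ B) * modulate (- k) (L f) z"
    have g: "?g \<in> schwartz_TR"
      using cts_op_in[OF cts_op_comp[OF cts_op_scale cts_op_comp[OF cts_op_modulate L(1)]] f] .
    have w1: "weight (real_vec k) ^ A * (weight x ^ B * c) = cmod (of_real (weight x ^ B) * (of_real (weight (real_vec (- k)) ^ A) * c'))"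
      if "c = cmod c'" for c c'
      using weight_pos[of "real_vec k"] weight_pos[of x]
      by (simp add: that norm_mult norm_power real_vec_uminus less_imp_le del: weight_pos)
    have "weight (real_vec k) ^ A * (weight x ^ B * cmod (torus_integral (modulate (- k) f) (0, x)))
        = cmod (torus_integral ?g (0, x))"
      by (subst w1[OF refl]) (simp only: L(2)[OF f] torus_integral_scale)
    also have "\<dots> \<le> (2 * pi) ^ CARD('m) * (C * seminorm_TR r f)"
    proof (rule norm_torus_integral_le[OF g])
      show "cmod (?g (s, x)) \<le> C * seminorm_TR r f" for s
        using C(2)[OF f, of "(s, x)"] weight_pos[of x]
        by (simp add: modulate_def norm_mult norm_power less_imp_le del: weight_pos)
    qed
    finally have "weight (real_vec k) ^ A * (weight x ^ B * cmod (torus_integral (modulate (- k) f) (0, x))) / (2 * pi) ^ CARD('m)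
        \<le> C * seminorm_TR r f"
      by (simp add: pos_divide_le_eq mult.commute)
    then show "weight (real_vec k) ^ A * (weight x ^ B * cmod (fourier_T f k x)) \<le> C * seminorm_TR r f"
      unfolding fourier_T_eq_torus_integral[OF f, of _ _ 0]
      by (simp add: norm_mult norm_divide norm_power)
  qed (rule C)
qed


section \<open>Functions that are constant in the periodic variable\<close>

lemma dir_deriv_lift_R: "dir_deriv (0, b) (\<lambda>z. f (snd z)) = (\<lambda>z. dir_deriv b f (snd z))"
  by (simp add: dir_deriv_def fun_eq_iff)

lemma dir_deriv_lift_T: "dir_deriv (a, 0) (\<lambda>z. f (snd z)) = (\<lambda>z. 0)"
  by (simp add: dir_deriv_def fun_eq_iff)

lemma dir_deriv_zero: "dir_deriv b (\<lambda>z. 0) = (\<lambda>z. 0)"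
  by (simp add: dir_deriv_def fun_eq_iff)

lemma continuous_lift_iff:
  "continuous_on UNIV (\<lambda>z::'a::euclidean_space \<times> 'b::euclidean_space. f (snd z) :: complex) \<longleftrightarrow> continuous_on UNIV f"
proof
  assume "continuous_on UNIV (\<lambda>z::'a \<times> 'b. f (snd z))"
  moreover have "continuous_on UNIV (\<lambda>x::'b. (0 :: 'a, x))" by (intro continuous_intros)
  ultimately show "continuous_on UNIV f"
    using continuous_on_compose2[of UNIV "\<lambda>z::'a \<times> 'b. f (snd z)" UNIV "\<lambda>x. (0, x)"] by simp
qed (auto intro!: continuous_on_compose2[of UNIV f] continuous_intros)

lemma differentiable_lift_iff:
  "(\<lambda>z::'a::euclidean_space \<times> 'b::euclidean_space. f (snd z) :: complex) differentiable_on UNIV \<longleftrightarrow> f differentiable_on UNIV"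
proof
  assume a: "(\<lambda>z::'a \<times> 'b. f (snd z)) differentiable_on UNIV"
  show "f differentiable_on UNIV"
    unfolding differentiable_on_def
  proof safe
    fix x :: 'b
    have "(\<lambda>z::'a \<times> 'b. f (snd z)) differentiable at (0, x)"
      using a by (simp add: differentiable_on_def)
    moreover have "(\<lambda>x. (0, x) :: 'a \<times> 'b) differentiable at x"
      unfolding differentiable_def by (auto intro!: exI derivative_eq_intros)
    ultimately have "(\<lambda>z::'a \<times> 'b. f (snd z)) \<circ> (\<lambda>x. (0, x)) differentiable at x"
      by (intro differentiable_chain_at)
    then show "f differentiable at x" by (simp add: o_def)
  qed
next
  assume a: "f differentiable_on UNIV"
  show "(\<lambda>z::'a \<times> 'b. f (snd z)) differentiable_on UNIV"
    unfolding differentiable_on_def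
  proof
    fix z :: "'a \<times> 'b"
    have "f differentiable at (snd z)" using a by (simp add: differentiable_on_def)
    moreover have "snd differentiable at z"
      unfolding differentiable_def by (auto intro!: exI derivative_eq_intros)
    ultimately have "f \<circ> snd differentiable at z"
      by (intro differentiable_chain_at)
    then show "(\<lambda>z. f (snd z)) differentiable at z" by (simp add: o_def)
  qed
qed

lemma cont_diff_lift_iff:
  "cont_diff r (\<lambda>z::'a::euclidean_space \<times> 'b::euclidean_space. f (snd z)) \<longleftrightarrow> cont_diff r f"
proof (induction r arbitrary: f)
  case 0 show ?case by (simp add: continuous_lift_iff)
next
  case (Suc r)
  have "cont_diff r (\<lambda>z::'a \<times> 'b. 0)" using smooth_const[where c=0 and ?'a="'a \<times> 'b"] by (simp add: smooth_def)
  then show ?case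
    by (simp add: differentiable_lift_iff Basis_prod_def ball_Un dir_deriv_lift_R dir_deriv_lift_T Suc)
qed

lemma smooth_lift_iff:
  "smooth (\<lambda>z::'a::euclidean_space \<times> 'b::euclidean_space. f (snd z)) \<longleftrightarrow> smooth f"
  by (simp add: smooth_def cont_diff_lift_iff)

lemma multi_list_map: "multi_list (\<lambda>i. g (e i)) \<alpha> = map g (multi_list e \<alpha>)"
  by (simp add: multi_list_def map_concat o_def)

lemma multi_list_eq_Nil_iff: "multi_list e \<alpha> = [] \<longleftrightarrow> \<alpha> = (\<lambda>_. 0)"
  by (auto simp: multi_list_def fun_eq_iff)

lemma foldr_dir_deriv_lift_T:
  assumes "set bs \<subseteq> range axis_T"
  shows "foldr dir_deriv bs (\<lambda>z::(real^'m) \<times> (real^'n). f (snd z)) = (if bs = [] then (\<lambda>z. f (snd z)) else (\<lambda>z. 0))"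
  using assms
proof (induction bs)
  case (Cons b bs)
  then obtain i where b: "b = axis_T i" by auto
  have "dir_deriv b (\<lambda>z::(real^'m) \<times> (real^'n). 0) = (\<lambda>z. 0)"
    by (rule dir_deriv_zero)
  moreover have "dir_deriv b (\<lambda>z::(real^'m) \<times> (real^'n). f (snd z)) = (\<lambda>z. 0)"
    unfolding b axis_T_def by (rule dir_deriv_lift_T)
  ultimately show ?case using Cons by auto
qed auto

text \<open>A derivative along the torus annihilates the lift, so only the trivial multi-index contributes.\<close>

lemma weighted_TR_lift:
  fixes f :: "real^'n \<Rightarrow> complex" and z :: "(real^'m) \<times> (real^'n)"
  shows "weighted_TR \<alpha> \<beta> \<gamma> (\<lambda>z::(real^'m) \<times> (real^'n). f (snd z)) z = (if \<alpha> = (\<lambda>_. 0) then weighted_R \<beta> \<gamma> f (snd z) else 0)"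
proof -
  have R: "foldr dir_deriv (map (Pair 0) bs) (\<lambda>z::(real^'m) \<times> (real^'n). f (snd z)) = (\<lambda>z. foldr dir_deriv bs f (snd z))" for bs
    by (induction bs) (auto simp: dir_deriv_lift_R)
  have "axis_R = (\<lambda>j. (0 :: real^'m, axis j (1::real) :: real^'n))" by (simp add: axis_R_def fun_eq_iff)
  then have "multi_list axis_R \<beta> = map (Pair (0 :: real^'m)) (multi_list (\<lambda>j. axis j 1 :: real^'n) \<beta>)"
    using multi_list_map[of "Pair (0 :: real^'m)" "\<lambda>j. axis j 1 :: real^'n" \<beta>] by simp
  then show ?thesis
    unfolding weighted_TR_eq_wderiv wderiv_def weighted_R_def multi_deriv_eq_foldr
    using foldr_dir_deriv_lift_T[OF set_multi_list, of \<alpha> "\<lambda>x. foldr dir_deriv (multi_list (\<lambda>j. axis j 1) \<beta>) f x"]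
    by (simp add: R multi_list_eq_Nil_iff)
qed

text \<open>Schwartz functions on the Euclidean space are the Schwartz functions on the product that are constant in the
periodic variable, with the same seminorms (\<open>seminorm_TR_lift\<close>); results on the product thus specialise to the
Euclidean space.\<close>

lemma lift_in_schwartz_TR_iff:
  fixes f :: "real^'n \<Rightarrow> complex"
  shows "(\<lambda>z::(real^'m) \<times> (real^'n). f (snd z)) \<in> schwartz_TR \<longleftrightarrow> f \<in> schwartz_R"
proof -
  have "bdd_above (range (weighted_TR \<alpha> \<beta> \<gamma> (\<lambda>z::(real^'m) \<times> (real^'n). f (snd z)))) \<longleftrightarrow>
     \<alpha> \<noteq> (\<lambda>_. 0) \<or> bdd_above (range (weighted_R \<beta> \<gamma> f))" for \<alpha> :: "'m \<Rightarrow> nat" and \<beta> \<gamma>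
    by (auto simp: weighted_TR_lift bdd_above_def)
  then show ?thesis
    unfolding schwartz_TR_def schwartz_R_def by (auto simp: smooth_lift_iff periodic_T_def)
qed

lemma seminorm_TR_lift:
  fixes f :: "real^'n \<Rightarrow> complex"
  shows "seminorm_TR r (\<lambda>z::(real^'m) \<times> (real^'n). f (snd z)) = seminorm_R r f"
proof -
  let ?F = "\<lambda>z::(real^'m) \<times> (real^'n). f (snd z)"
  let ?T = "{(\<alpha> :: 'm \<Rightarrow> nat, \<beta> :: 'n \<Rightarrow> nat, \<gamma> :: 'n \<Rightarrow> nat). multi_order \<alpha> + multi_order \<beta> + multi_order \<gamma> \<le> r}"
  let ?R = "{(\<beta> :: 'n \<Rightarrow> nat, \<gamma> :: 'n \<Rightarrow> nat). multi_order \<beta> + multi_order \<gamma> \<le> r}"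
  have S: "(SUP z. weighted_TR \<alpha> \<beta> \<gamma> ?F z) = (if \<alpha> = (\<lambda>_. 0) then (SUP x. weighted_R \<beta> \<gamma> f x) else 0)" for \<alpha> \<beta> \<gamma>
  proof -
    have "range (\<lambda>z::(real^'m) \<times> (real^'n). weighted_R \<beta> \<gamma> f (snd z)) = range (weighted_R \<beta> \<gamma> f)"
      by (auto simp: image_iff)
    then show ?thesis by (auto simp: weighted_TR_lift[abs_def])
  qed
  have "seminorm_TR r ?F = (\<Sum>(\<alpha>, \<beta>, \<gamma>)\<in>?T. if \<alpha> = (\<lambda>_. 0) then (SUP x. weighted_R \<beta> \<gamma> f x) else 0)"
    unfolding seminorm_TR_def S ..
  also have "\<dots> = (\<Sum>(\<alpha>, \<beta>, \<gamma>)\<in>Pair (\<lambda>_::'m. 0::nat) ` ?R. (SUP x. weighted_R \<beta> \<gamma> f x))"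
  proof (rule sum.mono_neutral_cong_right)
    show "finite ?T" by (rule finite_multi_order_TR)
  qed (auto simp: multi_order_def image_iff)
  also have "\<dots> = seminorm_R r f"
    unfolding seminorm_R_def by (subst sum.reindex) (auto simp: inj_on_def o_def split_beta)
  finally show ?thesis .
qed

lemma schwartz_R_add:
  assumes "f \<in> schwartz_R" "g \<in> schwartz_R" shows "(\<lambda>x. f x + g x) \<in> schwartz_R"
  using schwartz_TR_add[of "\<lambda>z::(real^unit) \<times> (real^'a). f (snd z)" "\<lambda>z. g (snd z)"] assms
  by (simp add: lift_in_schwartz_TR_iff lift_in_schwartz_TR_iff[of "\<lambda>x. f x + g x"])

lemma schwartz_R_scale:
  assumes "f \<in> schwartz_R" shows "(\<lambda>x. c * f x) \<in> schwartz_R"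
  using cts_op_in[OF cts_op_scale, of "\<lambda>z::(real^unit) \<times> (real^'a). f (snd z)" c] assms
  by (simp add: lift_in_schwartz_TR_iff lift_in_schwartz_TR_iff[of "\<lambda>x. c * f x"])

lemma fourier_T_in_schwartz_R:
  fixes f :: "(real^'m) \<times> (real^'n) \<Rightarrow> complex"
  assumes "f \<in> schwartz_TR" shows "fourier_T f k \<in> schwartz_R"
proof -
  have "(\<lambda>z. of_real (1 / (2 * pi) ^ CARD('m)) * torus_integral (modulate (- k) f) z) \<in> schwartz_TR"
    by (rule cts_op_in[OF cts_op_comp[OF cts_op_scale cts_op_comp[OF cts_op_torus_integral cts_op_modulate]] assms])
  moreover have "fourier_T f k (snd z) = of_real (1 / (2 * pi) ^ CARD('m)) * torus_integral (modulate (- k) f) z" for z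
    using fourier_T_eq_torus_integral[OF assms, of k "snd z" "fst z"] by simp
  ultimately have "(\<lambda>z::(real^'m) \<times> (real^'n). fourier_T f k (snd z)) \<in> schwartz_TR" by simp
  then show ?thesis by (simp add: lift_in_schwartz_TR_iff)
qed

lemma fourier_T_add:
  fixes f g :: "(real^'m) \<times> (real^'n) \<Rightarrow> complex"
  assumes "f \<in> schwartz_TR" "g \<in> schwartz_TR"
  shows "fourier_T (\<lambda>z. f z + g z) k = (\<lambda>x. fourier_T f k x + fourier_T g k x)"
proof
  fix x
  show "fourier_T (\<lambda>z. f z + g z) k x = fourier_T f k x + fourier_T g k x"
    unfolding fourier_T_eq_torus_integral[OF schwartz_TR_add[OF assms], of _ _ 0]
      fourier_T_eq_torus_integral[OF assms(1), of _ _ 0] fourier_T_eq_torus_integral[OF assms(2), of _ _ 0]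
    unfolding modulate_add
    by (subst torus_integral_add) (auto intro!: cts_op_in[OF cts_op_modulate] assms simp: add_divide_distrib)
qed

lemma fourier_T_scale: "fourier_T (\<lambda>z. c * f z) k = (\<lambda>x. c * fourier_T f k x)"
proof
  show "fourier_T (\<lambda>z. c * f z) k x = c * fourier_T f k x" for x
    unfolding fourier_T_def set_lebesgue_integral_def
    by (simp add: mult.assoc mult.left_commute[of _ c] flip: mult_scaleR_right)
qed

text \<open>Orthogonality of characters.  For \<open>l \<noteq> k\<close> it follows from \<open>torus_integral_modulate_dir_deriv\<close> in a direction
where the two frequencies differ, since the lift has zero derivative there.\<close>

lemma fourier_T_modulate_lift:
  fixes f :: "real^'n \<Rightarrow> complex" and k :: "int^'m"
  assumes f: "f \<in> schwartz_R"
  shows "fourier_T (modulate k (\<lambda>z::(real^'m) \<times> (real^'n). f (snd z))) l = (if l = k then f else (\<lambda>x. 0))"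
proof
  fix x
  let ?F = "\<lambda>z::(real^'m) \<times> (real^'n). f (snd z)"
  have F: "?F \<in> schwartz_TR" using f by (simp add: lift_in_schwartz_TR_iff)
  have "modulate (- l) (modulate k ?F) = modulate (k - l) ?F"
    by (auto simp: modulate_def fun_eq_iff real_vec_def inner_vec_def cis_mult sum.distrib[symmetric] algebra_simps sum_subtractf simp flip: mult.assoc)
  then have eq: "fourier_T (modulate k ?F) l x = of_real (1 / (2 * pi) ^ CARD('m)) * torus_integral (modulate (k - l) ?F) (0, x)"
    using fourier_T_eq_torus_integral[OF cts_op_in[OF cts_op_modulate F], of k l x 0] by simp
  show "fourier_T (modulate k ?F) l x = (if l = k then f else (\<lambda>x. 0)) x"
  proof (cases "l = k")
    case True
    have "measure lborel (cbox 0 (\<chi> i. 2 * pi) :: (real^'m) set) = (2 * pi) ^ CARD('m)"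
      by (subst content_cbox_cart) (auto simp: interval_ne_empty_cart)
    then have "torus_integral ?F (0, x) = of_real ((2 * pi) ^ CARD('m)) * f x"
      unfolding torus_integral_def torus_cell_def by (simp add: scaleR_conv_of_real)
    moreover have "modulate 0 ?F = ?F" by (simp add: modulate_def real_vec_def inner_vec_def fun_eq_iff)
    ultimately show ?thesis unfolding eq by (simp add: True)
  next
    case False
    then obtain i where "l $ i \<noteq> k $ i" by (auto simp: vec_eq_iff)
    then have i: "(k - l) $ i \<noteq> 0" by simp
    have "dir_deriv (axis_T i) ?F = (\<lambda>z. 0)" unfolding axis_T_def by (rule dir_deriv_lift_T)
    then have "torus_integral (modulate (k - l) (dir_deriv (axis_T i) ?F)) (0, x) = 0"
      by (simp add: modulate_def torus_integral_def)
    then have "torus_integral (modulate (k - l) ?F) (0, x) = 0"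
      unfolding torus_integral_modulate_dir_deriv[OF F] using i by (simp del: vector_minus_component)
    then show ?thesis unfolding eq using False by simp
  qed
qed


section \<open>Tempered functionals from seminorm bounds\<close>

text \<open>The topology is given by a subbase of seminorm balls around all points, so a linear functional bounded by one
seminorm is continuous: around each point, one ball of that seminorm suffices.\<close>

lemma topological_dualI:
  assumes ext: "v \<in> extensional S"
    and add: "\<And>f g. f \<in> S \<Longrightarrow> g \<in> S \<Longrightarrow> v (\<lambda>z. f z + g z) = v f + v g"
    and scale: "\<And>c f. f \<in> S \<Longrightarrow> v (\<lambda>z. c * f z) = c * v f"
    and diff: "\<And>f g. f \<in> S \<Longrightarrow> g \<in> S \<Longrightarrow> (\<lambda>z. f z - g z) \<in> S"
    and bound: "\<And>f. f \<in> S \<Longrightarrow> cmod (v f) \<le> C * p r f" and C: "C \<ge> 0"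
    and p0: "p r (\<lambda>z. 0) = 0"
  shows "v \<in> topological_dual S p"
  unfolding topological_dual_def
proof (intro CollectI conjI ballI allI ext add scale)
  let ?G = "\<lambda>f r \<epsilon>. {g \<in> S. p r (\<lambda>z. g z - f z) < \<epsilon>}"
  have basic: "openin (seminorm_topology S p) (?G f r \<epsilon>)" if "f \<in> S" "\<epsilon> > 0" for f \<epsilon>
    unfolding seminorm_topology_def using that by (intro topology_generated_by_Basis) blast
  have mem: "f \<in> ?G f r \<epsilon>" if "f \<in> S" "\<epsilon> > 0" for f \<epsilon>
    using that p0 by simp
  have top: "topspace (seminorm_topology S p) = S"
    unfolding seminorm_topology_def topology_generated_by_topspace
  proof
    show "S \<subseteq> \<Union> {?G f r \<epsilon> |f r \<epsilon>. f \<in> S \<and> 0 < \<epsilon>}"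
    proof
      fix f assume f: "f \<in> S"
      have "?G f r 1 \<in> {?G f r \<epsilon> |f r \<epsilon>. f \<in> S \<and> 0 < \<epsilon>}" using f zero_less_one by blast
      then show "f \<in> \<Union> {?G f r \<epsilon> |f r \<epsilon>. f \<in> S \<and> 0 < \<epsilon>}" using mem[OF f zero_less_one] by (rule UnionI)
    qed
  qed blast
  show "continuous_map (seminorm_topology S p) euclidean v"
    unfolding continuous_map_def top
  proof (intro conjI allI impI)
    fix U :: "complex set" assume "openin euclidean U"
    then have U: "open U" by simp
    show "openin (seminorm_topology S p) {f \<in> S. v f \<in> U}"
    proof (subst openin_subopen, intro ballI)
      fix f assume f: "f \<in> {f \<in> S. v f \<in> U}"
      then obtain e where e: "e > 0" "ball (v f) e \<subseteq> U"
        using U open_contains_ball by blast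
      \<comment> \<open>\<open>C + 1\<close> instead of \<open>C\<close> avoids a division by zero\<close>
      let ?\<epsilon> = "e / (C + 1)"
      have \<epsilon>: "?\<epsilon> > 0" using e C by simp
      have "v g \<in> U" if g: "g \<in> ?G f r ?\<epsilon>" for g
      proof -
        have "v g = v (\<lambda>z. (g z - f z) + f z)" by simp
        also have "\<dots> = v (\<lambda>z. g z - f z) + v f" using f g diff by (intro add) auto
        finally have "dist (v f) (v g) = cmod (v (\<lambda>z. g z - f z))" by (simp add: dist_norm norm_minus_commute)
        also have "\<dots> \<le> C * p r (\<lambda>z. g z - f z)" using f g diff by (intro bound) auto
        also have "\<dots> \<le> C * ?\<epsilon>" using g C by (intro mult_left_mono) auto
        also have "\<dots> < (C + 1) * ?\<epsilon>" using \<epsilon> by (intro mult_strict_right_mono) auto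
        also have "\<dots> = e" using C by simp
        finally show ?thesis using e by auto
      qed
      then show "\<exists>T. openin (seminorm_topology S p) T \<and> f \<in> T \<and> T \<subseteq> {f \<in> S. v f \<in> U}"
        using basic[of f ?\<epsilon>] mem[of f ?\<epsilon>] f \<epsilon> by (intro exI[of _ "?G f r ?\<epsilon>"]) auto
    qed
  qed auto
qed

lemma schwartz_R_zero: "(\<lambda>x::real^'n. 0) \<in> schwartz_R"
  using schwartz_TR_zero[where ?'m=1 and ?'n='n] lift_in_schwartz_TR_iff[where ?'m=1 and f="\<lambda>x::real^'n. 0"] by simp

lemma seminorm_TR_zero: "seminorm_TR r (\<lambda>z::(real^'m) \<times> (real^'n). 0) = 0"
proof -
  have "foldr dir_deriv bs (\<lambda>z::(real^'m) \<times> (real^'n). 0) = (\<lambda>z. 0)" for bs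
    by (induction bs) (auto simp: dir_deriv_zero)
  then have "weighted_TR \<alpha> \<beta> \<gamma> (\<lambda>z::(real^'m) \<times> (real^'n). 0) = (\<lambda>z. 0)" for \<alpha> \<beta> \<gamma>
    by (simp add: weighted_TR_eq_wderiv wderiv_def fun_eq_iff del: foldr_append)
  then show ?thesis by (simp add: seminorm_TR_def)
qed

lemma schwartz_TR_diff:
  fixes f :: "(real^'m) \<times> (real^'n) \<Rightarrow> complex"
  assumes "f \<in> schwartz_TR" "g \<in> schwartz_TR" shows "(\<lambda>z. f z - g z) \<in> schwartz_TR"
  using schwartz_TR_add[OF assms(1) cts_op_in[OF cts_op_scale assms(2)], of "-1"] by simp

lemma schwartz_R_diff:
  assumes "f \<in> schwartz_R" "g \<in> schwartz_R" shows "(\<lambda>x. f x - g x) \<in> schwartz_R"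
  using schwartz_R_add[OF assms(1) schwartz_R_scale[OF assms(2)], of "-1"] by simp

lemma tempered_TR_I:
  fixes v :: "((real^'m) \<times> (real^'n) \<Rightarrow> complex) \<Rightarrow> complex"
  assumes "v \<in> extensional schwartz_TR"
    and "\<And>f g. f \<in> schwartz_TR \<Longrightarrow> g \<in> schwartz_TR \<Longrightarrow> v (\<lambda>z. f z + g z) = v f + v g"
    and "\<And>c f. f \<in> schwartz_TR \<Longrightarrow> v (\<lambda>z. c * f z) = c * v f"
    and "controlled (\<lambda>f (i::unit). cmod (v f))"
  shows "v \<in> tempered_TR"
proof -
  obtain C r where C: "C \<ge> 0" "\<And>f (i::unit). f \<in> schwartz_TR \<Longrightarrow> cmod (v f) \<le> C * seminorm_TR r f"
    using assms(4) by (rule controlledE) blast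
  show ?thesis
    unfolding tempered_TR_def
    by (rule topological_dualI[where p=seminorm_TR and r=r and C=C])
      (use assms(1-3) C seminorm_TR_zero in \<open>auto intro: schwartz_TR_diff\<close>)
qed


section \<open>Densities of polynomial growth and the Fourier series\<close>

lemma weight_ge_1_plus_norm: "1 + (norm x)\<^sup>2 \<le> weight x" for x :: "real^'n"
proof -
  have "1 + (\<Sum>j\<in>J. a j) \<le> (\<Prod>j\<in>J. 1 + a j)" if "finite J" "\<And>j. 0 \<le> a j" for J and a :: "'n \<Rightarrow> real"
    using that
  proof (induction J)
    case (insert j J)
    have "1 \<le> (\<Prod>j\<in>J. 1 + a j)" using insert by (intro prod_ge_1) auto
    from mult_left_mono[OF this insert.prems[of j]] show ?case using insert by (simp add: algebra_simps)
  qed simp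
  from this[of UNIV "\<lambda>j. (x $ j)\<^sup>2"] show ?thesis
    unfolding power2_norm_eq_inner weight_def by (simp add: inner_vec_def power2_eq_square)
qed

text \<open>Rounding the exponent up turns the growth hypothesis into one about natural powers of the weight.\<close>

lemma japanese_bracket_powr_le_weight:
  fixes x :: "real^'n"
  assumes "N \<ge> 0"
  shows "(1 + (norm x)\<^sup>2) powr (N / 2) \<le> weight x ^ nat \<lceil>N\<rceil>"
proof -
  have "(1 + (norm x)\<^sup>2) powr (N / 2) \<le> weight x powr (N / 2)"
    using weight_ge_1_plus_norm[of x] assms by (intro powr_mono2) auto
  also have "\<dots> \<le> weight x powr real (nat \<lceil>N\<rceil>)"
    using weight_ge_1[of x] assms by (intro powr_mono) linarith+
  also have "\<dots> = weight x ^ nat \<lceil>N\<rceil>" by (rule powr_realpow) simp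
  finally show ?thesis .
qed

lemma sum_inverse_1_plus_square_int_bounded:
  obtains S :: real where "\<And>J :: int set. finite J \<Longrightarrow> (\<Sum>n\<in>J. 1 / (1 + (real_of_int n)\<^sup>2)) \<le> S"
proof -
  let ?a = "\<lambda>n::nat. 1 / (1 + (real n)\<^sup>2)"
  have sm: "summable ?a"
  proof (rule summable_comparison_test'[of "\<lambda>n. inverse (real n ^ 2)" 1])
    show "summable (\<lambda>n. inverse (real n ^ 2))" by (rule inverse_power_summable) simp
    show "norm (?a n) \<le> inverse (real n ^ 2)" if "n \<ge> 1" for n
    proof -
      have "?a n \<le> 1 / (real n)\<^sup>2" using that by (intro divide_left_mono mult_pos_pos add_pos_nonneg) auto
      moreover have "norm (?a n) = ?a n" unfolding real_norm_def by (rule abs_of_nonneg) simp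
      ultimately show ?thesis by (simp add: inverse_eq_divide)
    qed
  qed
  have nat: "(\<Sum>n\<in>J. 1 / (1 + (real_of_int n)\<^sup>2)) \<le> suminf ?a" if J: "finite J" "inj_on (\<lambda>n. nat \<bar>n\<bar>) J" for J :: "int set"
  proof -
    have "(\<Sum>n\<in>J. 1 / (1 + (real_of_int n)\<^sup>2)) = sum ?a ((\<lambda>n. nat \<bar>n\<bar>) ` J)"
      by (subst sum.reindex[OF J(2)]) (simp add: o_def)
    also have "\<dots> \<le> suminf ?a" using J by (intro sum_le_suminf sm) auto
    finally show ?thesis .
  qed
  have "(\<Sum>n\<in>J. 1 / (1 + (real_of_int n)\<^sup>2)) \<le> suminf ?a + suminf ?a" if J: "finite J" for J :: "int set"
  proof -
    have "J = {n\<in>J. n \<ge> 0} \<union> {n\<in>J. n < 0}" by auto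
    then have "(\<Sum>n\<in>J. 1 / (1 + (real_of_int n)\<^sup>2)) =
        (\<Sum>n\<in>{n\<in>J. n \<ge> 0}. 1 / (1 + (real_of_int n)\<^sup>2)) + (\<Sum>n\<in>{n\<in>J. n < 0}. 1 / (1 + (real_of_int n)\<^sup>2))"
      using J by (subst sum.union_disjoint[symmetric]) auto
    also have "\<dots> \<le> suminf ?a + suminf ?a"
      using J by (intro add_mono nat) (auto simp: inj_on_def)
    finally show ?thesis .
  qed
  then show ?thesis using that by blast
qed

text \<open>A finite set of lattice points lies in a cube, over which the sum factors into one-dimensional sums.\<close>

lemma summable_inverse_frequency_weight: "(\<lambda>k::int^'m. 1 / weight (real_vec k)) summable_on UNIV"
proof -
  obtain S :: real where S: "\<And>J :: int set. finite J \<Longrightarrow> (\<Sum>n\<in>J. 1 / (1 + (real_of_int n)\<^sup>2)) \<le> S"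
    using sum_inverse_1_plus_square_int_bounded by metis
  let ?a = "\<lambda>n::int. 1 / (1 + (real_of_int n)\<^sup>2)"
  have "(\<Sum>k\<in>F. 1 / weight (real_vec k)) \<le> S ^ CARD('m)" if F: "finite F" for F :: "(int^'m) set"
  proof -
    \<comment> \<open>all coordinates that occur in \<open>F\<close>\<close>
  define J where "J = (\<Union>i. (\<lambda>k. k $ i) ` F)"
    have J: "finite J" using F by (auto simp: J_def)
    have "inj_on (\<lambda>k. (\<lambda>i. k $ i)) F" by (auto simp: inj_on_def vec_eq_iff fun_eq_iff)
    then have "(\<Sum>k\<in>F. 1 / weight (real_vec k)) = (\<Sum>g\<in>(\<lambda>k. (\<lambda>i. k $ i)) ` F. \<Prod>i\<in>UNIV. ?a (g i))"
      by (subst sum.reindex) (auto simp: weight_def real_vec_def prod_dividef)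
    also have "\<dots> \<le> (\<Sum>g\<in>PiE (UNIV :: 'm set) (\<lambda>_. J). \<Prod>i\<in>UNIV. ?a (g i))"
      using J F by (intro sum_mono2 finite_PiE prod_nonneg) (auto simp: J_def)
    also have "\<dots> = (\<Prod>i\<in>(UNIV::'m set). \<Sum>n\<in>J. ?a n)"
      using J by (subst prod_sum_PiE) auto
    also have "\<dots> = (\<Sum>n\<in>J. ?a n) ^ CARD('m)" by simp
    also have "\<dots> \<le> S ^ CARD('m)" by (intro power_mono S J sum_nonneg) auto
    finally show ?thesis .
  qed
  then show ?thesis
    by (intro nonneg_bdd_above_summable_on) (auto simp: bdd_above_def less_imp_le)
qed

lemma nonneg_of_mult_pos: "0 \<le> c * x \<Longrightarrow> 0 < x \<Longrightarrow> 0 \<le> c" for c x :: real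
  by (auto simp: zero_le_mult_iff)

text \<open>One power of the weight more than the growth of \<open>w\<close> leaves the integrable majorant \<open>1 / weight\<close>.\<close>

lemma integral_polynomial_growth:
  fixes w h :: "real^'n \<Rightarrow> complex"
  assumes w: "w \<in> borel_measurable lebesgue" "\<And>x. cmod (w x) \<le> C * weight x ^ A"
    and h: "continuous_on UNIV h" "\<And>x. weight x ^ Suc A * cmod (h x) \<le> K"
  shows "integrable lebesgue (\<lambda>x. w x * h x)"
    and "cmod (LINT x|lebesgue. w x * h x) \<le> C * K * (LINT x|lborel. 1 / weight (x::real^'n))"
proof -
  have C: "0 \<le> C" using order_trans[OF norm_ge_zero w(2)[of 0]] by (rule nonneg_of_mult_pos) simp
  have hm: "h \<in> borel_measurable lebesgue"
    using borel_measurable_continuous_onI[OF h(1)] by (simp add: measurable_completion)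
  have b: "cmod (w x * h x) \<le> C * K * (1 / weight x)" for x
  proof -
    have "cmod (w x * h x) * weight x \<le> C * weight x ^ A * cmod (h x) * weight x"
      using mult_right_mono[OF w(2)[of x], of "cmod (h x) * weight x"] by (simp add: norm_mult mult.assoc less_imp_le)
    also have "\<dots> = C * (weight x ^ Suc A * cmod (h x))" by simp
    also have "\<dots> \<le> C * K" using h(2) C by (intro mult_left_mono)
    finally show ?thesis by (simp add: pos_le_divide_eq)
  qed
  have ib: "integrable lborel (\<lambda>x::real^'n. C * K * (1 / weight x))"
    by (intro integrable_mult_right integrable_inverse_weight)
  then have il: "integrable lebesgue (\<lambda>x::real^'n. C * K * (1 / weight x))"
    by (subst integrable_completion) auto
  show int: "integrable lebesgue (\<lambda>x. w x * h x)"
  proof (rule Bochner_Integration.integrable_bound[OF il])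
    show "AE x in lebesgue. norm (w x * h x) \<le> norm (C * K * (1 / weight x))"
      unfolding real_norm_def by (intro AE_I2 order_trans[OF b abs_ge_self])
  qed (use w hm in auto)
  have "cmod (LINT x|lebesgue. w x * h x) \<le> (LINT x|lebesgue. cmod (w x * h x))" by (rule integral_norm_bound)
  also have "\<dots> \<le> (LINT x|lebesgue. C * K * (1 / weight (x::real^'n)))"
    by (intro integral_mono integrable_norm int il b)
  also have "\<dots> = (LINT x|lborel. C * K * (1 / weight (x::real^'n)))"
    by (rule integral_completion) (use ib in auto)
  also have "\<dots> = C * K * (LINT x|lborel. 1 / weight (x::real^'n))" by (rule integral_mult_right_zero)
  finally show "cmod (LINT x|lebesgue. w x * h x) \<le> C * K * (LINT x|lborel. 1 / weight (x::real^'n))" .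
qed

lemma schwartz_R_continuous: "f \<in> schwartz_R \<Longrightarrow> continuous_on UNIV f"
  by (auto simp: schwartz_R_def intro: smooth_imp_continuous)

text \<open>Obtained from the product with a one-dimensional torus, along which the lift is constant.\<close>

lemma schwartz_R_weight_bound:
  obtains C r where "C \<ge> 0" "\<And>(f::real^'n \<Rightarrow> complex) x. f \<in> schwartz_R \<Longrightarrow> weight x ^ A * cmod (f x) \<le> C * seminorm_R r f"
proof -
  obtain C r where C: "C \<ge> 0" "\<And>(f :: (real^1) \<times> (real^'n) \<Rightarrow> complex) z. f \<in> schwartz_TR \<Longrightarrow> weight (snd z) ^ A * cmod (f z) \<le> C * seminorm_TR r f"
    using controlledE[OF controlled_weight] by metis
  have "weight x ^ A * cmod (f x) \<le> C * seminorm_R r f" if "f \<in> schwartz_R" for f :: "real^'n \<Rightarrow> complex" and x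
    using C(2)[of "\<lambda>z. f (snd z)" "(0, x)"] that by (simp add: lift_in_schwartz_TR_iff seminorm_TR_lift)
  then show ?thesis using that C(1) by blast
qed

lemma integral_schwartz_R_polynomial_growth:
  fixes w :: "real^'n \<Rightarrow> complex"
  assumes w: "w \<in> borel_measurable lebesgue" "\<And>x. cmod (w x) \<le> C * weight x ^ A"
    and f: "f \<in> schwartz_R"
  shows "integrable lebesgue (\<lambda>x. w x * f x)"
proof -
  obtain D r where "\<And>(f::real^'n \<Rightarrow> complex) x. f \<in> schwartz_R \<Longrightarrow> weight x ^ Suc A * cmod (f x) \<le> D * seminorm_R r f"
    using schwartz_R_weight_bound[of "Suc A"] by metis
  from integral_polynomial_growth(1)[OF w schwartz_R_continuous[OF f] this[OF f]] show ?thesis .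
qed

lemma distribution_of_add:
  fixes w :: "real^'n \<Rightarrow> complex"
  assumes w: "w \<in> borel_measurable lebesgue" "\<And>x. cmod (w x) \<le> C * weight x ^ A"
    and f: "f \<in> schwartz_R" and g: "g \<in> schwartz_R"
  shows "distribution_of w (\<lambda>x. f x + g x) = distribution_of w f + distribution_of w g"
  using integral_schwartz_R_polynomial_growth[OF w f] integral_schwartz_R_polynomial_growth[OF w g]
  by (simp add: distribution_of_def f g schwartz_R_add distrib_left)

lemma distribution_of_scale:
  "f \<in> schwartz_R \<Longrightarrow> distribution_of w (\<lambda>x. c * f x) = c * distribution_of w f"
  by (simp add: distribution_of_def schwartz_R_scale mult.left_commute[of _ c])

lemma distribution_of_tempered:
  fixes w :: "real^'n \<Rightarrow> complex"
  assumes w: "w \<in> borel_measurable lebesgue" "\<And>x. cmod (w x) \<le> C * weight x ^ A"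
  shows "distribution_of w \<in> tempered_R"
proof -
  obtain D r where D: "D \<ge> 0" "\<And>(f::real^'n \<Rightarrow> complex) x. f \<in> schwartz_R \<Longrightarrow> weight x ^ Suc A * cmod (f x) \<le> D * seminorm_R r f"
    using schwartz_R_weight_bound[of "Suc A"] by metis
  have C: "0 \<le> C" using order_trans[OF norm_ge_zero w(2)[of 0]] by (rule nonneg_of_mult_pos) simp
  let ?I = "LINT x|lborel. 1 / weight (x::real^'n)"
  have I: "0 \<le> ?I" by (intro integral_nonneg_AE AE_I2) (simp add: less_imp_le)
  show ?thesis unfolding tempered_R_def
  proof (rule topological_dualI[where C="C * D * ?I" and r=r])
    show "distribution_of w \<in> extensional schwartz_R" by (simp add: distribution_of_def)
    show "cmod (distribution_of w f) \<le> C * D * ?I * seminorm_R r f" if f: "f \<in> schwartz_R" for f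
      using integral_polynomial_growth(2)[OF w schwartz_R_continuous[OF f] D(2)[OF f]] f
      by (simp add: distribution_of_def mult_ac)
    show "seminorm_R r (\<lambda>x::real^'n. 0) = 0"
      by (rule trans[OF seminorm_TR_lift[where ?'m=1, symmetric] seminorm_TR_zero])
  qed (use D C I in \<open>auto intro!: distribution_of_add[OF w] distribution_of_scale schwartz_R_diff\<close>)
qed

text \<open>The exponents \<open>Suc A\<close> in both variables exceed the growth by one: the surplus in \<open>x\<close> pays for the integral, the
surplus in \<open>k\<close> remains and will pay for the sum.\<close>

lemma distribution_of_fourier_T_bound:
  fixes u :: "int^'m \<Rightarrow> real^'n \<Rightarrow> complex"
  assumes u: "\<And>k. u k \<in> borel_measurable lebesgue"
    and b: "\<And>k x. cmod (u k x) \<le> C * weight (real_vec k) ^ A * weight x ^ A"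
  obtains D r where "D \<ge> 0" "\<And>(f :: (real^'m) \<times> (real^'n) \<Rightarrow> complex) k. f \<in> schwartz_TR \<Longrightarrow>
     cmod (distribution_of (u k) (fourier_T f (- k))) \<le> D * seminorm_TR r f * (1 / weight (real_vec k))"
proof -
  obtain D r where D: "D \<ge> 0" "\<And>(f :: (real^'m) \<times> (real^'n) \<Rightarrow> complex) i. f \<in> schwartz_TR \<Longrightarrow>
     (case i of (k, x) \<Rightarrow> weight (real_vec k) ^ Suc A * (weight x ^ Suc A * cmod (fourier_T f k x))) \<le> D * seminorm_TR r f"
    by (rule controlledE[OF controlled_fourier_T[of "Suc A" "Suc A"]]) blast
  have "0 \<le> C * weight (real_vec 0 :: real^'m) ^ A"
    using order_trans[OF norm_ge_zero b[of 0 0]] by (rule nonneg_of_mult_pos) simp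
  then have C: "0 \<le> C" by (rule nonneg_of_mult_pos) simp
  let ?I = "LINT x|lborel. 1 / weight (x::real^'n)"
  have I: "0 \<le> ?I" by (intro integral_nonneg_AE AE_I2) (simp add: less_imp_le)
  have "cmod (distribution_of (u k) (fourier_T f (- k))) \<le> C * D * ?I * seminorm_TR r f * (1 / weight (real_vec k))"
    if f: "f \<in> schwartz_TR" for f :: "(real^'m) \<times> (real^'n) \<Rightarrow> complex" and k
  proof -
    let ?w = "weight (real_vec k)"
    have w: "0 < ?w" by simp
    have S: "fourier_T f (- k) \<in> schwartz_R" by (rule fourier_T_in_schwartz_R[OF f])
    have "weight x ^ Suc A * cmod (fourier_T f (- k) x) \<le> D * seminorm_TR r f / ?w ^ Suc A" for x
      using D(2)[OF f, of "(- k, x)"] w by (simp add: real_vec_uminus pos_le_divide_eq mult_ac)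
    from integral_polynomial_growth(2)[OF u[of k] b[of k] schwartz_R_continuous[OF S] this]
    have "cmod (distribution_of (u k) (fourier_T f (- k))) \<le> C * ?w ^ A * (D * seminorm_TR r f / ?w ^ Suc A) * ?I"
      unfolding distribution_of_def restrict_apply'[OF S] .
    also have "\<dots> = C * D * ?I * seminorm_TR r f * (1 / ?w)" using w by (simp add: field_simps)
    finally show ?thesis .
  qed
  then show ?thesis using that[of "C * D * ?I" r] C D(1) I by simp
qed

text \<open>Stated for arbitrary functionals \<open>U k\<close>, since only the decay of the terms of the series matters.\<close>

lemma controlled_dist_inv_fourier_T:
  fixes U :: "int^'m \<Rightarrow> (real^'n \<Rightarrow> complex) \<Rightarrow> complex"
  assumes D: "D \<ge> 0" "\<And>(f :: (real^'m) \<times> (real^'n) \<Rightarrow> complex) k. f \<in> schwartz_TR \<Longrightarrow>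
     cmod (U k (fourier_T f (- k))) \<le> D * seminorm_TR r f * (1 / weight (real_vec k))"
  shows "\<And>f. f \<in> schwartz_TR \<Longrightarrow> (\<lambda>k. cmod (U k (fourier_T f (- k)))) summable_on UNIV"
    and "controlled (\<lambda>f (i::unit). cmod (dist_inv_fourier_T U f))"
proof -
  let ?w = "\<lambda>k::int^'m. 1 / weight (real_vec k)"
  let ?J = "\<Sum>\<^sub>\<infinity>k. ?w k"
  have sw: "(\<lambda>k. c * ?w k) summable_on UNIV" for c :: real
    by (intro summable_on_cmult_right summable_inverse_frequency_weight)
  have J: "0 \<le> ?J" by (intro infsum_nonneg) (simp add: less_imp_le)
  show sm: "(\<lambda>k. cmod (U k (fourier_T f (- k)))) summable_on UNIV" if "f \<in> schwartz_TR" for f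
    by (rule summable_on_comparison_test[OF sw[of "D * seminorm_TR r f"]]) (use D(2)[OF that] in auto)
  show "controlled (\<lambda>f (i::unit). cmod (dist_inv_fourier_T U f))"
  proof (rule controlledI[of "(2 * pi) ^ CARD('m) * (D * ?J)" _ r])
    fix f :: "(real^'m) \<times> (real^'n) \<Rightarrow> complex" assume f: "f \<in> schwartz_TR"
    have "cmod (\<Sum>\<^sub>\<infinity>k. U k (fourier_T f (- k))) \<le> (\<Sum>\<^sub>\<infinity>k. cmod (U k (fourier_T f (- k))))"
      by (rule norm_infsum_bound[OF sm[OF f]])
    also have "\<dots> \<le> (\<Sum>\<^sub>\<infinity>k. D * seminorm_TR r f * ?w k)"
      by (rule infsum_mono[OF sm[OF f] sw]) (use D(2)[OF f] in auto)
    also have "\<dots> = D * seminorm_TR r f * ?J" by (rule infsum_cmult_right')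
    finally have "(2 * pi) ^ CARD('m) * cmod (\<Sum>\<^sub>\<infinity>k. U k (fourier_T f (- k))) \<le> (2 * pi) ^ CARD('m) * (D * seminorm_TR r f * ?J)"
      by (intro mult_left_mono) auto
    then show "cmod (dist_inv_fourier_T U f) \<le> (2 * pi) ^ CARD('m) * (D * ?J) * seminorm_TR r f"
      using f by (simp add: dist_inv_fourier_T_def norm_mult norm_power mult_ac)
  qed (use D J in auto)
qed

lemma dist_inv_fourier_R_tempered:
  fixes v :: "((real^'m) \<times> (real^'n) \<Rightarrow> complex) \<Rightarrow> complex"
  assumes add: "\<And>f g. f \<in> schwartz_TR \<Longrightarrow> g \<in> schwartz_TR \<Longrightarrow> v (\<lambda>z. f z + g z) = v f + v g"
    and scale: "\<And>c f. f \<in> schwartz_TR \<Longrightarrow> v (\<lambda>z. c * f z) = c * v f"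
    and ctrl: "controlled (\<lambda>f (i::unit). cmod (v f))"
  shows "dist_inv_fourier_R v \<in> tempered_TR"
proof (rule tempered_TR_I)
  show "dist_inv_fourier_R v \<in> extensional schwartz_TR" by (simp add: dist_inv_fourier_R_def)
  fix f g :: "(real^'m) \<times> (real^'n) \<Rightarrow> complex" and c
  assume f: "f \<in> schwartz_TR"
  have "inv_fourier_R (\<lambda>z. c * f z) = (\<lambda>z. c * inv_fourier_R f z)"
    by (simp add: inv_fourier_R_eq_osc_integral osc_integral_def fun_eq_iff mult.assoc)
  then show "dist_inv_fourier_R v (\<lambda>z. c * f z) = c * dist_inv_fourier_R v f"
    using f cts_op_in[OF cts_op_scale f] scale[OF cts_op_in[OF cts_op_inv_fourier_R f]] by (simp add: dist_inv_fourier_R_def)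
  assume g: "g \<in> schwartz_TR"
  have "osc_integral 1 (\<lambda>z. f z + g z) z = osc_integral 1 f z + osc_integral 1 g z" for z
    using osc_integrable[OF f, of "fst z" 1 "snd z"] osc_integrable[OF g, of "fst z" 1 "snd z"]
    by (simp add: osc_integral_def distrib_right)
  then have "inv_fourier_R (\<lambda>z. f z + g z) = (\<lambda>z. inv_fourier_R f z + inv_fourier_R g z)"
    by (simp add: inv_fourier_R_eq_osc_integral fun_eq_iff distrib_left add_divide_distrib)
  then show "dist_inv_fourier_R v (\<lambda>z. f z + g z) = dist_inv_fourier_R v f + dist_inv_fourier_R v g"
    using f g schwartz_TR_add[OF f g] add[OF cts_op_in[OF cts_op_inv_fourier_R f] cts_op_in[OF cts_op_inv_fourier_R g]]
    by (simp add: dist_inv_fourier_R_def)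
next
  show "controlled (\<lambda>f (i::unit). cmod (dist_inv_fourier_R v f))"
    by (rule controlled_mono[OF controlled_comp[OF ctrl cts_op_inv_fourier_R], of 1])
      (auto simp: dist_inv_fourier_R_def)
qed

text \<open>All transforms are transposes, so the left-hand side is the series evaluated at the Fourier inversion of a single
character times \<open>f\<close>; orthogonality reduces the series to one term.  The frequency \<open>- k\<close> of that character and the
sign in \<open>fourier_T _ (- l)\<close> cancel.\<close>

lemma dist_fourier_inversion:
  fixes U :: "int^'m \<Rightarrow> (real^'n \<Rightarrow> complex) \<Rightarrow> complex"
  assumes f: "f \<in> schwartz_R" and U0: "\<And>l. U l (\<lambda>x. 0) = 0"
  shows "dist_fourier_T (dist_fourier_R (dist_inv_fourier_R (dist_inv_fourier_T U))) k f = U k f"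
proof -
  let ?h = "modulate (- k) (\<lambda>z::(real^'m) \<times> (real^'n). f (snd z))"
  have h: "?h \<in> schwartz_TR"
    using f by (intro cts_op_in[OF cts_op_modulate]) (simp add: lift_in_schwartz_TR_iff)
  have e: "(\<lambda>(t, x). cis (- (real_vec k \<bullet> t)) * f x) = ?h"
    by (auto simp: modulate_def fun_eq_iff real_vec_uminus)
  have "dist_fourier_R (dist_inv_fourier_R (dist_inv_fourier_T U)) ?h = dist_inv_fourier_T U (inv_fourier_R (fourier_R ?h))"
    using h cts_op_in[OF cts_op_fourier_R h] by (simp add: dist_fourier_R_def dist_inv_fourier_R_def)
  also have "\<dots> = of_real ((2 * pi) ^ CARD('m)) * (\<Sum>\<^sub>\<infinity>l. U l (fourier_T ?h (- l)))"
    using h by (simp add: inv_fourier_R_fourier_R dist_inv_fourier_T_def)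
  also have "(\<Sum>\<^sub>\<infinity>l. U l (fourier_T ?h (- l))) = (\<Sum>\<^sub>\<infinity>l. if l = k then U k f else 0)"
    by (intro infsum_cong) (auto simp: fourier_T_modulate_lift[OF f] U0)
  also have "\<dots> = (\<Sum>\<^sub>\<infinity>l\<in>{k}. U k f)" by (rule infsum_cong_neutral) auto
  also have "\<dots> = U k f" by simp
  finally show ?thesis using f by (simp add: dist_fourier_T_def e)
qed

theorem corollary2p2:
  fixes u :: "int^'m \<Rightarrow> real^'n \<Rightarrow> complex"
  assumes "\<And>k. u k \<in> borel_measurable lebesgue"
    and "\<exists>N>0. \<exists>C>0. \<forall>k \<xi>.
      cmod (u k \<xi>) \<le> C * (1 + (norm (real_vec k))\<^sup>2) powr (N / 2) * (1 + (norm \<xi>)\<^sup>2) powr (N / 2)"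
  defines "U \<equiv> \<lambda>k. distribution_of (u k)"
  shows "(\<forall>k. \<forall>f\<in>schwartz_R. integrable lebesgue (\<lambda>\<xi>. u k \<xi> * f \<xi>)) \<and>
    (\<forall>k. U k \<in> tempered_R) \<and>
    (\<forall>f\<in>schwartz_TR. (\<lambda>k. U k (fourier_T f (- k))) summable_on UNIV) \<and>
    dist_inv_fourier_T U \<in> tempered_TR \<and>
    dist_inv_fourier_R (dist_inv_fourier_T U) \<in> tempered_TR \<and>
    (\<forall>k. dist_fourier_T (dist_fourier_R (dist_inv_fourier_R (dist_inv_fourier_T U))) k = U k)"
proof -
  note u = assms(1)
  obtain N C where N: "N > 0" and C: "C > 0" and NC: "\<And>k \<xi>.
      cmod (u k \<xi>) \<le> C * (1 + (norm (real_vec k))\<^sup>2) powr (N / 2) * (1 + (norm \<xi>)\<^sup>2) powr (N / 2)"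
    using assms(2) by blast
  define A where "A = nat \<lceil>N\<rceil>"
  have b: "cmod (u k \<xi>) \<le> C * weight (real_vec k) ^ A * weight \<xi> ^ A" for k \<xi>
    unfolding A_def
    by (rule order_trans[OF NC], intro mult_mono japanese_bracket_powr_le_weight)
      (use N C in \<open>auto intro!: mult_nonneg_nonneg simp: less_imp_le\<close>)
  obtain D r where D: "D \<ge> 0" "\<And>(f :: (real^'m) \<times> (real^'n) \<Rightarrow> complex) k. f \<in> schwartz_TR \<Longrightarrow>
     cmod (U k (fourier_T f (- k))) \<le> D * seminorm_TR r f * (1 / weight (real_vec k))"
    using distribution_of_fourier_T_bound[OF u b] unfolding U_def by metis
  have abs_sm: "(\<lambda>k. cmod (U k (fourier_T f (- k)))) summable_on UNIV" if "f \<in> schwartz_TR" for f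
    using controlled_dist_inv_fourier_T(1)[of D U r, OF D that] .
  have sm: "(\<lambda>k. U k (fourier_T f (- k))) summable_on UNIV" if "f \<in> schwartz_TR" for f
    using abs_sm[OF that] by (rule abs_summable_summable)
  have ctrl: "controlled (\<lambda>f (i::unit). cmod (dist_inv_fourier_T U f))"
    using controlled_dist_inv_fourier_T(2)[of D U r, OF D] .
  have add: "dist_inv_fourier_T U (\<lambda>z. f z + g z) = dist_inv_fourier_T U f + dist_inv_fourier_T U g"
    if f: "f \<in> schwartz_TR" and g: "g \<in> schwartz_TR" for f g
  proof -
    have "U k (fourier_T (\<lambda>z. f z + g z) (- k)) = U k (fourier_T f (- k)) + U k (fourier_T g (- k))" for k
      unfolding U_def fourier_T_add[OF f g]
      by (rule distribution_of_add[OF u b]) (intro fourier_T_in_schwartz_R f g)+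
    then show ?thesis
      using f g schwartz_TR_add[OF f g] infsum_add[OF sm[OF f] sm[OF g]]
      by (simp add: dist_inv_fourier_T_def distrib_left)
  qed
  have scale: "dist_inv_fourier_T U (\<lambda>z. c * f z) = c * dist_inv_fourier_T U f" if f: "f \<in> schwartz_TR" for c f
  proof -
    have "U k (fourier_T (\<lambda>z. c * f z) (- k)) = c * U k (fourier_T f (- k))" for k
      unfolding U_def fourier_T_scale by (rule distribution_of_scale[OF fourier_T_in_schwartz_R[OF f]])
    then show ?thesis
      using f cts_op_in[OF cts_op_scale f] by (simp add: dist_inv_fourier_T_def infsum_cmult_right')
  qed
  have "dist_fourier_T (dist_fourier_R (dist_inv_fourier_R (dist_inv_fourier_T U))) k = U k" for k
  proof (rule extensionalityI[of _ schwartz_R])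
    show "dist_fourier_T (dist_fourier_R (dist_inv_fourier_R (dist_inv_fourier_T U))) k \<in> extensional schwartz_R"
      by (simp add: dist_fourier_T_def)
    show "U k \<in> extensional schwartz_R" by (simp add: U_def distribution_of_def)
    have "U l (\<lambda>x. 0) = 0" for l
      by (simp add: U_def distribution_of_def schwartz_R_zero)
    then show "dist_fourier_T (dist_fourier_R (dist_inv_fourier_R (dist_inv_fourier_T U))) k f = U k f"
      if "f \<in> schwartz_R" for f using that by (intro dist_fourier_inversion)
  qed
  moreover have "dist_inv_fourier_T U \<in> tempered_TR"
    by (rule tempered_TR_I[OF _ add scale ctrl]) (auto simp only: dist_inv_fourier_T_def restrict_extensional)
  moreover have "dist_inv_fourier_R (dist_inv_fourier_T U) \<in> tempered_TR"
    by (rule dist_inv_fourier_R_tempered[OF add scale ctrl])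
  moreover have "U k \<in> tempered_R" for k
    unfolding U_def by (rule distribution_of_tempered[OF u b])
  moreover have "integrable lebesgue (\<lambda>\<xi>. u k \<xi> * f \<xi>)" if "f \<in> schwartz_R" for k f
    by (rule integral_schwartz_R_polynomial_growth[OF u b that])
  ultimately show ?thesis using sm by blast
qed

end
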